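(* Let $n\ge 1$ and $0<\delta<1$, let $\Psi$ satisfy conditions (i)–(iii) of the context, and let $\underline\psi$ and $\overline\psi$ be a (continuous) viscosity subsolution and a (continuous) viscosity supersolution, respectively, both of class $(\Psi)$, to $$(\mathrm E)\qquad v_t+\mathcal L^{n,\delta}[v]=0\ \text{ on } \mathcal D_\delta,\qquad v=\Psi\ \text{ on } \mathcal D^{*,c}_\delta ,$$ with $\overline\psi=\underline\psi=\Psi$ on $\mathcal D^{*,c}_\delta$ (such functions exist). Let $\mathcal F$ be the set of all (continuous) viscosity subsolutions $v$ of class $(\Psi)$ to $(\mathrm E)$ on $\mathcal D_\delta$ such that $\underline\psi\le v\le\overline\psi$, and put $u(\theta)=\sup_{v\in\mathcal F}v(\theta)$, $\theta\in D_\delta$. Let $$u^*(\theta)=\lim_{\rho\downarrow0}\sup\{u(\eta):\eta\in\mathcal D_\delta,\ |\eta-\theta|\le \rho\},\qquad u_*(\theta)=\lim_{\rho\downarrow0}\inf\{u(\eta):\eta\in\mathcal D_\delta,\ |\eta-\theta|\le \rho\}.$$ Then $u^*$ (resp. $u_*$) is a viscosity subsolution (resp. supersolution) of class $(\Psi)$ to $(\mathrm E)$ on $\mathcal D_\delta$.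
   Context: **Data.** Fix $T>0$, positive constants $p,r,\mu,\sigma,c$ and $M\ge p$. $F$ is an absolutely continuous distribution function on $[0,\infty)$ with density $f$, $\bar F=1-F$, and intensity $\lambda(t)=f(t)/\bar F(t)>0$, $t\in[0,T]$. $G$ is a continuous distribution function on $[0,\infty)$ with density $g$. Whenever $\lambda(w)$ is used for $w\in[-1,T+1]$, $\lambda$ is understood as a bounded continuous function there. **Hamiltonians.** For $\theta=(s,x,w)$, $\xi=(\xi^1,\xi^2)\in\mathbb R^2$, $y,A,z\in\mathbb R$, $(\gamma,a)\in[0,1]\times[0,M]$, $$H(\theta,y,\xi,A,z,\gamma,a)=\tfrac{\sigma^2}{2}\gamma^2x^2A+[p+(r+(\mu-r)\gamma)x-a]\xi^1+\xi^2+\lambda(w)z+(a-cy).$$ Fix $\varepsilon_n>0$, $\varepsilon_n\downarrow0$, and set $H^n(\theta,y,\xi,A_1,A_2,z,\gamma,a)=H(\theta,y,\xi,A_1,z,\gamma,a)+\frac{\varepsilon_n}{2}A_1+\frac{\varepsilon_n}{2}A_2$. **Domains.** For $0<\delta\le 1$: $D_\delta=\{(s,x,w):0<s\le T+\delta,\ x\ge-\delta,\ -\delta\le w\le s+\delta\}$, $\mathcal D_\delta=\mathrm{int}\,D_\delta$. For $0<s<T+\delta$ let $\mathcal D_{\delta,s}=\{(x,w):x>-\delta,\ -\delta<w<s+\delta\}$, and $$\mathcal D^{*,c}_\delta=(\{T+\delta\}\times\mathbb R^2)\cup\bigcup_{0<s<T+\delta}\{s\}\times(\mathbb R^2\setminus\mathcal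 D_{\delta,s}).$$ **Operators.** With $\nabla\varphi=(\varphi_x,\varphi_w)$, $$I^\delta[\varphi](s,x,w)=\int_0^{x+\delta}\varphi(s,x-u,-\delta)\,dG(u)-\varphi(s,x,w),$$ $$\mathcal L^{n,\delta}[\varphi](\theta)=\sup_{\gamma\in[0,1],a\in[0,M]}H^n(\theta,\varphi,\nabla\varphi,\varphi_{xx},\varphi_{ww},I^\delta[\varphi],\gamma,a).$$ **Conditions on $\Psi\in C^{1,3,3}(\mathbb R^3)$.** (i) There is $K_1>0$ with $0\le\Psi\le K_1$ on $D_1$, and $\Psi=0$ on $D_1^c$. (ii) There is $0<K_2<M$ such that for all $\theta\in D_1$, $0<\delta<1$, $n\ge1$: $M-K_2\le\Psi_t+H^n(\theta,\Psi,\nabla\Psi,\Psi_{xx},\Psi_{ww},I^\delta[\Psi],0,M)$. (iii) $\Psi$ is strictly increasing in $x$ on the interior of $D_1$ and, for some $0<\delta_0<1$, $b:=\inf\{\Psi_x(s,x,w):s\in(0,T],x\in[-\delta_0,0],w\in[0,s]\}>1$. **Class $(\Psi)$.** A function $v$ is of class $(\Psi)$ if (1) $v=\Psi$ on $\mathcal D^{*,c}_\delta$; (2) $v$ is increasing in $x$ on $D_\delta$; (3) $v$ is bounded on $D_\delta$; (4) $v(s,x,w)-v(s,-\delta,w)\ge x+\delta$ as $x\downarrow-\delta$ (i.e. for $x$ close to $-\delta$), for any $0\le s\le T+\delta$, $-\delta\le w\le s+\delta$. (The functions $u^*,u_*$ are set equal to $\Psi$ at points of $\mathcal D^{*,c}_\delta$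 outside $D_\delta$.) **Viscosity solutions.** $C^{1,2,2}_0(D_\delta)$ is the set of $\varphi\in C^{1,2,2}(\mathcal D_\delta)$ such that $\varphi$ and its derivatives $\varphi_t,\varphi_x,\varphi_{xx},\varphi_w,\varphi_{ww}$ extend continuously to $D_\delta$, with $\varphi=0$ off $D_\delta$. An upper semicontinuous (resp. lower semicontinuous) function $v$ on $D_\delta$ is a viscosity subsolution (resp. supersolution) on $\mathcal D_\delta$ if whenever $\theta_0\in\mathcal D_\delta$ and $\varphi\in C^{1,2,2}_0(D_\delta)$ satisfy $0=(v-\varphi)(\theta_0)=\max_{\mathcal D_\delta}(v-\varphi)$ (resp. $\min$), then $\varphi_t(\theta_0)+\mathcal L^{n,\delta}[\varphi](\theta_0)\ge0$ (resp. $\le0$).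
   Formalization: Ψ need only agree on D_1 with a C^{1,3,3}(R^3) function, as smoothness across the boundary of D_1 contradicts (i) and (iii); λ is bounded continuous on [-1,T+2], since w reaches T+2 in (ii); class (Ψ)(4) is for s>0, v having no value at s=0; the set F is assumed nonempty. *)

theory Defs
  imports "HOL-Probability.Probability"
begin

section \<open>Data\<close>

text \<open>Points of \<open>\<real>\<^sup>3\<close> are triples \<open>(s, x, w)\<close>; the product type carries the Euclidean distance.\<close>

type_synonym pt = "real \<times> real \<times> real"

record model =
  horizon :: real                  \<comment> \<open>\<open>T\<close>\<close>
  premium :: real                  \<comment> \<open>\<open>p\<close>\<close>
  rate :: real                     \<comment> \<open>\<open>r\<close>\<close>
  drift :: real                    \<comment> \<open>\<open>\<mu>\<close>\<close>
  vola :: real                     \<comment> \<open>\<open>\<sigma>\<close>\<close>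
  discount :: real                 \<comment> \<open>\<open>c\<close>\<close>
  maxdiv :: real                   \<comment> \<open>\<open>M\<close>\<close>
  cdfF :: "real \<Rightarrow> real"           \<comment> \<open>\<open>F\<close>\<close>
  densF :: "real \<Rightarrow> real"          \<comment> \<open>\<open>f\<close>\<close>
  intensity :: "real \<Rightarrow> real"      \<comment> \<open>\<open>\<lambda>\<close>, including its extension beyond \<open>[0,T]\<close>\<close>
  cdfG :: "real \<Rightarrow> real"           \<comment> \<open>\<open>G\<close>\<close>
  densG :: "real \<Rightarrow> real"          \<comment> \<open>\<open>g\<close>\<close>
  epsseq :: "nat \<Rightarrow> real"          \<comment> \<open>\<open>\<epsilon>\<^sub>n\<close>, used for \<open>n \<ge> 1\<close> only\<close>

definition distribution_with_density :: "(real \<Rightarrow> real) \<Rightarrow> (real \<Rightarrow> real) \<Rightarrow> bool" where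
  "distribution_with_density F f \<longleftrightarrow>
     f \<in> borel_measurable borel \<and> (\<forall>t. 0 \<le> f t) \<and> (\<forall>t<0. f t = 0) \<and>
     real_distribution (density lborel (\<lambda>t. ennreal (f t))) \<and>
     F = cdf (density lborel (\<lambda>t. ennreal (f t)))"

text \<open>The intensity is required to be bounded and continuous on \<open>[-1, T + 2]\<close>: this is the range of
  the third coordinate on \<open>D\<^sub>1\<close> (where \<open>w \<le> s + 1 \<le> T + 2\<close>), hence contains every \<open>w\<close> at which
  \<open>\<lambda>\<close> is evaluated.\<close>

definition standing_data :: "model \<Rightarrow> bool" where
  "standing_data m \<longleftrightarrow>
     horizon m > 0 \<and> premium m > 0 \<and> rate m > 0 \<and> drift m > 0 \<and> vola m > 0 \<and> discount m > 0 \<and>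
     maxdiv m \<ge> premium m \<and>
     distribution_with_density (cdfF m) (densF m) \<and>
     (\<forall>t\<in>{0..horizon m}. intensity m t = densF m t / (1 - cdfF m t) \<and> intensity m t > 0) \<and>
     continuous_on {-1..horizon m + 2} (intensity m) \<and>
     bounded (intensity m ` {-1..horizon m + 2}) \<and>
     distribution_with_density (cdfG m) (densG m) \<and>
     (\<forall>n\<ge>1. epsseq m n > 0) \<and> (\<forall>n\<ge>1. epsseq m (Suc n) \<le> epsseq m n) \<and>
     epsseq m \<longlonglongrightarrow> 0"


section \<open>Partial derivatives and regularity\<close>

definition Dt :: "(pt \<Rightarrow> real) \<Rightarrow> pt \<Rightarrow> real" where
  "Dt \<phi> = (\<lambda>(s, x, w). deriv (\<lambda>r. \<phi> (r, x, w)) s)"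

definition Dx :: "(pt \<Rightarrow> real) \<Rightarrow> pt \<Rightarrow> real" where
  "Dx \<phi> = (\<lambda>(s, x, w). deriv (\<lambda>y. \<phi> (s, y, w)) x)"

definition Dw :: "(pt \<Rightarrow> real) \<Rightarrow> pt \<Rightarrow> real" where
  "Dw \<phi> = (\<lambda>(s, x, w). deriv (\<lambda>v. \<phi> (s, x, v)) w)"

text \<open>\<open>C\<^sup>1\<^sup>,\<^sup>k\<^sup>,\<^sup>k(S)\<close> for open \<open>S\<close>: one derivative in \<open>s\<close> and \<open>k\<close> pure derivatives in each
  of \<open>x\<close> and \<open>w\<close>, all jointly continuous. No mixed derivatives are involved.\<close>

definition C1kk :: "nat \<Rightarrow> pt set \<Rightarrow> (pt \<Rightarrow> real) \<Rightarrow> bool" where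
  "C1kk k S \<phi> \<longleftrightarrow>
     (\<forall>(s, x, w)\<in>S. (\<lambda>r. \<phi> (r, x, w)) field_differentiable at s) \<and>
     (\<forall>j<k. \<forall>(s, x, w)\<in>S.
        (\<lambda>y. (Dx ^^ j) \<phi> (s, y, w)) field_differentiable at x \<and>
        (\<lambda>v. (Dw ^^ j) \<phi> (s, x, v)) field_differentiable at w) \<and>
     continuous_on S (Dt \<phi>) \<and>
     (\<forall>j\<le>k. continuous_on S ((Dx ^^ j) \<phi>) \<and> continuous_on S ((Dw ^^ j) \<phi>))"


section \<open>Domains\<close>

definition Dom :: "model \<Rightarrow> real \<Rightarrow> pt set" where
  "Dom m \<delta> = {(s, x, w). 0 < s \<and> s \<le> horizon m + \<delta> \<and> x \<ge> -\<delta> \<and> -\<delta> \<le> w \<and> w \<le> s + \<delta>}"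

abbreviation iDom :: "model \<Rightarrow> real \<Rightarrow> pt set" where
  "iDom m \<delta> \<equiv> interior (Dom m \<delta>)"

definition slice :: "real \<Rightarrow> real \<Rightarrow> (real \<times> real) set" where
  "slice \<delta> s = {(x, w). x > -\<delta> \<and> -\<delta> < w \<and> w < s + \<delta>}"

definition Dstarc :: "model \<Rightarrow> real \<Rightarrow> pt set" where
  "Dstarc m \<delta> = ({horizon m + \<delta>} \<times> UNIV) \<union>
     (\<Union>s\<in>{0<..<horizon m + \<delta>}. {s} \<times> (UNIV - slice \<delta> s))"


section \<open>Hamiltonians and operators\<close>

definition Ham :: "model \<Rightarrow> pt \<Rightarrow> real \<Rightarrow> real \<times> real \<Rightarrow> real \<Rightarrow> real \<Rightarrow> real \<Rightarrow> real \<Rightarrow> real" where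
  "Ham m \<theta> y \<xi> A z \<gamma> a = (case (\<theta>, \<xi>) of ((s, x, w), (\<xi>1, \<xi>2)) \<Rightarrow>
     (vola m)^2 / 2 * \<gamma>^2 * x^2 * A
     + (premium m + (rate m + (drift m - rate m) * \<gamma>) * x - a) * \<xi>1
     + \<xi>2 + intensity m w * z + (a - discount m * y))"

definition Hamn :: "model \<Rightarrow> nat \<Rightarrow> pt \<Rightarrow> real \<Rightarrow> real \<times> real \<Rightarrow> real \<Rightarrow> real \<Rightarrow> real \<Rightarrow> real \<Rightarrow> real \<Rightarrow> real" where
  "Hamn m n \<theta> y \<xi> A1 A2 z \<gamma> a =
     Ham m \<theta> y \<xi> A1 z \<gamma> a + epsseq m n / 2 * A1 + epsseq m n / 2 * A2"

text \<open>For \<open>x < -\<delta>\<close> the range of integration is empty and the integral is \<open>0\<close>; since \<open>G\<close> puts no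
  mass on \<open>(-\<infinity>, 0]\<close>, this agrees with the oriented integral from \<open>0\<close> to \<open>x + \<delta>\<close>.\<close>

definition Iop :: "model \<Rightarrow> real \<Rightarrow> (pt \<Rightarrow> real) \<Rightarrow> pt \<Rightarrow> real" where
  "Iop m \<delta> \<phi> = (\<lambda>(s, x, w).
     (LINT u:{0..x + \<delta>}|interval_measure (cdfG m). \<phi> (s, x - u, -\<delta>)) - \<phi> (s, x, w))"

definition Lop :: "model \<Rightarrow> nat \<Rightarrow> real \<Rightarrow> (pt \<Rightarrow> real) \<Rightarrow> pt \<Rightarrow> real" where
  "Lop m n \<delta> \<phi> \<theta> = (SUP (\<gamma>, a)\<in>{0..1} \<times> {0..maxdiv m}.
     Hamn m n \<theta> (\<phi> \<theta>) (Dx \<phi> \<theta>, Dw \<phi> \<theta>) (Dx (Dx \<phi>) \<theta>) (Dw (Dw \<phi>) \<theta>) (Iop m \<delta> \<phi> \<theta>) \<gamma> a)"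


section \<open>Conditions on \<open>\<Psi>\<close>\<close>

text \<open>
  A function that is continuous on all of \<open>\<real>\<^sup>3\<close> and vanishes off \<open>D\<^sub>1\<close> vanishes for \<open>s = 0\<close>,
  whereas \<open>\<Psi>\<^sub>x > 1\<close> on \<open>(0,T] \<times> [-\<delta>\<^sub>0,0] \<times> [0,s]\<close> forces
  \<open>\<Psi>(s,0,0) - \<Psi>(s,-\<delta>\<^sub>0,0) > \<delta>\<^sub>0\<close> for all small \<open>s > 0\<close>. So smoothness of \<open>\<Psi>\<close> across the
  boundary of \<open>D\<^sub>1\<close> is incompatible with the remaining conditions. Here \<open>\<Psi>\<close> is therefore the
  restriction to \<open>D\<^sub>1\<close>, continued by \<open>0\<close>, of a function \<open>\<Psi>s \<in> C\<^sup>1\<^sup>,\<^sup>3\<^sup>,\<^sup>3(\<real>\<^sup>3)\<close>. The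
  derivatives of \<open>\<Psi>s\<close> on \<open>D\<^sub>1\<close>, boundary points included, are determined by \<open>\<Psi>\<close>;
  they are what \<open>\<Psi>\<^sub>t, \<Psi>\<^sub>x, \<dots>\<close> mean on \<open>D\<^sub>1\<close>. The case \<open>\<Psi>s = \<Psi>\<close> is the one of a \<open>\<Psi>\<close>
  that is itself in \<open>C\<^sup>1\<^sup>,\<^sup>3\<^sup>,\<^sup>3(\<real>\<^sup>3)\<close>.
\<close>

definition Psi_conditions :: "model \<Rightarrow> (pt \<Rightarrow> real) \<Rightarrow> bool" where
  "Psi_conditions m \<Psi> \<longleftrightarrow> (\<exists>\<Psi>s. C1kk 3 UNIV \<Psi>s \<and> (\<forall>\<theta>\<in>Dom m 1. \<Psi> \<theta> = \<Psi>s \<theta>) \<and>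
     ((\<exists>K1>0. \<forall>\<theta>\<in>Dom m 1. 0 \<le> \<Psi> \<theta> \<and> \<Psi> \<theta> \<le> K1) \<and> (\<forall>\<theta>. \<theta> \<notin> Dom m 1 \<longrightarrow> \<Psi> \<theta> = 0)) \<and>
     (\<exists>K2. 0 < K2 \<and> K2 < maxdiv m \<and>
        (\<forall>\<theta>\<in>Dom m 1. \<forall>\<delta>\<in>{0<..<1}. \<forall>n\<ge>1.
           maxdiv m - K2 \<le> Dt \<Psi>s \<theta> +
             Hamn m n \<theta> (\<Psi>s \<theta>) (Dx \<Psi>s \<theta>, Dw \<Psi>s \<theta>) (Dx (Dx \<Psi>s) \<theta>) (Dw (Dw \<Psi>s) \<theta>)
               (Iop m \<delta> \<Psi>s \<theta>) 0 (maxdiv m))) \<and>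
     (\<forall>s x x' w. (s, x, w) \<in> iDom m 1 \<and> (s, x', w) \<in> iDom m 1 \<and> x < x' \<longrightarrow>
        \<Psi> (s, x, w) < \<Psi> (s, x', w)) \<and>
     (\<exists>\<delta>0. 0 < \<delta>0 \<and> \<delta>0 < 1 \<and>
        Inf {Dx \<Psi>s (s, x, w) | s x w. s \<in> {0<..horizon m} \<and> x \<in> {-\<delta>0..0} \<and> w \<in> {0..s}} > 1))"


section \<open>Class \<open>(\<Psi>)\<close>\<close>

text \<open>In the last condition \<open>s > 0\<close>, since functions on \<open>D\<^sub>\<delta>\<close> have no values at \<open>s = 0\<close>.\<close>

definition class_Psi :: "model \<Rightarrow> real \<Rightarrow> (pt \<Rightarrow> real) \<Rightarrow> (pt \<Rightarrow> real) \<Rightarrow> bool" where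
  "class_Psi m \<delta> \<Psi> v \<longleftrightarrow>
     (\<forall>\<theta>\<in>Dstarc m \<delta>. v \<theta> = \<Psi> \<theta>) \<and>
     (\<forall>s x x' w. (s, x, w) \<in> Dom m \<delta> \<and> (s, x', w) \<in> Dom m \<delta> \<and> x \<le> x' \<longrightarrow>
        v (s, x, w) \<le> v (s, x', w)) \<and>
     bounded (v ` Dom m \<delta>) \<and>
     (\<forall>s w. 0 < s \<and> s \<le> horizon m + \<delta> \<and> -\<delta> \<le> w \<and> w \<le> s + \<delta> \<longrightarrow>
        (\<forall>\<^sub>F x in at_right (-\<delta>). v (s, x, w) - v (s, -\<delta>, w) \<ge> x + \<delta>))"


section \<open>Viscosity sub- and supersolutions\<close>

text \<open>A test function \<open>\<phi>\<close> takes on \<open>D\<^sub>\<delta>\<close> the values of its continuous extension from the interior.\<close>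

definition test_fun :: "model \<Rightarrow> real \<Rightarrow> (pt \<Rightarrow> real) \<Rightarrow> bool" where
  "test_fun m \<delta> \<phi> \<longleftrightarrow>
     C1kk 2 (iDom m \<delta>) \<phi> \<and> continuous_on (Dom m \<delta>) \<phi> \<and>
     (\<forall>h\<in>{Dt \<phi>, Dx \<phi>, Dx (Dx \<phi>), Dw \<phi>, Dw (Dw \<phi>)}.
        \<exists>e. continuous_on (Dom m \<delta>) e \<and> (\<forall>\<theta>\<in>iDom m \<delta>. e \<theta> = h \<theta>)) \<and>
     (\<forall>\<theta>. \<theta> \<notin> Dom m \<delta> \<longrightarrow> \<phi> \<theta> = 0)"

definition usc_on :: "pt set \<Rightarrow> (pt \<Rightarrow> real) \<Rightarrow> bool" where
  "usc_on S v \<longleftrightarrow> (\<forall>\<theta>\<in>S. \<forall>y>v \<theta>. \<forall>\<^sub>F \<eta> in at \<theta> within S. v \<eta> < y)"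

definition lsc_on :: "pt set \<Rightarrow> (pt \<Rightarrow> real) \<Rightarrow> bool" where
  "lsc_on S v \<longleftrightarrow> (\<forall>\<theta>\<in>S. \<forall>y<v \<theta>. \<forall>\<^sub>F \<eta> in at \<theta> within S. y < v \<eta>)"

definition visc_subsolution :: "model \<Rightarrow> nat \<Rightarrow> real \<Rightarrow> (pt \<Rightarrow> real) \<Rightarrow> bool" where
  "visc_subsolution m n \<delta> v \<longleftrightarrow> usc_on (Dom m \<delta>) v \<and>
     (\<forall>\<theta>0\<in>iDom m \<delta>. \<forall>\<phi>. test_fun m \<delta> \<phi> \<and> v \<theta>0 - \<phi> \<theta>0 = 0 \<and> (\<forall>\<theta>\<in>iDom m \<delta>. v \<theta> - \<phi> \<theta> \<le> 0) \<longrightarrow>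
        Dt \<phi> \<theta>0 + Lop m n \<delta> \<phi> \<theta>0 \<ge> 0)"

definition visc_supersolution :: "model \<Rightarrow> nat \<Rightarrow> real \<Rightarrow> (pt \<Rightarrow> real) \<Rightarrow> bool" where
  "visc_supersolution m n \<delta> v \<longleftrightarrow> lsc_on (Dom m \<delta>) v \<and>
     (\<forall>\<theta>0\<in>iDom m \<delta>. \<forall>\<phi>. test_fun m \<delta> \<phi> \<and> v \<theta>0 - \<phi> \<theta>0 = 0 \<and> (\<forall>\<theta>\<in>iDom m \<delta>. v \<theta> - \<phi> \<theta> \<ge> 0) \<longrightarrow>
        Dt \<phi> \<theta>0 + Lop m n \<delta> \<phi> \<theta>0 \<le> 0)"


section \<open>The Perron family and its envelopes\<close>

text \<open>The boundary condition \<open>v = \<Psi>\<close> of the boundary value problem is part of \<^const>\<open>class_Psi\<close>.\<close>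

definition perron_family ::
  "model \<Rightarrow> nat \<Rightarrow> real \<Rightarrow> (pt \<Rightarrow> real) \<Rightarrow> (pt \<Rightarrow> real) \<Rightarrow> (pt \<Rightarrow> real) \<Rightarrow> (pt \<Rightarrow> real) set" where
  "perron_family m n \<delta> \<Psi> \<psi>l \<psi>u =
     {v. continuous_on (Dom m \<delta>) v \<and> visc_subsolution m n \<delta> v \<and> class_Psi m \<delta> \<Psi> v \<and>
         (\<forall>\<theta>\<in>Dom m \<delta>. \<psi>l \<theta> \<le> v \<theta> \<and> v \<theta> \<le> \<psi>u \<theta>)}"

definition upper_envelope :: "model \<Rightarrow> real \<Rightarrow> (pt \<Rightarrow> real) \<Rightarrow> (pt \<Rightarrow> real) \<Rightarrow> pt \<Rightarrow> real" where
  "upper_envelope m \<delta> \<Psi> u \<theta> =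
     (if \<theta> \<in> Dom m \<delta>
      then Lim (at_right 0) (\<lambda>\<rho>. SUP \<eta>\<in>{\<eta>\<in>iDom m \<delta>. dist \<eta> \<theta> \<le> \<rho>}. u \<eta>)
      else \<Psi> \<theta>)"

definition lower_envelope :: "model \<Rightarrow> real \<Rightarrow> (pt \<Rightarrow> real) \<Rightarrow> (pt \<Rightarrow> real) \<Rightarrow> pt \<Rightarrow> real" where
  "lower_envelope m \<delta> \<Psi> u \<theta> =
     (if \<theta> \<in> Dom m \<delta>
      then Lim (at_right 0) (\<lambda>\<rho>. INF \<eta>\<in>{\<eta>\<in>iDom m \<delta>. dist \<eta> \<theta> \<le> \<rho>}. u \<eta>)
      else \<Psi> \<theta>)"

end

theory Submission
  imports Defs
begin

text \<open>
  The envelopes inherit class \<open>(\<Psi>)\<close> because \<open>\<psi>\<^sub>l \<le> u\<^sub>* \<le> u\<^sup>* \<le> \<psi>\<^sub>u\<close>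
  on \<open>D\<^sub>\<delta>\<close>, with equality on its boundary.

  A test function \<open>\<phi>\<close> touching \<open>u\<^sup>*\<close> from above is perturbed to \<open>\<phi> + \<kappa> h\<close> with a quartic \<open>h\<close>
  centred at the touching point; some subsolution of the family is then touched nearby, and the inequality
  passes to the limit \<open>\<kappa> \<rightarrow> 0\<close>, the nonlocal term by dominated convergence.

  If \<open>u\<^sub>*\<close> were not a supersolution, then \<open>\<phi> - h + c/4\<close> would be a strict classical subsolution near a
  touching point. By compactness a single \<open>v\<close> of the family lies above it where \<open>c/2 \<le> h \<le> c\<close>, so
  pasting the maximum of both into \<open>v\<close> gives a continuous function. Since members of the family have to
  be increasing in \<open>x\<close>, its running maximum in \<open>x\<close> is taken; this is still a subsolution, belongs to the
  family, and exceeds \<open>u\<close> somewhere.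
\<close>

section \<open>One-sided limits and the Hamiltonian\<close>

text \<open>The equation is tested at interior points only, but its nonlocal term reads test
  functions on the face w = -\<delta>. Where jump integrals have to be compared, inequalities known
  in the interior are therefore extended to D by continuity, and on that face all functions of class
  (\<Psi>) share the values of \<Psi>.

  The running maximum is the main obstacle. It may be attained at some x' < x, so the strict
  inequality of the bump at x' has to be carried to x although the Hamiltonian depends on x. There
  the bump is flat and concave in x, which lets the choice \<gamma> = 0 remove the dependence on x.
  The jump integrals are compared jump by jump, with \<Psi> \<ge> 0 absorbing the longer range of
  integration. This needs a nonnegative intensity at every w of the open domain, while the data give
  its sign on [0, T] only; the sign is recovered from the lower barrier.

  A bump also needs room below \<open>\<psi>u\<close>. Where \<open>ul\<close> already equals
  \<open>\<psi>u\<close> there is none, but there the test function touches \<open>\<psi>u\<close>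
  itself.\<close>

lemma tendsto_at_right_0_mono:
  fixes f :: "real \<Rightarrow> real"
  assumes mono: "\<And>a b. 0 < a \<Longrightarrow> a \<le> b \<Longrightarrow> f a \<le> f b" and bd: "\<And>a. 0 < a \<Longrightarrow> B \<le> f a"
  shows "(f \<longlongrightarrow> (INF a\<in>{0<..}. f a)) (at_right 0)"
proof -
  have bdd: "bdd_below (f ` {0<..})" using bd by (auto intro!: bdd_belowI2)
  show ?thesis
  proof (rule order_tendstoI)
    fix a assume a: "a < (INF a\<in>{0<..}. f a)"
    have "a < f x" if "x > 0" for x
      using a cINF_lower[OF bdd, of x] that by auto
    then show "\<forall>\<^sub>F x in at_right 0. a < f x"
      by (auto simp: eventually_at_right[of 0 1] intro!: exI[of _ 1])
  next
    fix a assume "(INF a\<in>{0<..}. f a) < a"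
    then obtain b where "b > 0" "f b < a" using bdd by (subst (asm) cINF_less_iff) auto
    then show "\<forall>\<^sub>F x in at_right 0. f x < a"
      using mono by (auto simp: eventually_at_right[of 0 1] intro!: exI[of _ b])
        (metis less_imp_le le_less_trans)
  qed
qed

text \<open>The supremum over a ball is monotone in the radius, and bounded below because a point of
  the closure keeps every ball nonempty in S; so the limit is the infimum over all radii. The last
  two parts are the forms in which the limit is used later.\<close>

lemma upper_limit_tendsto:
  fixes u :: "'a::metric_space \<Rightarrow> real"
  assumes \<theta>: "\<theta> \<in> closure S" and bd: "bounded (u ` S)"
  defines "g \<equiv> \<lambda>\<rho>. SUP \<eta>\<in>{\<eta>\<in>S. dist \<eta> \<theta> \<le> \<rho>}. u \<eta>"
  shows "(g \<longlongrightarrow> (INF \<rho>\<in>{0<..}. g \<rho>)) (at_right 0)"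
    and "(INF \<rho>\<in>{0<..}. g \<rho>) < y \<Longrightarrow> \<exists>\<rho>>0. \<forall>\<eta>\<in>S. dist \<eta> \<theta> \<le> \<rho> \<longrightarrow> u \<eta> < y"
    and "y < (INF \<rho>\<in>{0<..}. g \<rho>) \<Longrightarrow> \<rho> > 0 \<Longrightarrow> \<exists>\<eta>\<in>S. dist \<eta> \<theta> \<le> \<rho> \<and> y < u \<eta>"
proof -
  obtain B where B: "\<And>\<eta>. \<eta> \<in> S \<Longrightarrow> \<bar>u \<eta>\<bar> \<le> B" using bd unfolding bounded_iff by auto
  have bdd: "bdd_above (u ` {\<eta>\<in>S. dist \<eta> \<theta> \<le> \<rho>})" for \<rho>
    using B by (intro bdd_aboveI2[of _ _ B]) (fastforce simp: abs_le_iff)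
  have ne: "{\<eta>\<in>S. dist \<eta> \<theta> \<le> \<rho>} \<noteq> {}" if "\<rho> > 0" for \<rho>
    using \<theta> that unfolding closure_approachable by (auto dest!: spec[of _ \<rho>] intro: less_imp_le)
  have mono: "g a \<le> g b" if "0 < a" "a \<le> b" for a b
    unfolding g_def using that ne[OF that(1)] bdd by (intro cSUP_subset_mono) auto
  have low: "- B \<le> g a" if a: "0 < a" for a
  proof -
    obtain \<eta> where \<eta>: "\<eta> \<in> S" "dist \<eta> \<theta> \<le> a" using ne[OF a] by auto
    then have "u \<eta> \<le> g a" unfolding g_def using bdd by (intro cSUP_upper) auto
    then show ?thesis using B[OF \<eta>(1)] by auto
  qed
  show "(g \<longlongrightarrow> (INF \<rho>\<in>{0<..}. g \<rho>)) (at_right 0)"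
    using tendsto_at_right_0_mono[of g "-B"] mono low by blast
  have bddb: "bdd_below (g ` {0<..})" using low by (auto intro!: bdd_belowI2)
  show "\<exists>\<rho>>0. \<forall>\<eta>\<in>S. dist \<eta> \<theta> \<le> \<rho> \<longrightarrow> u \<eta> < y" if y: "(INF \<rho>\<in>{0<..}. g \<rho>) < y"
  proof -
    obtain \<rho> where \<rho>: "\<rho> > 0" "g \<rho> < y" using y bddb by (subst (asm) cINF_less_iff) auto
    have "u \<eta> \<le> g \<rho>" if "\<eta> \<in> S" "dist \<eta> \<theta> \<le> \<rho>" for \<eta>
      unfolding g_def using bdd that by (intro cSUP_upper) auto
    then show ?thesis using \<rho> by fastforce
  qed
  show "\<exists>\<eta>\<in>S. dist \<eta> \<theta> \<le> \<rho> \<and> y < u \<eta>" if y: "y < (INF \<rho>\<in>{0<..}. g \<rho>)" "\<rho> > 0"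
  proof -
    have "y < g \<rho>" using y cINF_lower[OF bddb, of \<rho>] by auto
    then show ?thesis unfolding g_def using bdd ne[OF y(2)] by (subst (asm) less_cSUP_iff) auto
  qed
qed

text \<open>\<open>Lim\<close> is a definite description and carries information only once
  convergence is known; after this lemma the envelopes are handled through these two inequalities
  alone.\<close>

lemma Lim_upper:
  fixes u :: "'a::metric_space \<Rightarrow> real"
  assumes "\<theta> \<in> closure S" "bounded (u ` S)"
  defines "L \<equiv> Lim (at_right 0) (\<lambda>\<rho>. SUP \<eta>\<in>{\<eta>\<in>S. dist \<eta> \<theta> \<le> \<rho>}. u \<eta>)"
  shows "L < y \<Longrightarrow> \<exists>\<rho>>0. \<forall>\<eta>\<in>S. dist \<eta> \<theta> \<le> \<rho> \<longrightarrow> u \<eta> < y"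
    and "y < L \<Longrightarrow> \<rho> > 0 \<Longrightarrow> \<exists>\<eta>\<in>S. dist \<eta> \<theta> \<le> \<rho> \<and> y < u \<eta>"
  unfolding L_def tendsto_Lim[OF trivial_limit_at_right_real upper_limit_tendsto(1)[OF assms(1,2)]]
  using upper_limit_tendsto(2,3)[OF assms(1,2)] by blast+

lemma Lim_lower:
  fixes u :: "'a::metric_space \<Rightarrow> real"
  assumes \<theta>: "\<theta> \<in> closure S" and bd: "bounded (u ` S)"
  defines "L \<equiv> Lim (at_right 0) (\<lambda>\<rho>. INF \<eta>\<in>{\<eta>\<in>S. dist \<eta> \<theta> \<le> \<rho>}. u \<eta>)"
  shows "y < L \<Longrightarrow> \<exists>\<rho>>0. \<forall>\<eta>\<in>S. dist \<eta> \<theta> \<le> \<rho> \<longrightarrow> y < u \<eta>"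
    and "L < y \<Longrightarrow> \<rho> > 0 \<Longrightarrow> \<exists>\<eta>\<in>S. dist \<eta> \<theta> \<le> \<rho> \<and> u \<eta> < y"
proof -
  define v where "v = (\<lambda>\<eta>. - u \<eta>)"
  have bdv: "bounded (v ` S)" using bd unfolding v_def bounded_iff by auto
  note 1 = upper_limit_tendsto(1)[OF \<theta> bdv]
  \<comment> \<open>The infimum of a set of reals is defined as a negated supremum, so this needs no
    boundedness.\<close>
  have eq: "(INF \<eta>\<in>X. u \<eta>) = - (SUP \<eta>\<in>X. v \<eta>)" for X
    by (simp add: Inf_real_def image_image v_def)
  have "L = - Lim (at_right 0) (\<lambda>\<rho>. SUP \<eta>\<in>{\<eta>\<in>S. dist \<eta> \<theta> \<le> \<rho>}. v \<eta>)"
    unfolding L_def eq tendsto_Lim[OF trivial_limit_at_right_real 1]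
    by (rule tendsto_Lim[OF trivial_limit_at_right_real tendsto_minus[OF 1]])
  then show "y < L \<Longrightarrow> \<exists>\<rho>>0. \<forall>\<eta>\<in>S. dist \<eta> \<theta> \<le> \<rho> \<longrightarrow> y < u \<eta>"
    and "L < y \<Longrightarrow> \<rho> > 0 \<Longrightarrow> \<exists>\<eta>\<in>S. dist \<eta> \<theta> \<le> \<rho> \<and> u \<eta> < y"
    using Lim_upper[OF \<theta> bdv, of "-y"] Lim_upper(2)[OF \<theta> bdv, of "-y" \<rho>]
    by (auto simp: v_def)
qed

section \<open>Continuity and monotonicity of the Hamiltonian maximised over the controls\<close>

lemma cSUP_abs_diff_le:
  fixes f g :: "'a \<Rightarrow> real"
  assumes "A \<noteq> {}" "bdd_above (f ` A)" "bdd_above (g ` A)" "\<And>i. i \<in> A \<Longrightarrow> \<bar>f i - g i\<bar> \<le> e"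
  shows "\<bar>(SUP i\<in>A. f i) - (SUP i\<in>A. g i)\<bar> \<le> e"
proof -
  have "(SUP i\<in>A. f i) \<le> (SUP i\<in>A. g i) + e"
  proof (rule cSUP_least[OF assms(1)])
    fix i assume "i \<in> A"
    then show "f i \<le> (SUP i\<in>A. g i) + e" using cSUP_upper[OF _ assms(3), of i] assms(4)[of i] by auto
  qed
  moreover have "(SUP i\<in>A. g i) \<le> (SUP i\<in>A. f i) + e"
  proof (rule cSUP_least[OF assms(1)])
    fix i assume "i \<in> A"
    then show "g i \<le> (SUP i\<in>A. f i) + e" using cSUP_upper[OF _ assms(2), of i] assms(4)[of i] by auto
  qed
  ultimately show ?thesis by auto
qed

text \<open>The operator \<open>Lop\<close> freed from its test function, so that value, derivatives
  and nonlocal term can be varied independently of each other.\<close>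

definition ham_sup ::
  "model \<Rightarrow> nat \<Rightarrow> pt \<Rightarrow> real \<Rightarrow> real \<Rightarrow> real \<Rightarrow> real \<Rightarrow> real \<Rightarrow> real \<Rightarrow> real" where
  "ham_sup m n \<theta> y \<xi>1 \<xi>2 A1 A2 z =
     (SUP (\<gamma>, a)\<in>{0..1} \<times> {0..maxdiv m}. Hamn m n \<theta> y (\<xi>1, \<xi>2) A1 A2 z \<gamma> a)"

lemma Lop_ham_sup:
  "Lop m n \<delta> \<phi> \<theta> = ham_sup m n \<theta> (\<phi> \<theta>) (Dx \<phi> \<theta>) (Dw \<phi> \<theta>) (Dx (Dx \<phi>) \<theta>) (Dw (Dw \<phi>) \<theta>) (Iop m \<delta> \<phi> \<theta>)"
  by (simp add: Lop_def ham_sup_def)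

text \<open>Displayed as a polynomial in the controls, quadratic in \<gamma> and linear in a. On the
  bounded control rectangle, convergence of the four coefficients gives convergence uniformly in the
  controls.\<close>

lemma Hamn_expand:
  "Hamn m n (s, x, w) y (\<xi>1, \<xi>2) A1 A2 z \<gamma> a =
     ((vola m)\<^sup>2 / 2 * x\<^sup>2 * A1) * \<gamma>\<^sup>2 + ((drift m - rate m) * x * \<xi>1) * \<gamma> + (1 - \<xi>1) * a +
     ((premium m + rate m * x) * \<xi>1 + \<xi>2 + intensity m w * z - discount m * y +
      epsseq m n / 2 * A1 + epsseq m n / 2 * A2)"
  by (simp add: Hamn_def Ham_def algebra_simps)

lemma control_abs_le:
  fixes \<gamma> a M c1 c2 c3 c4 :: real
  assumes "\<gamma> \<in> {0..1}" "a \<in> {0..M}"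
  shows "\<bar>c1 * \<gamma>\<^sup>2 + c2 * \<gamma> + c3 * a + c4\<bar> \<le> \<bar>c1\<bar> + \<bar>c2\<bar> + \<bar>c3\<bar> * M + \<bar>c4\<bar>"
proof -
  have "\<bar>c1 * \<gamma>\<^sup>2\<bar> \<le> \<bar>c1\<bar> * 1" unfolding abs_mult using assms
    by (intro mult_left_mono) (auto simp: power_le_one)
  moreover have "\<bar>c2 * \<gamma>\<bar> \<le> \<bar>c2\<bar> * 1" unfolding abs_mult using assms
    by (intro mult_left_mono) auto
  moreover have "\<bar>c3 * a\<bar> \<le> \<bar>c3\<bar> * M" unfolding abs_mult using assms
    by (intro mult_left_mono) auto
  ultimately show ?thesis by linarith
qed

lemma bdd_above_Hamn:
  "bdd_above ((\<lambda>(\<gamma>, a). Hamn m n \<theta> y (\<xi>1, \<xi>2) A1 A2 z \<gamma> a) ` ({0..1} \<times> {0..maxdiv m}))"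
proof -
  obtain s x w where \<theta>: "\<theta> = (s, x, w)" by (cases \<theta>) auto
  obtain c1 c2 c3 c4 where
    H: "\<And>\<gamma> a. Hamn m n \<theta> y (\<xi>1, \<xi>2) A1 A2 z \<gamma> a = c1 * \<gamma>\<^sup>2 + c2 * \<gamma> + c3 * a + c4"
    by (rule that, unfold \<theta>, rule Hamn_expand)
  have "Hamn m n \<theta> y (\<xi>1, \<xi>2) A1 A2 z \<gamma> a \<le> \<bar>c1\<bar> + \<bar>c2\<bar> + \<bar>c3\<bar> * maxdiv m + \<bar>c4\<bar>"
    if "\<gamma> \<in> {0..1}" "a \<in> {0..maxdiv m}" for \<gamma> a
    unfolding H using control_abs_le[OF that] by (rule order_trans[OF abs_ge_self])
  then show ?thesis
    by (intro bdd_aboveI2[where M = "\<bar>c1\<bar> + \<bar>c2\<bar> + \<bar>c3\<bar> * maxdiv m + \<bar>c4\<bar>"]) auto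
qed

lemma ham_sup_tendsto:
  assumes M: "0 \<le> maxdiv m"
    and "(s \<longlongrightarrow> s0) F" "(x \<longlongrightarrow> x0) F" "(w \<longlongrightarrow> w0) F" "isCont (intensity m) w0"
    and "(y \<longlongrightarrow> y0) F" "(\<xi>1 \<longlongrightarrow> \<xi>10) F" "(\<xi>2 \<longlongrightarrow> \<xi>20) F" "(A1 \<longlongrightarrow> A10) F" "(A2 \<longlongrightarrow> A20) F"
    and "(z \<longlongrightarrow> z0) F"
  shows "((\<lambda>k. ham_sup m n (s k, x k, w k) (y k) (\<xi>1 k) (\<xi>2 k) (A1 k) (A2 k) (z k)) \<longlongrightarrow>
          ham_sup m n (s0, x0, w0) y0 \<xi>10 \<xi>20 A10 A20 z0) F"
proof -
  define c1 where "c1 = (\<lambda>x A1. (vola m)\<^sup>2 / 2 * x\<^sup>2 * A1)"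
  define c2 where "c2 = (\<lambda>x \<xi>1. (drift m - rate m) * x * \<xi>1)"
  define c4 where "c4 = (\<lambda>x w y \<xi>1 \<xi>2 A1 A2 z. (premium m + rate m * x) * \<xi>1 + \<xi>2 +
      intensity m w * z - discount m * y + epsseq m n / 2 * A1 + epsseq m n / 2 * A2)"
  have lw: "((\<lambda>k. intensity m (w k)) \<longlongrightarrow> intensity m w0) F"
    by (rule isCont_tendsto_compose[OF assms(5,4)])
  \<comment> \<open>A bound, uniform over the controls, for the difference of the two Hamiltonians:
    the sum of the coefficient differences, weighted by the largest controls 1 and
    \<open>maxdiv m\<close>.\<close>
  define e where "e = (\<lambda>k. \<bar>c1 (x k) (A1 k) - c1 x0 A10\<bar> + \<bar>c2 (x k) (\<xi>1 k) - c2 x0 \<xi>10\<bar>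
     + \<bar>(1 - \<xi>1 k) - (1 - \<xi>10)\<bar> * maxdiv m
     + \<bar>c4 (x k) (w k) (y k) (\<xi>1 k) (\<xi>2 k) (A1 k) (A2 k) (z k) - c4 x0 w0 y0 \<xi>10 \<xi>20 A10 A20 z0\<bar>)"
  have "(e \<longlongrightarrow> \<bar>c1 x0 A10 - c1 x0 A10\<bar> + \<bar>c2 x0 \<xi>10 - c2 x0 \<xi>10\<bar>
     + \<bar>(1 - \<xi>10) - (1 - \<xi>10)\<bar> * maxdiv m
     + \<bar>c4 x0 w0 y0 \<xi>10 \<xi>20 A10 A20 z0 - c4 x0 w0 y0 \<xi>10 \<xi>20 A10 A20 z0\<bar>) F"
    unfolding e_def c1_def c2_def c4_def by (intro tendsto_intros assms lw)
  then have e0: "(e \<longlongrightarrow> 0) F" by simp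
  have H: "Hamn m n (s, x, w) y (\<xi>1, \<xi>2) A1 A2 z \<gamma> a =
      c1 x A1 * \<gamma>\<^sup>2 + c2 x \<xi>1 * \<gamma> + (1 - \<xi>1) * a + c4 x w y \<xi>1 \<xi>2 A1 A2 z"
    for s x w y \<xi>1 \<xi>2 A1 A2 z \<gamma> a
    unfolding Hamn_expand c1_def c2_def c4_def by (rule refl)
  have le: "\<bar>ham_sup m n (s k, x k, w k) (y k) (\<xi>1 k) (\<xi>2 k) (A1 k) (A2 k) (z k) -
       ham_sup m n (s0, x0, w0) y0 \<xi>10 \<xi>20 A10 A20 z0\<bar> \<le> e k" for k
    unfolding ham_sup_def
  proof (rule cSUP_abs_diff_le[OF _ bdd_above_Hamn bdd_above_Hamn], goal_cases)
    case 1 show ?case using M by auto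
  next
    case (2 i)
    obtain \<gamma> a where i: "i = (\<gamma>, a)" "\<gamma> \<in> {0..1}" "a \<in> {0..maxdiv m}" using 2 by auto
    have "Hamn m n (s k, x k, w k) (y k) (\<xi>1 k, \<xi>2 k) (A1 k) (A2 k) (z k) \<gamma> a -
       Hamn m n (s0, x0, w0) y0 (\<xi>10, \<xi>20) A10 A20 z0 \<gamma> a =
       (c1 (x k) (A1 k) - c1 x0 A10) * \<gamma>\<^sup>2 + (c2 (x k) (\<xi>1 k) - c2 x0 \<xi>10) * \<gamma>
       + ((1 - \<xi>1 k) - (1 - \<xi>10)) * a
       + (c4 (x k) (w k) (y k) (\<xi>1 k) (\<xi>2 k) (A1 k) (A2 k) (z k) - c4 x0 w0 y0 \<xi>10 \<xi>20 A10 A20 z0)"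
      unfolding H by (simp add: algebra_simps)
    then show ?case using control_abs_le[OF i(2,3)] unfolding e_def i(1) by simp
  qed
  show ?thesis
    by (subst LIM_zero_iff[symmetric], rule Lim_null_comparison[OF _ e0]) (use le in simp)
qed

text \<open>The dominating control may differ in \<gamma> while a is kept. This freedom is what
  allows \<gamma> to be replaced by 0 when points with different x are compared.\<close>

lemma ham_sup_mono:
  assumes M: "0 \<le> maxdiv m"
    and "\<And>\<gamma> a. \<gamma> \<in> {0..1} \<Longrightarrow> a \<in> {0..maxdiv m} \<Longrightarrow> \<exists>\<gamma>'\<in>{0..1}. 
      Hamn m n \<theta> y (\<xi>1, \<xi>2) A1 A2 z \<gamma> a \<le> Hamn m n \<theta>' y' (\<xi>1', \<xi>2') A1' A2' z' \<gamma>' a"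
  shows "ham_sup m n \<theta> y \<xi>1 \<xi>2 A1 A2 z \<le> ham_sup m n \<theta>' y' \<xi>1' \<xi>2' A1' A2' z'"
  unfolding ham_sup_def
proof (rule cSUP_mono[OF _ bdd_above_Hamn], goal_cases)
  case 1 show ?case using M by auto
next
  case (2 i)
  then obtain \<gamma> a where i: "i = (\<gamma>, a)" "\<gamma> \<in> {0..1}" "a \<in> {0..maxdiv m}" by auto
  obtain \<gamma>' where "\<gamma>' \<in> {0..1}"
    "Hamn m n \<theta> y (\<xi>1, \<xi>2) A1 A2 z \<gamma> a \<le> Hamn m n \<theta>' y' (\<xi>1', \<xi>2') A1' A2' z' \<gamma>' a"
    using assms(2)[OF i(2,3)] by auto
  then show ?case using i by (intro bexI[of _ "(\<gamma>', a)"]) auto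
qed

section \<open>Domains and test functions\<close>

lemma iDom_eq:
  "iDom m \<delta> = {(s, x, w). 0 < s \<and> s < horizon m + \<delta> \<and> -\<delta> < x \<and> -\<delta> < w \<and> w < s + \<delta>}" (is "_ = ?R")
proof
  show "iDom m \<delta> \<subseteq> ?R"
  proof
    fix \<theta> assume \<theta>: "\<theta> \<in> iDom m \<delta>"
    obtain s x w where [simp]: "\<theta> = (s, x, w)" by (cases \<theta>) auto
    obtain e where e: "e > 0" "ball \<theta> e \<subseteq> Dom m \<delta>" using \<theta> by (auto simp: mem_interior)
    have "(s + e/2, x, w) \<in> Dom m \<delta>" "(s, x - e/2, w) \<in> Dom m \<delta>"
      "(s, x, w - e/2) \<in> Dom m \<delta>" "(s, x, w + e/2) \<in> Dom m \<delta>" "(s, x, w) \<in> Dom m \<delta>"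
      using e by (auto simp: subset_iff dist_Pair_Pair dist_real_def)
    then show "\<theta> \<in> ?R" using e(1) by (auto simp: Dom_def)
  qed
  have "?R = {p. 0 < fst p} \<inter> {p. fst p < horizon m + \<delta>} \<inter> {p. -\<delta> < fst (snd p)} \<inter>
    {p. -\<delta> < snd (snd p)} \<inter> {p. snd (snd p) < fst p + \<delta>}" by auto
  then have "open ?R"
    by (simp only:) (intro open_Int open_Collect_less continuous_intros)
  then show "?R \<subseteq> iDom m \<delta>" by (rule interior_maximal[rotated]) (auto simp: Dom_def)
qed

lemma Dom_cases:
  assumes "0 < \<delta>" "\<theta> \<in> Dom m \<delta>"
  shows "\<theta> \<in> iDom m \<delta> \<or> \<theta> \<in> Dstarc m \<delta>"
  using assms unfolding iDom_eq by (cases \<theta>) (auto simp: Dom_def Dstarc_def slice_def)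

lemma iDom_notin_Dstarc: "\<theta> \<in> iDom m \<delta> \<Longrightarrow> \<theta> \<notin> Dstarc m \<delta>"
  by (cases \<theta>) (auto simp: iDom_eq Dstarc_def slice_def)

lemma convex_Dom: "convex (Dom m \<delta>)"
proof -
  have "Dom m \<delta> = {p. inner (1, 0, 0) p > 0} \<inter> {p. inner (1, 0, 0) p \<le> horizon m + \<delta>} \<inter>
    {p. inner (0, 1, 0) p \<ge> - \<delta>} \<inter> {p. inner (0, 0, 1) p \<ge> -\<delta>} \<inter> {p. inner (-1, 0, 1) p \<le> \<delta>}"
    by (auto simp: Dom_def inner_Pair)
  then show ?thesis
    by (simp only:) (intro convex_Int convex_halfspace_le convex_halfspace_ge convex_halfspace_gt)
qed

text \<open>By convexity and a nonempty interior. The envelopes sample \<open>u\<close> only in the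
  interior, so this is what gives them a meaning at boundary points of D.\<close>

lemma Dom_subset_closure_iDom:
  assumes "0 < horizon m" "0 < \<delta>" shows "Dom m \<delta> \<subseteq> closure (iDom m \<delta>)"
proof -
  have "(horizon m, 0, 0) \<in> iDom m \<delta>" using assms by (auto simp: iDom_eq)
  then show ?thesis using convex_closure_interior[OF convex_Dom, of m \<delta>] closure_subset by auto
qed

section \<open>Calculus of unmixed partial derivatives\<close>

definition has_partials ::
  "pt set \<Rightarrow> (pt \<Rightarrow> real) \<Rightarrow> (pt \<Rightarrow> real) \<Rightarrow> (pt \<Rightarrow> real) \<Rightarrow> (pt \<Rightarrow> real) \<Rightarrow> (pt \<Rightarrow> real) \<Rightarrow> (pt \<Rightarrow> real) \<Rightarrow> bool"
where
  "has_partials S f ft fx fxx fw fww \<longleftrightarrow>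
     (\<forall>s x w. (s, x, w) \<in> S \<longrightarrow>
        ((\<lambda>r. f (r, x, w)) has_real_derivative ft (s, x, w)) (at s) \<and>
        ((\<lambda>y. f (s, y, w)) has_real_derivative fx (s, x, w)) (at x) \<and>
        ((\<lambda>y. fx (s, y, w)) has_real_derivative fxx (s, x, w)) (at x) \<and>
        ((\<lambda>v. f (s, x, v)) has_real_derivative fw (s, x, w)) (at w) \<and>
        ((\<lambda>v. fw (s, x, v)) has_real_derivative fww (s, x, w)) (at w))"

lemma open_sections:
  fixes S :: "pt set"
  assumes "open S"
  shows "open {r. (r, x, w) \<in> S}" "open {y. (s, y, w) \<in> S}" "open {v. (s, x, v) \<in> S}"
proof -
  have "open ((\<lambda>r. (r, x, w)) -` S)" "open ((\<lambda>y. (s, y, w)) -` S)" "open ((\<lambda>v. (s, x, v)) -` S)"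
    using assms by (intro open_vimage continuous_intros; simp)+
  then show "open {r. (r, x, w) \<in> S}" "open {y. (s, y, w) \<in> S}" "open {v. (s, x, v) \<in> S}"
    by (simp_all add: vimage_def)
qed

lemma has_partials_transform:
  assumes S: "open S" and f: "has_partials S f ft fx fxx fw fww"
    and "\<And>\<theta>. \<theta> \<in> S \<Longrightarrow> f \<theta> = g \<theta>" "\<And>\<theta>. \<theta> \<in> S \<Longrightarrow> ft \<theta> = gt \<theta>"
    and "\<And>\<theta>. \<theta> \<in> S \<Longrightarrow> fx \<theta> = gx \<theta>" "\<And>\<theta>. \<theta> \<in> S \<Longrightarrow> fxx \<theta> = gxx \<theta>"
    and "\<And>\<theta>. \<theta> \<in> S \<Longrightarrow> fw \<theta> = gw \<theta>" "\<And>\<theta>. \<theta> \<in> S \<Longrightarrow> fww \<theta> = gww \<theta>"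
  shows "has_partials S g gt gx gxx gw gww"
  unfolding has_partials_def
proof (intro allI impI)
  fix s x w assume in_S: "(s, x, w) \<in> S"
  note tr = has_field_derivative_transform_within_open[OF _ open_sections(1)[OF S]]
    has_field_derivative_transform_within_open[OF _ open_sections(2)[OF S]]
    has_field_derivative_transform_within_open[OF _ open_sections(3)[OF S]]
  have f': "((\<lambda>r. f (r, x, w)) has_real_derivative gt (s, x, w)) (at s)"
    "((\<lambda>y. f (s, y, w)) has_real_derivative gx (s, x, w)) (at x)"
    "((\<lambda>y. fx (s, y, w)) has_real_derivative gxx (s, x, w)) (at x)"
    "((\<lambda>v. f (s, x, v)) has_real_derivative gw (s, x, w)) (at w)"
    "((\<lambda>v. fw (s, x, v)) has_real_derivative gww (s, x, w)) (at w)"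
    using f in_S assms unfolding has_partials_def by metis+
  show "((\<lambda>r. g (r, x, w)) has_real_derivative gt (s, x, w)) (at s) \<and>
    ((\<lambda>y. g (s, y, w)) has_real_derivative gx (s, x, w)) (at x) \<and>
    ((\<lambda>y. gx (s, y, w)) has_real_derivative gxx (s, x, w)) (at x) \<and>
    ((\<lambda>v. g (s, x, v)) has_real_derivative gw (s, x, w)) (at w) \<and>
    ((\<lambda>v. gw (s, x, v)) has_real_derivative gww (s, x, w)) (at w)"
    using in_S assms
    by (intro conjI tr(1)[OF f'(1)] tr(2)[OF f'(2)] tr(2)[OF f'(3)] tr(3)[OF f'(4)] tr(3)[OF f'(5)]) auto
qed

lemma C1kk_has_partials:
  assumes "C1kk 2 S f"
  shows "has_partials S f (Dt f) (Dx f) (Dx (Dx f)) (Dw f) (Dw (Dw f))"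
proof -
  have *: "(h has_real_derivative deriv h z) (at z)" if "h field_differentiable at z" for h z
    using that by (simp add: DERIV_deriv_iff_field_differentiable)
  note C = assms[unfolded C1kk_def]
  have "\<forall>(s, x, w)\<in>S. (\<lambda>y. (Dx ^^ j) f (s, y, w)) field_differentiable at x \<and>
        (\<lambda>v. (Dw ^^ j) f (s, x, v)) field_differentiable at w" if "j < 2" for j
    using C that by blast
  from this[of 0] this[of 1] have j: "(\<lambda>r. f (r, x, w)) field_differentiable at s"
    "(\<lambda>y. f (s, y, w)) field_differentiable at x" "(\<lambda>v. f (s, x, v)) field_differentiable at w"
    "(\<lambda>y. Dx f (s, y, w)) field_differentiable at x" "(\<lambda>v. Dw f (s, x, v)) field_differentiable at w"
    if "(s, x, w) \<in> S" for s x w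
    using C that by auto
  show ?thesis unfolding has_partials_def
  proof (intro allI impI)
    fix s x w assume "(s, x, w) \<in> S"
    note d = j[OF this, THEN *]
    have "Dt f (s, x, w) = deriv (\<lambda>r. f (r, x, w)) s" "Dx f (s, x, w) = deriv (\<lambda>y. f (s, y, w)) x"
      "Dw f (s, x, w) = deriv (\<lambda>v. f (s, x, v)) w"
      "Dx (Dx f) (s, x, w) = deriv (\<lambda>y. Dx f (s, y, w)) x"
      "Dw (Dw f) (s, x, w) = deriv (\<lambda>v. Dw f (s, x, v)) w"
      unfolding Dt_def Dx_def Dw_def by simp_all
    then show "((\<lambda>r. f (r, x, w)) has_real_derivative Dt f (s, x, w)) (at s) \<and>
      ((\<lambda>y. f (s, y, w)) has_real_derivative Dx f (s, x, w)) (at x) \<and>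
      ((\<lambda>y. Dx f (s, y, w)) has_real_derivative Dx (Dx f) (s, x, w)) (at x) \<and>
      ((\<lambda>v. f (s, x, v)) has_real_derivative Dw f (s, x, w)) (at w) \<and>
      ((\<lambda>v. Dw f (s, x, v)) has_real_derivative Dw (Dw f) (s, x, w)) (at w)"
      using d by metis
  qed
qed

text \<open>The way back from explicitly given derivatives, which the derivative rules produce, to
  the operators \<open>Dt\<close>, \<open>Dx\<close>, \<open>Dw\<close>, which are built from
  \<open>deriv\<close> and say nothing without differentiability.\<close>

lemma has_partials_unique:
  assumes S: "open S" and f: "has_partials S f ft fx fxx fw fww" and in_S: "\<theta> \<in> S"
  shows "Dt f \<theta> = ft \<theta>" "Dx f \<theta> = fx \<theta>" "Dx (Dx f) \<theta> = fxx \<theta>" "Dw f \<theta> = fw \<theta>" "Dw (Dw f) \<theta> = fww \<theta>"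
proof -
  have 1: "Dt f \<theta> = ft \<theta>" "Dx f \<theta> = fx \<theta>" "Dw f \<theta> = fw \<theta>" if "\<theta> \<in> S" for \<theta>
    using f that unfolding has_partials_def Dt_def Dx_def Dw_def
    by (cases \<theta>; auto intro!: DERIV_imp_deriv)+
  \<comment> \<open>The second derivatives need \<open>Dx f = fx\<close> and
    \<open>Dw f = fw\<close> near the point and not only at it; this is where openness of S
    enters.\<close>
  have "has_partials S f ft (Dx f) fxx (Dw f) fww"
    by (rule has_partials_transform[OF S f]) (auto simp: 1)
  then show "Dx (Dx f) \<theta> = fxx \<theta>" "Dw (Dw f) \<theta> = fww \<theta>"
    using in_S unfolding has_partials_def Dx_def[of "Dx f"] Dw_def[of "Dw f"]
    by (cases \<theta>; auto intro!: DERIV_imp_deriv)+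
  show "Dt f \<theta> = ft \<theta>" "Dx f \<theta> = fx \<theta>" "Dw f \<theta> = fw \<theta>" using 1 in_S by auto
qed


lemma has_partials_C1kk:
  assumes S: "open S" and f: "has_partials S f ft fx fxx fw fww"
    and c: "continuous_on S f" "continuous_on S ft" "continuous_on S fx" "continuous_on S fxx"
      "continuous_on S fw" "continuous_on S fww"
  shows "C1kk 2 S f"
proof -
  note u = has_partials_unique[OF S f]
  have f': "has_partials S f (Dt f) (Dx f) (Dx (Dx f)) (Dw f) (Dw (Dw f))"
    by (rule has_partials_transform[OF S f]) (auto simp: u)
  have c': "continuous_on S (Dt f)" "continuous_on S (Dx f)" "continuous_on S (Dx (Dx f))"
    "continuous_on S (Dw f)" "continuous_on S (Dw (Dw f))"
    using c u by (simp_all cong: continuous_on_cong)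
  show ?thesis
    unfolding C1kk_def
  proof (intro conjI allI impI)
    show "\<forall>(s, x, w)\<in>S. (\<lambda>r. f (r, x, w)) field_differentiable at s"
      using f' unfolding has_partials_def by (auto simp: field_differentiable_def)
  next
    fix j :: nat assume "j < 2"
    then have "j = 0 \<or> j = 1" by auto
    then show "\<forall>(s, x, w)\<in>S. (\<lambda>y. (Dx ^^ j) f (s, y, w)) field_differentiable at x \<and>
        (\<lambda>v. (Dw ^^ j) f (s, x, v)) field_differentiable at w"
      using f' unfolding has_partials_def by (elim disjE) (auto simp: field_differentiable_def)
  next
    fix j :: nat assume "j \<le> 2"
    then have "j = 0 \<or> j = Suc 0 \<or> j = Suc (Suc 0)" by auto
    then show "continuous_on S ((Dx ^^ j) f)" "continuous_on S ((Dw ^^ j) f)"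
      using c' c(1) by auto
  qed (rule c')
qed

lemma has_partials_add:
  assumes "has_partials S f ft fx fxx fw fww" "has_partials S g gt gx gxx gw gww"
  shows "has_partials S (\<lambda>\<theta>. f \<theta> + g \<theta>) (\<lambda>\<theta>. ft \<theta> + gt \<theta>) (\<lambda>\<theta>. fx \<theta> + gx \<theta>) (\<lambda>\<theta>. fxx \<theta> + gxx \<theta>)
    (\<lambda>\<theta>. fw \<theta> + gw \<theta>) (\<lambda>\<theta>. fww \<theta> + gww \<theta>)"
  using assms unfolding has_partials_def by (auto intro!: DERIV_add)

lemma has_partials_subset: "has_partials S f ft fx fxx fw fww \<Longrightarrow> R \<subseteq> S \<Longrightarrow> has_partials R f ft fx fxx fw fww"
  unfolding has_partials_def by blast

lemma test_fun_partials:
  assumes "test_fun m \<delta> \<phi>"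
  shows "has_partials (iDom m \<delta>) \<phi> (Dt \<phi>) (Dx \<phi>) (Dx (Dx \<phi>)) (Dw \<phi>) (Dw (Dw \<phi>))"
    and "continuous_on (iDom m \<delta>) (Dt \<phi>)" "continuous_on (iDom m \<delta>) (Dx \<phi>)"
    "continuous_on (iDom m \<delta>) (Dx (Dx \<phi>))" "continuous_on (iDom m \<delta>) (Dw \<phi>)"
    "continuous_on (iDom m \<delta>) (Dw (Dw \<phi>))" "continuous_on (Dom m \<delta>) \<phi>"
proof -
  have C: "C1kk 2 (iDom m \<delta>) \<phi>" using assms by (simp add: test_fun_def)
  have "continuous_on (iDom m \<delta>) ((Dx ^^ j) \<phi>) \<and> continuous_on (iDom m \<delta>) ((Dw ^^ j) \<phi>)" if "j \<le> 2" for j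
    using C that unfolding C1kk_def by blast
  from this[of 1] this[of 2] show "continuous_on (iDom m \<delta>) (Dx \<phi>)"
    "continuous_on (iDom m \<delta>) (Dx (Dx \<phi>))" "continuous_on (iDom m \<delta>) (Dw \<phi>)"
    "continuous_on (iDom m \<delta>) (Dw (Dw \<phi>))"
    by (auto simp: numeral_2_eq_2)
  show "continuous_on (iDom m \<delta>) (Dt \<phi>)" using C unfolding C1kk_def by blast
qed (use assms in \<open>auto simp: test_fun_def intro: C1kk_has_partials\<close>)

text \<open>Test functions vanish off D, hence the cut-off. It leaves the derivatives at interior
  points alone, and the globally continuous derivatives of q supply the required extensions to
  D.\<close>

lemma test_fun_perturb:
  assumes \<phi>: "test_fun m \<delta> \<phi>" and q: "has_partials UNIV q qt qx qxx qw qww"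
    and c: "continuous_on UNIV q" "continuous_on UNIV qt" "continuous_on UNIV qx" "continuous_on UNIV qxx"
      "continuous_on UNIV qw" "continuous_on UNIV qww"
  defines "\<zeta> \<equiv> \<lambda>\<theta>. if \<theta> \<in> Dom m \<delta> then \<phi> \<theta> + q \<theta> else 0"
  shows "test_fun m \<delta> \<zeta>"
    and "\<theta> \<in> iDom m \<delta> \<Longrightarrow> Dt \<zeta> \<theta> = Dt \<phi> \<theta> + qt \<theta>"
    and "\<theta> \<in> iDom m \<delta> \<Longrightarrow> Dx \<zeta> \<theta> = Dx \<phi> \<theta> + qx \<theta>"
    and "\<theta> \<in> iDom m \<delta> \<Longrightarrow> Dx (Dx \<zeta>) \<theta> = Dx (Dx \<phi>) \<theta> + qxx \<theta>"
    and "\<theta> \<in> iDom m \<delta> \<Longrightarrow> Dw \<zeta> \<theta> = Dw \<phi> \<theta> + qw \<theta>"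
    and "\<theta> \<in> iDom m \<delta> \<Longrightarrow> Dw (Dw \<zeta>) \<theta> = Dw (Dw \<phi>) \<theta> + qww \<theta>"
proof -
  note p = test_fun_partials[OF \<phi>]
  have sub: "iDom m \<delta> \<subseteq> Dom m \<delta>" by (rule interior_subset)
  have c': "continuous_on X q" "continuous_on X qt" "continuous_on X qx" "continuous_on X qxx"
      "continuous_on X qw" "continuous_on X qww" for X
    using c by (auto intro: continuous_on_subset)
  have P: "has_partials (iDom m \<delta>) \<zeta> (\<lambda>\<theta>. Dt \<phi> \<theta> + qt \<theta>) (\<lambda>\<theta>. Dx \<phi> \<theta> + qx \<theta>)
      (\<lambda>\<theta>. Dx (Dx \<phi>) \<theta> + qxx \<theta>) (\<lambda>\<theta>. Dw \<phi> \<theta> + qw \<theta>) (\<lambda>\<theta>. Dw (Dw \<phi>) \<theta> + qww \<theta>)"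
    using sub by (intro has_partials_transform[OF open_interior
      has_partials_add[OF p(1) has_partials_subset[OF q subset_UNIV]]]) (auto simp: \<zeta>_def)
  note D = has_partials_unique[OF open_interior P]
  show "\<theta> \<in> iDom m \<delta> \<Longrightarrow> Dt \<zeta> \<theta> = Dt \<phi> \<theta> + qt \<theta>"
    "\<theta> \<in> iDom m \<delta> \<Longrightarrow> Dx \<zeta> \<theta> = Dx \<phi> \<theta> + qx \<theta>"
    "\<theta> \<in> iDom m \<delta> \<Longrightarrow> Dx (Dx \<zeta>) \<theta> = Dx (Dx \<phi>) \<theta> + qxx \<theta>"
    "\<theta> \<in> iDom m \<delta> \<Longrightarrow> Dw \<zeta> \<theta> = Dw \<phi> \<theta> + qw \<theta>"
    "\<theta> \<in> iDom m \<delta> \<Longrightarrow> Dw (Dw \<zeta>) \<theta> = Dw (Dw \<phi>) \<theta> + qww \<theta>"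
    by (rule D; assumption)+
  have cD: "continuous_on (Dom m \<delta>) \<zeta>"
    by (rule continuous_on_eq[OF continuous_on_add[OF p(7) c'(1)]]) (simp add: \<zeta>_def)
  have ext: "\<exists>e. continuous_on (Dom m \<delta>) e \<and> (\<forall>\<theta>\<in>iDom m \<delta>. e \<theta> = h \<theta> + k \<theta>)"
    if h: "\<exists>e. continuous_on (Dom m \<delta>) e \<and> (\<forall>\<theta>\<in>iDom m \<delta>. e \<theta> = h \<theta>)"
      and k: "continuous_on (Dom m \<delta>) k" for h k :: "pt \<Rightarrow> real"
  proof -
    obtain e where "continuous_on (Dom m \<delta>) e" "\<forall>\<theta>\<in>iDom m \<delta>. e \<theta> = h \<theta>" using h by auto
    then show ?thesis using k by (intro exI[of _ "\<lambda>\<theta>. e \<theta> + k \<theta>"]) (auto intro: continuous_on_add)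
  qed
  have e0: "\<forall>h\<in>{Dt \<phi>, Dx \<phi>, Dx (Dx \<phi>), Dw \<phi>, Dw (Dw \<phi>)}.
        \<exists>e. continuous_on (Dom m \<delta>) e \<and> (\<forall>\<theta>\<in>iDom m \<delta>. e \<theta> = h \<theta>)"
    using \<phi> unfolding test_fun_def by blast
  show "test_fun m \<delta> \<zeta>"
    unfolding test_fun_def
  proof (intro conjI)
    show "C1kk 2 (iDom m \<delta>) \<zeta>"
      by (rule has_partials_C1kk[OF open_interior P])
        (intro continuous_intros p c' continuous_on_subset[OF cD sub])+
    show "\<forall>h\<in>{Dt \<zeta>, Dx \<zeta>, Dx (Dx \<zeta>), Dw \<zeta>, Dw (Dw \<zeta>)}.
        \<exists>e. continuous_on (Dom m \<delta>) e \<and> (\<forall>\<theta>\<in>iDom m \<delta>. e \<theta> = h \<theta>)"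
      using e0 by (auto simp: D intro!: ext c')
    show "\<forall>\<theta>. \<theta> \<notin> Dom m \<delta> \<longrightarrow> \<zeta> \<theta> = 0" by (simp add: \<zeta>_def)
  qed (rule cD)
qed

text \<open>Base for a test function that is a pure quartic, as needed for the sign of the
  intensity.\<close>

lemma test_fun_zero: "test_fun m \<delta> (\<lambda>_. 0)"
proof -
  have "has_partials (iDom m \<delta>) (\<lambda>_. 0) (\<lambda>_. 0) (\<lambda>_. 0) (\<lambda>_. 0) (\<lambda>_. 0) (\<lambda>_. 0)"
    unfolding has_partials_def by auto
  note * = has_partials_C1kk[OF open_interior this] has_partials_unique[OF open_interior this]
  show ?thesis unfolding test_fun_def
    by (auto simp: * intro!: exI[of _ "\<lambda>_. 0"])
qed

text \<open>The exponents make every derivative occurring in the equation vanish at the touching point.\<close>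

definition quart :: "pt \<Rightarrow> pt \<Rightarrow> real" where
  "quart = (\<lambda>(s0, x0, w0) (s, x, w). (s - s0)\<^sup>2 + (x - x0)^4 + (w - w0)^4)"

definition quartt :: "pt \<Rightarrow> pt \<Rightarrow> real" where "quartt = (\<lambda>(s0, x0, w0) (s, x, w). 2 * (s - s0))"
definition quartx :: "pt \<Rightarrow> pt \<Rightarrow> real" where "quartx = (\<lambda>(s0, x0, w0) (s, x, w). 4 * (x - x0)^3)"
definition quartxx :: "pt \<Rightarrow> pt \<Rightarrow> real" where "quartxx = (\<lambda>(s0, x0, w0) (s, x, w). 12 * (x - x0)\<^sup>2)"
definition quartw :: "pt \<Rightarrow> pt \<Rightarrow> real" where "quartw = (\<lambda>(s0, x0, w0) (s, x, w). 4 * (w - w0)^3)"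
definition quartww :: "pt \<Rightarrow> pt \<Rightarrow> real" where "quartww = (\<lambda>(s0, x0, w0) (s, x, w). 12 * (w - w0)\<^sup>2)"

lemmas quart_defs = quart_def quartt_def quartx_def quartxx_def quartw_def quartww_def

lemma continuous_quart:
  "continuous_on X (quart \<theta>0)" "continuous_on X (quartt \<theta>0)" "continuous_on X (quartx \<theta>0)"
  "continuous_on X (quartxx \<theta>0)" "continuous_on X (quartw \<theta>0)" "continuous_on X (quartww \<theta>0)"
  unfolding quart_defs by (cases \<theta>0; auto simp: case_prod_unfold intro!: continuous_intros)+

lemma quart_self [simp]: "quart \<theta> \<theta> = 0" "quartt \<theta> \<theta> = 0" "quartx \<theta> \<theta> = 0"
  "quartxx \<theta> \<theta> = 0" "quartw \<theta> \<theta> = 0" "quartww \<theta> \<theta> = 0"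
  unfolding quart_defs by (cases \<theta>; simp)+

lemma quart_nonneg: "0 \<le> quart \<theta>0 \<theta>"
  unfolding quart_def by (cases \<theta>0; cases \<theta>) simp

text \<open>The extra summand with factor j lifts a test function away from w = w1 and is meant for
  the sign of the intensity; all other applications take j = 0.\<close>

lemma has_partials_quart:
  "has_partials UNIV (\<lambda>(s, x, w). a + k * quart \<theta>0 (s, x, w) + j * (w - w1)^4)
     (\<lambda>\<theta>. k * quartt \<theta>0 \<theta>) (\<lambda>\<theta>. k * quartx \<theta>0 \<theta>) (\<lambda>\<theta>. k * quartxx \<theta>0 \<theta>)
     (\<lambda>(s, x, w). k * quartw \<theta>0 (s, x, w) + j * (4 * (w - w1)^3))
     (\<lambda>(s, x, w). k * quartww \<theta>0 (s, x, w) + j * (12 * (w - w1)\<^sup>2))"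
  unfolding has_partials_def quart_defs
  by (cases \<theta>0) (auto intro!: derivative_eq_intros simp: algebra_simps)

lemma quart_le_imp:
  assumes "quart (s0, x0, w0) (s, x, w) \<le> c"
  shows "\<bar>s - s0\<bar> \<le> sqrt c" "\<bar>x - x0\<bar> \<le> sqrt (sqrt c)" "\<bar>w - w0\<bar> \<le> sqrt (sqrt c)"
proof -
  have 4: "r ^ 4 = (r\<^sup>2)\<^sup>2" for r :: real by (simp flip: power_mult)
  have *: "(s - s0)\<^sup>2 \<le> c" "((x - x0)\<^sup>2)\<^sup>2 \<le> c" "((w - w0)\<^sup>2)\<^sup>2 \<le> c"
    using assms[unfolded quart_def 4 prod.case] zero_le_power2[of "s - s0"]
      zero_le_power2[of "(x - x0)\<^sup>2"] zero_le_power2[of "(w - w0)\<^sup>2"] by linarith+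
  then show "\<bar>s - s0\<bar> \<le> sqrt c" using real_sqrt_le_mono by fastforce
  have "(x - x0)\<^sup>2 \<le> sqrt c" "(w - w0)\<^sup>2 \<le> sqrt c" using * by (auto intro: real_le_rsqrt)
  then show "\<bar>x - x0\<bar> \<le> sqrt (sqrt c)" "\<bar>w - w0\<bar> \<le> sqrt (sqrt c)"
    by (auto intro: real_le_rsqrt)
qed

text \<open>Sublevel sets of \<open>quart\<close> take over the role of closed balls: this radius
  makes them bounded and shows that they shrink to the centre as c \<rightarrow> 0.\<close>

lemma quart_le_dist:
  assumes "quart \<theta>0 \<theta> \<le> c" shows "dist \<theta> \<theta>0 \<le> sqrt c + 2 * sqrt (sqrt c)"
proof -
  obtain s0 x0 w0 s x w where [simp]: "\<theta>0 = (s0, x0, w0)" "\<theta> = (s, x, w)" by (cases \<theta>0; cases \<theta>) auto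
  have "dist \<theta> \<theta>0 \<le> dist s s0 + dist (x, w) (x0, w0)"
    by (simp only: \<open>\<theta> = _\<close> \<open>\<theta>0 = _\<close> dist_Pair_Pair[of s "(x, w)" s0 "(x0, w0)"])
      (rule sqrt_sum_squares_le_sum; simp)
  also have "dist (x, w) (x0, w0) \<le> dist x x0 + dist w w0"
    by (simp add: dist_Pair_Pair sqrt_sum_squares_le_sum)
  finally show ?thesis using quart_le_imp[of s0 x0 w0 s x w c] assms by (auto simp: dist_real_def)
qed

lemma compact_quart_le: "compact {\<theta>. quart \<theta>0 \<theta> \<le> c}"
proof -
  have "{\<theta>. quart \<theta>0 \<theta> \<le> c} \<subseteq> cball \<theta>0 (sqrt c + 2 * sqrt (sqrt c))"
    using quart_le_dist[of \<theta>0 _ c] by (simp add: subset_iff dist_commute)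
  moreover have "closed {\<theta>. quart \<theta>0 \<theta> \<le> c}"
    by (intro closed_Collect_le continuous_quart continuous_intros)
  ultimately show ?thesis
    by (meson bounded_cball bounded_subset compact_eq_bounded_closed)
qed

lemma quart_radius_tendsto: "((\<lambda>c. sqrt c + 2 * sqrt (sqrt c)) \<longlongrightarrow> 0) (at_right 0)"
proof -
  have "((\<lambda>c. sqrt c + 2 * sqrt (sqrt c)) \<longlongrightarrow> sqrt 0 + 2 * sqrt (sqrt 0)) (at_right 0)"
    by (intro tendsto_intros)
  then show ?thesis by simp
qed

lemma quart_le_subset:
  assumes "open S" "\<theta>0 \<in> S"
  shows "\<exists>c>0. \<forall>c'\<le>c. {\<theta>. quart \<theta>0 \<theta> \<le> c'} \<subseteq> S"
proof -
  obtain e where e: "e > 0" "ball \<theta>0 e \<subseteq> S" using assms by (auto simp: open_contains_ball)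
  have "\<forall>\<^sub>F c in at_right 0. sqrt c + 2 * sqrt (sqrt c) < e"
    using quart_radius_tendsto e(1) by (simp add: order_tendsto_iff)
  then obtain b where b: "b > 0" "\<And>c. 0 < c \<Longrightarrow> c < b \<Longrightarrow> sqrt c + 2 * sqrt (sqrt c) < e"
    by (auto simp: eventually_at_right[of 0 1])
  have "{\<theta>. quart \<theta>0 \<theta> \<le> c'} \<subseteq> S" if "c' \<le> b/2" for c'
  proof
    fix \<theta> assume "\<theta> \<in> {\<theta>. quart \<theta>0 \<theta> \<le> c'}"
    then have "quart \<theta>0 \<theta> \<le> b/2" using that by auto
    from quart_le_dist[OF this] show "\<theta> \<in> S" using b(1) b(2)[of "b/2"] e(2)
      by (auto simp: dist_commute)
  qed
  then show ?thesis using b(1) by (intro exI[of _ "b/2"]) auto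
qed

lemma quart_seq_tendsto:
  assumes "\<And>k. quart \<theta>0 (\<theta> k) \<le> c k" "c \<longlonglongrightarrow> 0"
  shows "\<theta> \<longlonglongrightarrow> \<theta>0"
proof -
  have "(\<lambda>k. sqrt (c k) + 2 * sqrt (sqrt (c k))) \<longlonglongrightarrow> sqrt 0 + 2 * sqrt (sqrt 0)"
    by (intro tendsto_intros assms)
  then have "(\<lambda>k. sqrt (c k) + 2 * sqrt (sqrt (c k))) \<longlonglongrightarrow> 0" by simp
  then show ?thesis
    by (intro metric_tendsto_imp_tendsto[of _ "0::real" _ \<theta> \<theta>0])
      (use quart_le_dist[OF assms(1)] in \<open>auto simp: dist_real_def intro!: always_eventually order_trans[OF _ abs_ge_self]\<close>)
qed

section \<open>Second-order conditions and the nonlocal term\<close>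

text \<open>If the second derivative at x were negative, the first derivative would be negative just
  to the right of x, and the mean value theorem would make f drop below its minimum. No continuity
  of the second derivative is involved.\<close>

lemma local_min_second_derivative:
  fixes f f' :: "real \<Rightarrow> real"
  assumes d: "d > 0" and f: "\<And>y. \<bar>y - x\<bar> < d \<Longrightarrow> (f has_real_derivative f' y) (at y)"
    and f': "(f' has_real_derivative c) (at x)" and min: "\<And>y. \<bar>y - x\<bar> < d \<Longrightarrow> f x \<le> f y"
  shows "f' x = 0" "0 \<le> c"
proof -
  show 0: "f' x = 0"
    using DERIV_local_min[OF f d] min d by (simp add: abs_minus_commute)
  show "0 \<le> c"
  proof (rule ccontr)
    assume "\<not> 0 \<le> c"
    then obtain e where e: "e > 0" "\<And>h. h > 0 \<Longrightarrow> h < e \<Longrightarrow> f' (x + h) < f' x"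
      using DERIV_neg_dec_right[OF f'] by auto
    define h where "h = min d e / 2"
    have h: "0 < h" "h < d" "h < e" using d e(1) by (auto simp: h_def)
    have "\<exists>z>x. z < x + h \<and> f (x + h) - f x = (x + h - x) * f' z"
      using h by (intro MVT2 f) auto
    then obtain z where z: "x < z" "z < x + h" "f (x + h) - f x = h * f' z" by auto
    have "f' z < 0" using e(2)[of "z - x"] z h 0 by auto
    then have "h * f' z < 0" using h by (simp add: mult_pos_neg)
    then show False using min[of "x + h"] h z(3) by auto
  qed
qed

text \<open>The equation contains no mixed derivatives, so it suffices to restrict to the three
  coordinate lines through the minimum.\<close>

lemma has_partials_min:
  assumes S: "open S" "(s, x, w) \<in> S" and f: "has_partials S f ft fx fxx fw fww"
    and min: "\<And>\<eta>. \<eta> \<in> S \<Longrightarrow> f (s, x, w) \<le> f \<eta>"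
  shows "ft (s, x, w) = 0" "fx (s, x, w) = 0" "fw (s, x, w) = 0" "0 \<le> fxx (s, x, w)" "0 \<le> fww (s, x, w)"
proof -
  have ball: "\<exists>d>0. \<forall>r'. \<bar>r' - r\<bar> < d \<longrightarrow> r' \<in> A" if "open A" "r \<in> A" for A and r :: real
    using that by (auto simp: open_dist dist_real_def)
  obtain d1 where d1: "d1 > 0" "\<And>r. \<bar>r - s\<bar> < d1 \<Longrightarrow> (r, x, w) \<in> S"
    using ball[OF open_sections(1)[OF S(1), of x w], of s] S(2) by auto
  obtain d2 where d2: "d2 > 0" "\<And>y. \<bar>y - x\<bar> < d2 \<Longrightarrow> (s, y, w) \<in> S"
    using ball[OF open_sections(2)[OF S(1), of s w], of x] S(2) by auto
  obtain d3 where d3: "d3 > 0" "\<And>v. \<bar>v - w\<bar> < d3 \<Longrightarrow> (s, x, v) \<in> S"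
    using ball[OF open_sections(3)[OF S(1), of s x], of w] S(2) by auto
  note F = f[unfolded has_partials_def, rule_format]
  show "ft (s, x, w) = 0"
    using DERIV_local_min[of "\<lambda>r. f (r, x, w)" "ft (s, x, w)" s d1] d1(1) F[OF S(2)] min d1(2)
    by (simp add: abs_minus_commute)
  have a: "((\<lambda>y. f (s, y, w)) has_real_derivative fx (s, z, w)) (at z)" if "\<bar>z - x\<bar> < d2" for z
    using F[OF d2(2)[OF that]] by simp
  have b: "((\<lambda>y. fx (s, y, w)) has_real_derivative fxx (s, x, w)) (at x)"
    using F[OF S(2)] by simp
  have c: "f (s, x, w) \<le> f (s, z, w)" if "\<bar>z - x\<bar> < d2" for z
    using min[OF d2(2)[OF that]] .
  show "fx (s, x, w) = 0" "0 \<le> fxx (s, x, w)"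
    using local_min_second_derivative[OF d2(1) a b c] by auto
  have a: "((\<lambda>y. f (s, x, y)) has_real_derivative fw (s, x, z)) (at z)" if "\<bar>z - w\<bar> < d3" for z
    using F[OF d3(2)[OF that]] by simp
  have b: "((\<lambda>y. fw (s, x, y)) has_real_derivative fww (s, x, w)) (at w)"
    using F[OF S(2)] by simp
  have c: "f (s, x, w) \<le> f (s, x, z)" if "\<bar>z - w\<bar> < d3" for z
    using min[OF d3(2)[OF that]] .
  show "fw (s, x, w) = 0" "0 \<le> fww (s, x, w)"
    using local_min_second_derivative[OF d3(1) a b c] by auto
qed

lemma has_partials_diff:
  assumes "has_partials S f ft fx fxx fw fww" "has_partials S g gt gx gxx gw gww"
  shows "has_partials S (\<lambda>\<theta>. f \<theta> - g \<theta>) (\<lambda>\<theta>. ft \<theta> - gt \<theta>) (\<lambda>\<theta>. fx \<theta> - gx \<theta>) (\<lambda>\<theta>. fxx \<theta> - gxx \<theta>)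
    (\<lambda>\<theta>. fw \<theta> - gw \<theta>) (\<lambda>\<theta>. fww \<theta> - gww \<theta>)"
  using assms unfolding has_partials_def by (auto intro!: DERIV_diff)

text \<open>Moves a test function for the running maximum from the point x to the point x' = x - b
  at which the maximum is attained.\<close>

lemma has_partials_shift_x:
  assumes "has_partials S f ft fx fxx fw fww" "\<And>s x w. (s, x, w) \<in> R \<Longrightarrow> (s, x + b, w) \<in> S"
  shows "has_partials R (\<lambda>(s, x, w). f (s, x + b, w)) (\<lambda>(s, x, w). ft (s, x + b, w))
    (\<lambda>(s, x, w). fx (s, x + b, w)) (\<lambda>(s, x, w). fxx (s, x + b, w))
    (\<lambda>(s, x, w). fw (s, x + b, w)) (\<lambda>(s, x, w). fww (s, x + b, w))"
  unfolding has_partials_def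
proof (intro allI impI)
  fix s x w assume "(s, x, w) \<in> R"
  then have F: "((\<lambda>r. f (r, x + b, w)) has_real_derivative ft (s, x + b, w)) (at s)"
    "((\<lambda>y. f (s, y, w)) has_real_derivative fx (s, x + b, w)) (at (x + b))"
    "((\<lambda>y. fx (s, y, w)) has_real_derivative fxx (s, x + b, w)) (at (x + b))"
    "((\<lambda>v. f (s, x + b, v)) has_real_derivative fw (s, x + b, w)) (at w)"
    "((\<lambda>v. fw (s, x + b, v)) has_real_derivative fww (s, x + b, w)) (at w)"
    using assms unfolding has_partials_def by blast+
  show "((\<lambda>r. case (r, x, w) of (s, x, w) \<Rightarrow> f (s, x + b, w)) has_real_derivative
         (case (s, x, w) of (s, x, w) \<Rightarrow> ft (s, x + b, w))) (at s) \<and>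
        ((\<lambda>y. case (s, y, w) of (s, x, w) \<Rightarrow> f (s, x + b, w)) has_real_derivative
         (case (s, x, w) of (s, x, w) \<Rightarrow> fx (s, x + b, w))) (at x) \<and>
        ((\<lambda>y. case (s, y, w) of (s, x, w) \<Rightarrow> fx (s, x + b, w)) has_real_derivative
         (case (s, x, w) of (s, x, w) \<Rightarrow> fxx (s, x + b, w))) (at x) \<and>
        ((\<lambda>v. case (s, x, v) of (s, x, w) \<Rightarrow> f (s, x + b, w)) has_real_derivative
         (case (s, x, w) of (s, x, w) \<Rightarrow> fw (s, x + b, w))) (at w) \<and>
        ((\<lambda>v. case (s, x, v) of (s, x, w) \<Rightarrow> fw (s, x + b, w)) has_real_derivative
         (case (s, x, w) of (s, x, w) \<Rightarrow> fww (s, x + b, w))) (at w)"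
    using F(1,4,5) F(2,3)[unfolded DERIV_shift] by simp
qed

section \<open>The claim size measure and the nonlocal operator\<close>

lemma interval_measure_cdf_density:
  assumes "distribution_with_density F f"
  shows "interval_measure F = density lborel (\<lambda>t. ennreal (f t))"
proof -
  define N where "N = density lborel (\<lambda>t. ennreal (f t))"
  have N: "real_distribution N" and F: "F = cdf N"
    using assms by (auto simp: distribution_with_density_def N_def)
  interpret N: real_distribution N by (rule N)
  have c: "\<And>x y. x \<le> y \<Longrightarrow> cdf N x \<le> cdf N y" "\<And>a. continuous (at_right a) (cdf N)"
    "(cdf N \<longlongrightarrow> 0) at_bot" "(cdf N \<longlongrightarrow> 1) at_top"
    using N.cdf_nondecreasing N.cdf_is_right_cont N.cdf_lim_at_bot N.cdf_lim_at_top_prob by auto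
  show ?thesis unfolding F
    using cdf_unique[OF real_distribution_interval_measure[OF c] N cdf_interval_measure[OF c(1-3)]]
    by (simp add: N_def)
qed

abbreviation nu :: "model \<Rightarrow> real measure" where
  "nu m \<equiv> interval_measure (cdfG m)"

text \<open>Absolute continuity excludes atoms. The density vanishes on the negative axis, so the
  mass of {0..b} is the distribution function at b, which tends to 1.\<close>

lemma nu_props:
  assumes "standing_data m"
  shows "real_distribution (nu m)" and "AE u in nu m. u \<noteq> c" and "\<exists>a. \<forall>b\<ge>a. 0 < measure (nu m) {0..b}"
proof -
  have d: "distribution_with_density (cdfG m) (densG m)" using assms by (simp add: standing_data_def)
  note nu = interval_measure_cdf_density[OF d]
  have g: "densG m \<in> borel_measurable borel" "\<And>t. t < 0 \<Longrightarrow> densG m t = 0"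
    using d by (auto simp: distribution_with_density_def)
  show R: "real_distribution (nu m)"
    using d unfolding nu distribution_with_density_def by auto
  show "AE u in nu m. u \<noteq> c"
    unfolding nu using g AE_lborel_singleton[of c] by (subst AE_density) auto
  interpret R: real_distribution "nu m" by (rule R)
  have ge0: "AE u in nu m. 0 \<le> u"
    unfolding nu using g by (subst AE_density) (auto intro!: AE_I2 simp: not_less[symmetric])
  have eq: "measure (nu m) {0..b} = cdf (nu m) b" for b
    unfolding cdf_def by (rule R.finite_measure_eq_AE) (use ge0 in auto)
  have "\<forall>\<^sub>F b in at_top. 0 < cdf (nu m) b"
    using R.cdf_lim_at_top_prob by (rule order_tendstoD) simp
  then show "\<exists>a. \<forall>b\<ge>a. 0 < measure (nu m) {0..b}"
    unfolding eq eventually_at_top_linorder .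
qed

lemma set_integrable_continuous:
  fixes g :: "real \<Rightarrow> real"
  assumes "real_distribution N" "continuous_on {a..b} g"
  shows "set_integrable N {a..b} g"
proof -
  interpret N: real_distribution N by fact
  have "bounded (g ` {a..b})" using assms(2) by (intro compact_imp_bounded compact_continuous_image) auto
  then obtain B where B: "\<And>u. u \<in> {a..b} \<Longrightarrow> norm (g u) \<le> B" unfolding bounded_iff by blast
  have m: "(\<lambda>u. indicator {a..b} u *\<^sub>R g u) \<in> borel_measurable N"
    using borel_measurable_continuous_on_indicator[OF _ assms(2)] by simp
  show ?thesis unfolding set_integrable_def
    by (rule N.integrable_const_bound[OF _ m, of "max B 0"])
      (use B in \<open>auto simp: indicator_def le_max_iff_disj intro!: AE_I2\<close>)
qed

text \<open>Dominated convergence with a moving endpoint. The indicators converge except possibly at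
  u = X0, which is a null set by assumption.\<close>

lemma set_integral_tendsto:
  fixes g :: "nat \<Rightarrow> real \<Rightarrow> real"
  assumes N: "real_distribution N" and ne: "AE u in N. u \<noteq> X0"
    and X: "X \<longlonglongrightarrow> X0" and B: "\<And>k u. u \<in> {0..X k} \<Longrightarrow> \<bar>g k u\<bar> \<le> B"
    and c: "\<And>k. continuous_on {0..X k} (g k)" "continuous_on {0..X0} g0"
    and lim: "\<And>u. 0 \<le> u \<Longrightarrow> u < X0 \<Longrightarrow> (\<lambda>k. g k u) \<longlonglongrightarrow> g0 u"
  shows "(\<lambda>k. LINT u:{0..X k}|N. g k u) \<longlonglongrightarrow> (LINT u:{0..X0}|N. g0 u)"
  unfolding set_lebesgue_integral_def
proof (rule integral_dominated_convergence[where w = "\<lambda>_. max B 0"])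
  interpret N: real_distribution N by fact
  show "(\<lambda>u. indicator {0..X0} u *\<^sub>R g0 u) \<in> borel_measurable N"
    "(\<lambda>u. indicator {0..X k} u *\<^sub>R g k u) \<in> borel_measurable N" for k
    using borel_measurable_continuous_on_indicator[OF _ c(1)]
      borel_measurable_continuous_on_indicator[OF _ c(2)] by simp_all
  show "integrable N (\<lambda>_. max B 0)" by simp
  show "AE u in N. norm (indicator {0..X k} u *\<^sub>R g k u) \<le> max B 0" for k
    using B[of _ k] by (auto intro!: AE_I2 simp: indicator_def le_max_iff_disj)
  show "AE u in N. (\<lambda>k. indicator {0..X k} u *\<^sub>R g k u) \<longlonglongrightarrow> indicator {0..X0} u *\<^sub>R g0 u"
    using ne
  proof eventually_elim
    case (elim u)
    consider "u < 0" | "0 \<le> u" "u < X0" | "u > X0" using elim by linarith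
    then show ?case
    proof cases
      case 2
      have "\<forall>\<^sub>F k in sequentially. u < X k" using X 2 by (simp add: order_tendsto_iff)
      then have "\<forall>\<^sub>F k in sequentially. g k u = indicator {0..X k} u *\<^sub>R g k u"
        by eventually_elim (use 2 in auto)
      from Lim_transform_eventually[OF lim[OF 2] this] show ?thesis using 2 by simp
    next
      case 3
      have "\<forall>\<^sub>F k in sequentially. X k < u" using X 3 by (simp add: order_tendsto_iff)
      then have "\<forall>\<^sub>F k in sequentially. 0 = indicator {0..X k} u *\<^sub>R g k u"
        by eventually_elim auto
      from Lim_transform_eventually[OF tendsto_const this] show ?thesis using 3 by simp
    qed simp
  qed
qed

text \<open>The integral part of \<open>Iop\<close>, split off because it depends on the test
  function only along the face w = -\<delta>, whereas the subtracted value belongs to the touching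
  point.\<close>

definition Jop :: "model \<Rightarrow> real \<Rightarrow> (pt \<Rightarrow> real) \<Rightarrow> pt \<Rightarrow> real" where
  "Jop m \<delta> \<phi> = (\<lambda>(s, x, w). LINT u:{0..x + \<delta>}|nu m. \<phi> (s, x - u, -\<delta>))"

lemma Iop_Jop: "Iop m \<delta> \<phi> \<theta> = Jop m \<delta> \<phi> \<theta> - \<phi> \<theta>"
  by (cases \<theta>) (simp add: Iop_def Jop_def)

text \<open>Jumps from interior points land on the face w = -\<delta>, so the integral never sees
  interior values, and every function of class (\<Psi>) agrees with \<Psi> there.\<close>

lemma jump_in_Dom:
  assumes "0 < \<delta>" "(s, x, w) \<in> iDom m \<delta>" "u \<in> {0..x + \<delta>}"
  shows "(s, x - u, -\<delta>) \<in> Dom m \<delta>" "(s, x - u, -\<delta>) \<in> Dstarc m \<delta>"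
  using assms unfolding iDom_eq by (auto simp: Dom_def Dstarc_def slice_def)

lemma Jop_cong:
  assumes "0 < \<delta>" "\<theta> \<in> iDom m \<delta>" "\<And>\<eta>. \<eta> \<in> Dom m \<delta> \<Longrightarrow> \<phi> \<eta> = \<phi>' \<eta>"
  shows "Jop m \<delta> \<phi> \<theta> = Jop m \<delta> \<phi>' \<theta>"
proof -
  obtain s x w where [simp]: "\<theta> = (s, x, w)" by (cases \<theta>) auto
  show ?thesis unfolding Jop_def
    using assms jump_in_Dom[of \<delta> s x w m] by (auto intro!: set_lebesgue_integral_cong)
qed

lemma continuous_on_jump:
  assumes "0 < \<delta>" "(s, x, w) \<in> iDom m \<delta>" "continuous_on (Dom m \<delta>) \<phi>"
  shows "continuous_on {0..x + \<delta>} (\<lambda>u. \<phi> (s, x - u, -\<delta>))"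
  by (rule continuous_on_compose2[OF assms(3)])
    (use jump_in_Dom[OF assms(1,2)] in \<open>auto intro!: continuous_intros\<close>)

lemma Jop_mono:
  assumes sd: "standing_data m" and \<delta>: "0 < \<delta>" and "(s, x, w) \<in> iDom m \<delta>" "(s, x', w) \<in> iDom m \<delta>"
    and "continuous_on (Dom m \<delta>) \<phi>" "continuous_on (Dom m \<delta>) \<zeta>"
    and "x' \<le> x" and "\<And>u. u \<in> {0..x' + \<delta>} \<Longrightarrow> \<phi> (s, x' - u, -\<delta>) \<le> \<zeta> (s, x - u, -\<delta>)"
    and "\<And>u. u \<in> {0..x + \<delta>} \<Longrightarrow> 0 \<le> \<zeta> (s, x - u, -\<delta>)"
  shows "Jop m \<delta> \<phi> (s, x', w) \<le> Jop m \<delta> \<zeta> (s, x, w)"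
  unfolding Jop_def prod.case set_lebesgue_integral_def
proof (rule integral_mono)
  show "integrable (nu m) (\<lambda>u. indicator {0..x' + \<delta>} u *\<^sub>R \<phi> (s, x' - u, -\<delta>))"
    "integrable (nu m) (\<lambda>u. indicator {0..x + \<delta>} u *\<^sub>R \<zeta> (s, x - u, -\<delta>))"
    using set_integrable_continuous[OF nu_props(1)[OF sd]] continuous_on_jump[OF \<delta>] assms
    unfolding set_integrable_def by blast+
qed (use assms(7-) in \<open>auto simp: indicator_def\<close>)

lemma Jop_tendsto:
  assumes sd: "standing_data m" and \<delta>: "0 < \<delta>"
    and \<theta>: "\<theta> \<longlonglongrightarrow> \<theta>0" "\<theta>0 \<in> iDom m \<delta>" "\<And>k. \<theta> k \<in> iDom m \<delta>"
    and \<phi>: "continuous_on (Dom m \<delta>) \<phi>" and q: "continuous_on (Dom m \<delta>) q"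
    and \<kappa>: "\<kappa> \<longlonglongrightarrow> 0" and c: "c \<longlonglongrightarrow> 0"
  shows "(\<lambda>k. Jop m \<delta> (\<lambda>\<eta>. \<phi> \<eta> + (c k + \<kappa> k * q \<eta>)) (\<theta> k)) \<longlonglongrightarrow> Jop m \<delta> \<phi> \<theta>0"
proof -
  obtain s0 x0 w0 where \<theta>0: "\<theta>0 = (s0, x0, w0)" by (cases \<theta>0) auto
  define s x w where "s = (\<lambda>k. fst (\<theta> k))" and "x = (\<lambda>k. fst (snd (\<theta> k)))" and "w = (\<lambda>k. snd (snd (\<theta> k)))"
  have \<theta>_eq: "\<theta> k = (s k, x k, w k)" for k by (simp add: s_def x_def w_def)
  have lim: "s \<longlonglongrightarrow> s0" "x \<longlonglongrightarrow> x0" "w \<longlonglongrightarrow> w0"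
    using tendsto_fst[OF \<theta>(1)] tendsto_fst[OF tendsto_snd[OF \<theta>(1)]] tendsto_snd[OF tendsto_snd[OF \<theta>(1)]]
    by (simp_all add: s_def x_def w_def \<theta>0)
  define K where "K = insert \<theta>0 (range \<theta>)"
  \<comment> \<open>All landing points of jumps from K, with the jump range rescaled to [0,1]. As a
    compact subset of D it bounds \<phi> and q uniformly in k; on the unbounded D they may be
    unbounded.\<close>
  define C where "C = (\<lambda>((s, x, w), t). (s, -\<delta> + t * (x + \<delta>), -\<delta>)) ` (K \<times> {0..1::real})"
  have "compact K" unfolding K_def by (rule compact_sequence_with_limit[OF \<theta>(1)])
  then have "compact C" unfolding C_def case_prod_unfold
    by (intro compact_continuous_image compact_Times continuous_intros) auto
  have CD: "C \<subseteq> Dom m \<delta>"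
  proof
    fix \<eta> assume "\<eta> \<in> C"
    then obtain s x w t where "(s, x, w) \<in> K" "t \<in> {0..1}" "\<eta> = (s, -\<delta> + t * (x + \<delta>), -\<delta>)"
      unfolding C_def by auto
    moreover have "(s, x, w) \<in> iDom m \<delta>" using \<open>(s, x, w) \<in> K\<close> \<theta> unfolding K_def by auto
    ultimately show "\<eta> \<in> Dom m \<delta>" using \<delta> unfolding iDom_eq by (auto simp: Dom_def)
  qed
  have in_C: "(s k, x k - u, -\<delta>) \<in> C" if "u \<in> {0..x k + \<delta>}" for k u
  proof -
    have "x k + \<delta> > 0" using \<theta>(3)[of k] unfolding \<theta>_eq iDom_eq by auto
    then have "(x k - u + \<delta>) / (x k + \<delta>) \<in> {0..1}"
      "-\<delta> + (x k - u + \<delta>) / (x k + \<delta>) * (x k + \<delta>) = x k - u" using that by auto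
    moreover have "\<theta> k \<in> K" by (simp add: K_def)
    ultimately show ?thesis unfolding C_def
      by (intro image_eqI[of _ _ "(\<theta> k, (x k - u + \<delta>) / (x k + \<delta>))"]) (simp_all add: \<theta>_eq)
  qed
  have bdd: "\<exists>B. \<forall>\<eta>\<in>C. \<bar>f \<eta>\<bar> \<le> B" if "continuous_on (Dom m \<delta>) f" for f :: "pt \<Rightarrow> real"
    using compact_imp_bounded[OF compact_continuous_image[OF continuous_on_subset[OF that CD] \<open>compact C\<close>]]
    unfolding bounded_iff by (simp add: image_iff Bex_def)
  obtain B1 B2 where B12: "\<And>\<eta>. \<eta> \<in> C \<Longrightarrow> \<bar>\<phi> \<eta>\<bar> \<le> B1" "\<And>\<eta>. \<eta> \<in> C \<Longrightarrow> \<bar>q \<eta>\<bar> \<le> B2"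
    using bdd[OF \<phi>] bdd[OF q] by blast
  obtain Bc where Bc: "\<And>k. \<bar>c k\<bar> \<le> Bc" using convergent_imp_Bseq[OF convergentI[OF c]] unfolding Bseq_def real_norm_def by blast
  obtain Bk where Bk: "\<And>k. \<bar>\<kappa> k\<bar> \<le> Bk" using convergent_imp_Bseq[OF convergentI[OF \<kappa>]] unfolding Bseq_def real_norm_def by blast
  note in_D0 = jump_in_Dom[OF \<delta> \<theta>(2)[unfolded \<theta>0]]
  show ?thesis unfolding Jop_def \<theta>_eq \<theta>0 prod.case
  proof (rule set_integral_tendsto[where B = "B1 + (Bc + Bk * B2)"])
    show "real_distribution (nu m)" "AE u in nu m. u \<noteq> x0 + \<delta>" using nu_props[OF sd] by auto
    show "(\<lambda>k. x k + \<delta>) \<longlonglongrightarrow> x0 + \<delta>" by (intro tendsto_intros lim)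
    show "\<bar>\<phi> (s k, x k - u, - \<delta>) + (c k + \<kappa> k * q (s k, x k - u, - \<delta>))\<bar> \<le> B1 + (Bc + Bk * B2)"
      if "u \<in> {0..x k + \<delta>}" for k u
    proof -
      have "\<bar>\<kappa> k * q (s k, x k - u, - \<delta>)\<bar> \<le> Bk * B2"
        unfolding abs_mult using B12(2)[OF in_C[OF that]] Bk[of k] by (intro mult_mono) auto
      then show ?thesis using B12(1)[OF in_C[OF that]] Bc[of k] by linarith
    qed
    show "continuous_on {0..x k + \<delta>} (\<lambda>u. \<phi> (s k, x k - u, - \<delta>) + (c k + \<kappa> k * q (s k, x k - u, - \<delta>)))" for k
      using \<theta>(3)[of k] unfolding \<theta>_eq
      by (intro continuous_on_add continuous_on_mult continuous_on_const
        continuous_on_jump[OF \<delta> _ \<phi>] continuous_on_jump[OF \<delta> _ q])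
    show "continuous_on {0..x0 + \<delta>} (\<lambda>u. \<phi> (s0, x0 - u, - \<delta>))"
      by (rule continuous_on_jump[OF \<delta> \<theta>(2)[unfolded \<theta>0] \<phi>])
    fix u assume u: "0 \<le> u" "u < x0 + \<delta>"
    \<comment> \<open>A fixed jump size below the limiting endpoint is admissible from the k-th
      point only for large k.\<close>
    have ev: "\<forall>\<^sub>F k in sequentially. (s k, x k - u, - \<delta>) \<in> Dom m \<delta>"
    proof -
      have "\<forall>\<^sub>F k in sequentially. u - \<delta> < x k" using lim(2) u(2) by (simp add: order_tendsto_iff)
      then show ?thesis
        by eventually_elim (use u jump_in_Dom[OF \<delta> \<theta>(3)[unfolded \<theta>_eq]] in auto)
    qed
    have l: "(\<lambda>k. (s k, x k - u, - \<delta>)) \<longlonglongrightarrow> (s0, x0 - u, -\<delta>)" by (intro tendsto_intros lim)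
    have cont: "(\<lambda>k. f (s k, x k - u, - \<delta>)) \<longlonglongrightarrow> f (s0, x0 - u, -\<delta>)"
      if "continuous_on (Dom m \<delta>) f" for f :: "pt \<Rightarrow> real"
      using continuous_on_tendsto_compose[OF that l in_D0(1) ev] u by auto
    have "(\<lambda>k. \<phi> (s k, x k - u, - \<delta>) + (c k + \<kappa> k * q (s k, x k - u, - \<delta>))) \<longlonglongrightarrow>
      \<phi> (s0, x0 - u, - \<delta>) + (0 + 0 * q (s0, x0 - u, - \<delta>))"
      by (intro tendsto_intros cont \<phi> q \<kappa> c)
    then show "(\<lambda>k. \<phi> (s k, x k - u, - \<delta>) + (c k + \<kappa> k * q (s k, x k - u, - \<delta>))) \<longlonglongrightarrow> \<phi> (s0, x0 - u, - \<delta>)"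
      by simp
  qed
qed

section \<open>Sign of the intensity and running maxima\<close>

lemma ham_sup_tendsto_pt:
  assumes "0 \<le> maxdiv m" and \<theta>: "(\<theta> \<longlongrightarrow> \<theta>0) F" and l: "isCont (intensity m) (snd (snd \<theta>0))"
    and "(y \<longlongrightarrow> y0) F" "(\<xi>1 \<longlongrightarrow> \<xi>10) F" "(\<xi>2 \<longlongrightarrow> \<xi>20) F" "(A1 \<longlongrightarrow> A10) F" "(A2 \<longlongrightarrow> A20) F"
    and "(z \<longlongrightarrow> z0) F"
  shows "((\<lambda>k. ham_sup m n (\<theta> k) (y k) (\<xi>1 k) (\<xi>2 k) (A1 k) (A2 k) (z k)) \<longlongrightarrow>
          ham_sup m n \<theta>0 y0 \<xi>10 \<xi>20 A10 A20 z0) F"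
  using ham_sup_tendsto[OF assms(1) tendsto_fst[OF \<theta>] tendsto_fst[OF tendsto_snd[OF \<theta>]]
    tendsto_snd[OF tendsto_snd[OF \<theta>]] l assms(4-), of n]
  by simp

text \<open>The nonlocal variable enters linearly, with the same coefficient for all controls, and
  therefore comes out of the supremum.\<close>

lemma ham_sup_shift_le:
  assumes "0 \<le> maxdiv m"
  shows "ham_sup m n (s, x, w) y \<xi>1 \<xi>2 A1 A2 (z + d) \<le> ham_sup m n (s, x, w) y \<xi>1 \<xi>2 A1 A2 z + intensity m w * d"
proof -
  have "(case p of (\<gamma>, a) \<Rightarrow> Hamn m n (s, x, w) y (\<xi>1, \<xi>2) A1 A2 (z + d) \<gamma> a) \<le>
      ham_sup m n (s, x, w) y \<xi>1 \<xi>2 A1 A2 z + intensity m w * d"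
    if p: "p \<in> {0..1} \<times> {0..maxdiv m}" for p
  proof -
    have "(case p of (\<gamma>, a) \<Rightarrow> Hamn m n (s, x, w) y (\<xi>1, \<xi>2) A1 A2 z \<gamma> a) \<le>
        ham_sup m n (s, x, w) y \<xi>1 \<xi>2 A1 A2 z"
      unfolding ham_sup_def by (rule cSUP_upper[OF p bdd_above_Hamn])
    then show ?thesis by (cases p) (simp add: Hamn_expand algebra_simps)
  qed
  then show ?thesis unfolding ham_sup_def[of m n _ _ _ _ _ _ "z + d"]
    using assms by (intro cSUP_least) auto
qed

lemma isCont_intensity:
  assumes "standing_data m" "0 < \<delta>" "\<delta> < 1" "(s, x, w) \<in> iDom m \<delta>"
  shows "isCont (intensity m) w"
proof -
  have "continuous_on {-1..horizon m + 2} (intensity m)" using assms(1) by (simp add: standing_data_def)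
  moreover have "w \<in> interior {-1..horizon m + 2}" using assms by (auto simp: iDom_eq)
  ultimately show ?thesis by (rule continuous_on_interior)
qed

lemma visc_subsolutionD:
  assumes "visc_subsolution m n \<delta> v" "\<theta> \<in> iDom m \<delta>" "test_fun m \<delta> \<phi>" "v \<theta> = \<phi> \<theta>"
    and "\<And>\<eta>. \<eta> \<in> iDom m \<delta> \<Longrightarrow> v \<eta> \<le> \<phi> \<eta>"
  shows "0 \<le> Dt \<phi> \<theta> + Lop m n \<delta> \<phi> \<theta>"
  using assms unfolding visc_subsolution_def by auto

lemma visc_supersolutionD:
  assumes "visc_supersolution m n \<delta> v" "\<theta> \<in> iDom m \<delta>" "test_fun m \<delta> \<phi>" "v \<theta> = \<phi> \<theta>"
    and "\<And>\<eta>. \<eta> \<in> iDom m \<delta> \<Longrightarrow> \<phi> \<eta> \<le> v \<eta>"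
  shows "Dt \<phi> \<theta> + Lop m n \<delta> \<phi> \<theta> \<le> 0"
  using assms unfolding visc_supersolution_def by auto

lemma continuous_imp_usc_on: "continuous_on S v \<Longrightarrow> usc_on S v"
  unfolding usc_on_def continuous_on_def by (auto dest: order_tendstoD(2))

text \<open>The j-term is centred at the w of the point of evaluation and not at \<theta>0: it
  changes neither the value nor any derivative in the equation there, only values elsewhere, hence
  only the nonlocal term.\<close>

lemma quartic_test_fun:
  fixes a k j :: real and \<theta>0 :: pt
  assumes \<phi>: "test_fun m \<delta> \<phi>" and \<theta>: "(s, x, w) \<in> iDom m \<delta>"
  defines "\<zeta> \<equiv> \<lambda>(s', x', w'). if (s', x', w') \<in> Dom m \<delta>
    then \<phi> (s', x', w') + (a + k * quart \<theta>0 (s', x', w') + j * (w' - w)^4) else 0"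
  shows "test_fun m \<delta> \<zeta>" "Dt \<zeta> (s, x, w) = Dt \<phi> (s, x, w) + k * quartt \<theta>0 (s, x, w)"
    "Dx \<zeta> (s, x, w) = Dx \<phi> (s, x, w) + k * quartx \<theta>0 (s, x, w)"
    "Dx (Dx \<zeta>) (s, x, w) = Dx (Dx \<phi>) (s, x, w) + k * quartxx \<theta>0 (s, x, w)"
    "Dw \<zeta> (s, x, w) = Dw \<phi> (s, x, w) + k * quartw \<theta>0 (s, x, w)"
    "Dw (Dw \<zeta>) (s, x, w) = Dw (Dw \<phi>) (s, x, w) + k * quartww \<theta>0 (s, x, w)"
proof -
  have \<zeta>: "\<zeta> = (\<lambda>\<theta>. if \<theta> \<in> Dom m \<delta> then \<phi> \<theta> +
      (\<lambda>(s', x', w'). a + k * quart \<theta>0 (s', x', w') + j * (w' - w)^4) \<theta> else 0)"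
    unfolding \<zeta>_def by (auto simp: fun_eq_iff)
  have c: "continuous_on UNIV (\<lambda>(s', x', w'). a + k * quart \<theta>0 (s', x', w') + j * (w' - w)^4)"
    "continuous_on UNIV (\<lambda>(s', x', w'). k * quartw \<theta>0 (s', x', w') + j * (4 * (w' - w)^3))"
    "continuous_on UNIV (\<lambda>(s', x', w'). k * quartww \<theta>0 (s', x', w') + j * (12 * (w' - w)\<^sup>2))"
    unfolding case_prod_unfold prod.collapse by (intro continuous_intros continuous_quart)+
  have c': "continuous_on UNIV (\<lambda>\<theta>. k * quartt \<theta>0 \<theta>)" "continuous_on UNIV (\<lambda>\<theta>. k * quartx \<theta>0 \<theta>)"
    "continuous_on UNIV (\<lambda>\<theta>. k * quartxx \<theta>0 \<theta>)"
    by (intro continuous_intros continuous_quart)+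
  note P = test_fun_perturb[OF \<phi> has_partials_quart[of a k \<theta>0 j w] c(1) c' c(2,3), folded \<zeta>]
  show "test_fun m \<delta> \<zeta>" by (rule P(1))
  show "Dt \<zeta> (s, x, w) = Dt \<phi> (s, x, w) + k * quartt \<theta>0 (s, x, w)"
    "Dx \<zeta> (s, x, w) = Dx \<phi> (s, x, w) + k * quartx \<theta>0 (s, x, w)"
    "Dx (Dx \<zeta>) (s, x, w) = Dx (Dx \<phi>) (s, x, w) + k * quartxx \<theta>0 (s, x, w)"
    "Dw \<zeta> (s, x, w) = Dw \<phi> (s, x, w) + k * quartw \<theta>0 (s, x, w)"
    "Dw (Dw \<zeta>) (s, x, w) = Dw (Dw \<phi>) (s, x, w) + k * quartww \<theta>0 (s, x, w)"
    using P(2-6)[OF \<theta>] by auto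
qed

text \<open>Nothing in the data forces \<open>\<lambda> \<ge> 0\<close> off \<open>[0, T]\<close>. But where \<open>\<lambda> < 0\<close>, raising a test function
  near \<open>w = -\<delta>\<close> alone drives the nonlocal term to \<open>-\<infinity>\<close>, so that no subsolution can be touched
  from above there, whereas a bounded one is touched on a dense set.\<close>

lemma intensity_nonneg:
  assumes sd: "standing_data m" and \<delta>: "0 < \<delta>" "\<delta> < 1"
    and v: "continuous_on (Dom m \<delta>) v" "visc_subsolution m n \<delta> v" "bounded (v ` Dom m \<delta>)"
    and \<theta>: "(s, x, w) \<in> iDom m \<delta>"
  shows "0 \<le> intensity m w"
proof (rule ccontr)
  assume neg: "\<not> 0 \<le> intensity m w"
  have M: "0 \<le> maxdiv m" using sd by (auto simp: standing_data_def)
  have UD: "iDom m \<delta> \<subseteq> Dom m \<delta>" by (rule interior_subset)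
  obtain a where a: "\<And>b. b \<ge> a \<Longrightarrow> 0 < measure (nu m) {0..b}" using nu_props(3)[OF sd] by auto
  \<comment> \<open>Increasing x stays in the domain and leaves \<lambda>(w) unchanged, and makes
    the jump range large enough to carry positive mass.\<close>
  define \<theta>0 where "\<theta>0 = (s, max x a + 1, w)"
  define S where "S = (iDom m \<delta> \<inter> (\<lambda>p. intensity m (snd (snd p))) -` {..<0}) \<inter> {p. a < fst (snd p)}"
  have "continuous_on (iDom m \<delta>) (\<lambda>p. intensity m (snd (snd p)))"
  proof (rule continuous_at_imp_continuous_on, rule ballI)
    fix p assume "p \<in> iDom m \<delta>"
    then have "isCont (intensity m) (snd (snd p))" using isCont_intensity[OF sd \<delta>] by (cases p) auto
    then show "isCont (\<lambda>p. intensity m (snd (snd p))) p"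
      by (rule isCont_o2[rotated]) (intro continuous_intros)
  qed
  then have oS: "open S" unfolding S_def
    by (intro open_Int continuous_open_preimage open_interior open_lessThan open_Collect_less continuous_intros)
  have \<theta>0S: "\<theta>0 \<in> S" using \<theta> neg by (auto simp: S_def \<theta>0_def iDom_eq)
  obtain c where c: "c > 0" "{\<theta>. quart \<theta>0 \<theta> \<le> c} \<subseteq> S"
    using quart_le_subset[OF oS \<theta>0S] by blast
  have SU: "S \<subseteq> iDom m \<delta>" by (auto simp: S_def)
  obtain B where B: "\<And>\<eta>. \<eta> \<in> Dom m \<delta> \<Longrightarrow> \<bar>v \<eta>\<bar> \<le> B" using v(3) unfolding bounded_iff by (auto simp: image_iff Bex_def)
  \<comment> \<open>Beyond the sublevel set the penalty is at least 2B + 1, more than v can vary, so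
    a maximum over the sublevel set is one over the whole interior.\<close>
  define K where "K = (2 * B + 1) / c"
  have B0: "0 \<le> B" using B[of \<theta>0] \<theta>0S SU UD by force
  have K: "K \<ge> 0" "K * c = 2 * B + 1" using c(1) B0 by (auto simp: K_def)
  have "\<exists>\<theta>1\<in>{\<theta>. quart \<theta>0 \<theta> \<le> c}. \<forall>\<eta>\<in>{\<theta>. quart \<theta>0 \<theta> \<le> c}. v \<eta> - K * quart \<theta>0 \<eta> \<le> v \<theta>1 - K * quart \<theta>0 \<theta>1"
  proof (rule continuous_attains_sup[OF compact_quart_le])
    show "{\<theta>. quart \<theta>0 \<theta> \<le> c} \<noteq> {}" using c(1) by (metis (mono_tags) empty_iff less_imp_le mem_Collect_eq quart_self(1))
    show "continuous_on {\<theta>. quart \<theta>0 \<theta> \<le> c} (\<lambda>\<eta>. v \<eta> - K * quart \<theta>0 \<eta>)"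
      using c(2) SU UD by (intro continuous_intros continuous_quart continuous_on_subset[OF v(1)]) auto
  qed
  then obtain \<theta>1 where \<theta>1: "quart \<theta>0 \<theta>1 \<le> c"
    "\<And>\<eta>. quart \<theta>0 \<eta> \<le> c \<Longrightarrow> v \<eta> - K * quart \<theta>0 \<eta> \<le> v \<theta>1 - K * quart \<theta>0 \<theta>1" by auto
  obtain s1 x1 w1 where \<theta>1_eq: "\<theta>1 = (s1, x1, w1)" by (cases \<theta>1) auto
  define m1 where "m1 = v \<theta>1 - K * quart \<theta>0 \<theta>1"
  have m1: "- B \<le> m1" using \<theta>1(2)[of \<theta>0] c(1) B[of \<theta>0] \<theta>0S SU UD by (auto simp: m1_def)
  have max: "v \<eta> \<le> m1 + K * quart \<theta>0 \<eta>" if \<eta>: "\<eta> \<in> iDom m \<delta>" for \<eta>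
  proof (cases "quart \<theta>0 \<eta> \<le> c")
    case True then show ?thesis using \<theta>1(2)[of \<eta>] by (simp add: m1_def)
  next
    case False
    then have "K * c \<le> K * quart \<theta>0 \<eta>" using K(1) by (intro mult_left_mono) auto
    then show ?thesis using B[of \<eta>] \<eta> UD K(2) m1 by auto
  qed
  have "\<theta>1 \<in> S" using \<theta>1(1) c(2) by auto
  then have \<theta>1U: "(s1, x1, w1) \<in> iDom m \<delta>" and lneg: "intensity m w1 < 0" and "a < x1"
    by (auto simp: S_def \<theta>1_eq)
  then have pos: "0 < measure (nu m) {0..x1 + \<delta>}" using a \<delta> by auto
  have w1: "0 < (w1 + \<delta>)^4" using \<theta>1U by (auto simp: iDom_eq)
  interpret R: real_distribution "nu m" by (rule nu_props(1)[OF sd])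
  define \<zeta> where "\<zeta> = (\<lambda>j (s', x', w'). if (s', x', w') \<in> Dom m \<delta>
    then 0 + (m1 + K * quart \<theta>0 (s', x', w') + j * (w' - w1)^4) else 0)"
  \<comment> \<open>The contribution to the jump integral per unit of j: on the landing face the
    j-term is constant, and it is positive because w1 > -\<delta>.\<close>
  define E where "E = (w1 + \<delta>)^4 * measure (nu m) {0..x1 + \<delta>}"
  define p where "p = (\<lambda>\<eta>. m1 + K * quart \<theta>0 \<eta>)"
  define z where "z = Jop m \<delta> p (s1, x1, w1) - v \<theta>1"
  let ?o = "\<lambda>_::pt. 0::real"
  define C0 where "C0 = Dt ?o (s1, x1, w1) + K * quartt \<theta>0 (s1, x1, w1) +
     ham_sup m n (s1, x1, w1) (v \<theta>1) (Dx ?o (s1, x1, w1) + K * quartx \<theta>0 (s1, x1, w1))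
       (Dw ?o (s1, x1, w1) + K * quartw \<theta>0 (s1, x1, w1))
       (Dx (Dx ?o) (s1, x1, w1) + K * quartxx \<theta>0 (s1, x1, w1))
       (Dw (Dw ?o) (s1, x1, w1) + K * quartww \<theta>0 (s1, x1, w1)) z"
  have key: "0 \<le> C0 + intensity m w1 * (j * E)" if j: "0 \<le> j" for j
  proof -
    note Q = quartic_test_fun[OF test_fun_zero \<theta>1U, of m1 K \<theta>0 j]
    have "\<zeta> j = (\<lambda>(s', x', w'). if (s', x', w') \<in> Dom m \<delta>
      then 0 + (m1 + K * quart \<theta>0 (s', x', w') + j * (w' - w1)^4) else 0)"
      by (simp only: \<zeta>_def)
    note T = Q[folded this]
    have at1: "v \<theta>1 = \<zeta> j \<theta>1" using \<theta>1U UD by (auto simp: \<zeta>_def \<theta>1_eq m1_def)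
    have le: "v \<eta> \<le> \<zeta> j \<eta>" if "\<eta> \<in> iDom m \<delta>" for \<eta>
      using max[OF that] UD that j by (cases \<eta>) (auto simp: \<zeta>_def intro: order_trans)
    have "0 \<le> Dt (\<zeta> j) (s1, x1, w1) + Lop m n \<delta> (\<zeta> j) (s1, x1, w1)"
      using visc_subsolutionD[OF v(2) _ T(1) _ le] \<theta>1U at1 unfolding \<theta>1_eq by blast
    moreover have "Jop m \<delta> (\<zeta> j) (s1, x1, w1) = Jop m \<delta> p (s1, x1, w1) + j * E"
    proof -
      have sgn: "(-\<delta> - w1)^4 = (w1 + \<delta>)^4" by (simp add: power4_eq_xxxx algebra_simps)
      have cp: "continuous_on (Dom m \<delta>) p" unfolding p_def by (intro continuous_intros continuous_quart)
      have "Jop m \<delta> (\<zeta> j) (s1, x1, w1) = (LINT u:{0..x1 + \<delta>}|nu m. p (s1, x1 - u, -\<delta>) + j * (w1 + \<delta>)^4)"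
        unfolding Jop_def prod.case
        using jump_in_Dom(1)[OF \<delta>(1) \<theta>1U]
        by (intro set_lebesgue_integral_cong) (auto simp: \<zeta>_def p_def sgn)
      also have "\<dots> = Jop m \<delta> p (s1, x1, w1) + (LINT u:{0..x1 + \<delta>}|nu m. j * (w1 + \<delta>)^4)"
        unfolding Jop_def prod.case
        by (intro set_integral_add set_integrable_continuous nu_props[OF sd] continuous_on_jump[OF \<delta>(1) \<theta>1U cp]
          continuous_intros)
      also have "(LINT u:{0..x1 + \<delta>}|nu m. j * (w1 + \<delta>)^4) = j * E"
        by (simp add: E_def set_lebesgue_integral_def)
      finally show ?thesis .
    qed
    ultimately have "0 \<le> Dt ?o (s1, x1, w1) + K * quartt \<theta>0 (s1, x1, w1) +
     ham_sup m n (s1, x1, w1) (v \<theta>1) (Dx ?o (s1, x1, w1) + K * quartx \<theta>0 (s1, x1, w1))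
       (Dw ?o (s1, x1, w1) + K * quartw \<theta>0 (s1, x1, w1))
       (Dx (Dx ?o) (s1, x1, w1) + K * quartxx \<theta>0 (s1, x1, w1))
       (Dw (Dw ?o) (s1, x1, w1) + K * quartww \<theta>0 (s1, x1, w1)) (z + j * E)"
      unfolding Lop_ham_sup T(2-) Iop_Jop z_def at1[unfolded \<theta>1_eq, symmetric]
      by (simp add: \<theta>1_eq algebra_simps)
    also have "\<dots> \<le> C0 + intensity m w1 * (j * E)"
      unfolding C0_def add.assoc by (intro add_left_mono ham_sup_shift_le[OF M])
    finally show ?thesis .
  qed
  have E: "0 < E" using pos w1 by (simp add: E_def)
  then have n: "intensity m w1 * E < 0" using lneg by (rule mult_neg_pos[rotated])
  \<comment> \<open>Chosen so that the bound in \<open>key\<close> becomes C0 - \<bar>C0\<bar> - 1 <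
    0.\<close>
  define j where "j = (\<bar>C0\<bar> + 1) / (- (intensity m w1 * E))"
  have "b / (- q) * q = - b" if "q < 0" for b q :: real using that by (simp add: field_simps)
  from this[OF n] have "intensity m w1 * (j * E) = - (\<bar>C0\<bar> + 1)"
    unfolding j_def by (simp only: mult.left_commute)
  moreover have "0 \<le> j" unfolding j_def using n by (intro divide_nonneg_pos) linarith+
  ultimately show False using key[of j] by auto
qed

section \<open>Running maximum in x\<close>

definition xhull :: "real \<Rightarrow> (pt \<Rightarrow> real) \<Rightarrow> pt \<Rightarrow> real" where
  "xhull \<delta> f = (\<lambda>(s, x, w). SUP y\<in>{-\<delta>..x}. f (s, y, w))"

lemma Dom_x_segment: "(s, x, w) \<in> Dom m \<delta> \<Longrightarrow> y \<in> {-\<delta>..x} \<Longrightarrow> (s, y, w) \<in> Dom m \<delta>"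
  by (auto simp: Dom_def)

context
  fixes m :: model and \<delta> :: real and f :: "pt \<Rightarrow> real"
  assumes f: "continuous_on (Dom m \<delta>) f"
begin

lemma continuous_on_x_section:
  assumes "(s, x, w) \<in> Dom m \<delta>" shows "continuous_on {-\<delta>..x} (\<lambda>y. f (s, y, w))"
  by (rule continuous_on_compose2[OF f])
    (use Dom_x_segment[OF assms] in \<open>auto intro!: continuous_intros\<close>)

lemma bdd_above_x_section:
  assumes "(s, x, w) \<in> Dom m \<delta>" shows "bdd_above ((\<lambda>y. f (s, y, w)) ` {-\<delta>..x})"
  by (intro bounded_imp_bdd_above compact_imp_bounded compact_continuous_image
      continuous_on_x_section[OF assms]) auto

lemma xhull_upper: "(s, x, w) \<in> Dom m \<delta> \<Longrightarrow> y \<in> {-\<delta>..x} \<Longrightarrow> f (s, y, w) \<le> xhull \<delta> f (s, x, w)"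
  unfolding xhull_def prod.case by (intro cSUP_upper bdd_above_x_section)

lemma xhull_ge: "\<theta> \<in> Dom m \<delta> \<Longrightarrow> f \<theta> \<le> xhull \<delta> f \<theta>"
  by (cases \<theta>) (auto intro!: xhull_upper simp: Dom_def)

text \<open>Supplies the contact point on the left, at which a test function touching the running
  maximum is compared with the original function.\<close>

lemma xhull_attained:
  assumes \<theta>: "(s, x, w) \<in> Dom m \<delta>"
  shows "\<exists>y\<in>{-\<delta>..x}. xhull \<delta> f (s, x, w) = f (s, y, w)"
proof -
  have ne: "{-\<delta>..x} \<noteq> {}" using \<theta> by (auto simp: Dom_def)
  obtain y where y: "y \<in> {-\<delta>..x}" "\<forall>y'\<in>{-\<delta>..x}. f (s, y', w) \<le> f (s, y, w)"
    using continuous_attains_sup[OF compact_Icc ne continuous_on_x_section[OF \<theta>]] by blast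
  have "xhull \<delta> f (s, x, w) \<le> f (s, y, w)"
    unfolding xhull_def prod.case using y(2) ne by (intro cSUP_least) auto
  then show ?thesis using xhull_upper[OF \<theta> y(1)] y(1) by (intro bexI[of _ y]) auto
qed

lemma xhull_mono: "(s, x', w) \<in> Dom m \<delta> \<Longrightarrow> -\<delta> \<le> x \<Longrightarrow> x \<le> x' \<Longrightarrow> xhull \<delta> f (s, x, w) \<le> xhull \<delta> f (s, x', w)"
  unfolding xhull_def prod.case by (intro cSUP_subset_mono bdd_above_x_section) auto

text \<open>Rescaling {-\<delta>..x} to [0,1] turns the moving range into a fixed compact one.
  Continuity is then uniform in t, and suprema do not expand uniform distances.\<close>

lemma continuous_on_xhull: "continuous_on (Dom m \<delta>) (xhull \<delta> f)"
proof -
  define g where "g = (\<lambda>(\<theta>, t). case \<theta> of (s, x, w) \<Rightarrow> f (s, -\<delta> + t * (x + \<delta>), w))"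
  have g: "continuous_on (Dom m \<delta> \<times> {0..1::real}) g"
    unfolding g_def case_prod_unfold
    by (rule continuous_on_compose2[OF f]) (auto simp: Dom_def intro!: continuous_intros)
  have eq: "xhull \<delta> f \<theta> = (SUP t\<in>{0..1}. g (\<theta>, t))" if "\<theta> \<in> Dom m \<delta>" for \<theta>
  proof -
    obtain s x w where \<theta>: "\<theta> = (s, x, w)" by (cases \<theta>) auto
    have "x \<ge> -\<delta>" using that by (auto simp: \<theta> Dom_def)
    then have "{-\<delta>..x} = (\<lambda>t. -\<delta> + t * (x + \<delta>)) ` {0..1}"
      using image_affinity_atLeastAtMost[of "x + \<delta>" "-\<delta>" 0 1] by (auto simp: algebra_simps)
    then show ?thesis by (simp add: xhull_def \<theta> g_def image_image)
  qed
  have bdd: "bdd_above ((\<lambda>t. g (\<theta>, t)) ` {0..1})" if "\<theta> \<in> Dom m \<delta>" for \<theta>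
    by (intro bounded_imp_bdd_above compact_imp_bounded compact_continuous_image
      continuous_on_compose2[OF g]) (use that in \<open>auto intro!: continuous_intros\<close>)
  show ?thesis unfolding continuous_on_iff
  proof (intro ballI allI impI)
    fix \<theta> and e :: real assume \<theta>: "\<theta> \<in> Dom m \<delta>" and e: "0 < e"
    obtain X where X: "\<theta> \<in> X" "open X"
      "\<forall>\<eta>\<in>X \<inter> Dom m \<delta>. \<forall>t\<in>{0..1}. dist (g (\<eta>, t)) (g (\<theta>, t)) \<le> e / 2"
      using continuous_on_prod_compactE[OF g compact_Icc \<theta>, of "e/2"] e by auto
    obtain d where d: "d > 0" "ball \<theta> d \<subseteq> X" using X(1,2) by (auto simp: open_contains_ball)
    have "dist (xhull \<delta> f \<eta>) (xhull \<delta> f \<theta>) < e" if \<eta>: "\<eta> \<in> Dom m \<delta>" "dist \<eta> \<theta> < d" for \<eta>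
    proof -
      have "\<eta> \<in> X" using d \<eta> by (auto simp: dist_commute)
      then have "\<bar>(SUP t\<in>{0..1}. g (\<eta>, t)) - (SUP t\<in>{0..1}. g (\<theta>, t))\<bar> \<le> e / 2"
        using X(3) \<eta> by (intro cSUP_abs_diff_le bdd \<theta>) (auto simp: dist_real_def)
      then show ?thesis using eq \<eta>(1) \<theta> e by (simp add: dist_real_def)
    qed
    then show "\<exists>d>0. \<forall>\<eta>\<in>Dom m \<delta>. dist \<eta> \<theta> < d \<longrightarrow> dist (xhull \<delta> f \<eta>) (xhull \<delta> f \<theta>) < e"
      using d(1) by blast
  qed
qed

end

section \<open>The Perron family and its envelopes\<close>

text \<open>The growth condition at x = -\<delta> is inherited upwards: W and v agree at x =
  -\<delta>, and W is at least v to the right of it.\<close>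

lemma class_Psi_above:
  assumes v: "class_Psi m \<delta> \<Psi> v" and \<delta>: "0 < \<delta>" and W: "\<And>\<theta>. \<theta> \<in> Dstarc m \<delta> \<Longrightarrow> W \<theta> = \<Psi> \<theta>"
    and mono: "\<And>s x x' w. (s, x, w) \<in> Dom m \<delta> \<Longrightarrow> (s, x', w) \<in> Dom m \<delta> \<Longrightarrow> x \<le> x' \<Longrightarrow> W (s, x, w) \<le> W (s, x', w)"
    and bd: "bounded (W ` Dom m \<delta>)" and ge: "\<And>\<theta>. \<theta> \<in> Dom m \<delta> \<Longrightarrow> v \<theta> \<le> W \<theta>"
  shows "class_Psi m \<delta> \<Psi> W"
  unfolding class_Psi_def
proof (intro conjI ballI allI impI bd)
  fix s w assume sw: "0 < s \<and> s \<le> horizon m + \<delta> \<and> - \<delta> \<le> w \<and> w \<le> s + \<delta>"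
  then have b: "(s, -\<delta>, w) \<in> Dstarc m \<delta>" by (auto simp: Dstarc_def slice_def)
  then have eq: "W (s, -\<delta>, w) = v (s, -\<delta>, w)" using v W by (simp add: class_Psi_def)
  have "\<forall>\<^sub>F x in at_right (-\<delta>). x + \<delta> \<le> v (s, x, w) - v (s, - \<delta>, w)"
    using v sw unfolding class_Psi_def by blast
  moreover have "\<forall>\<^sub>F x in at_right (-\<delta>). -\<delta> < x" by (rule eventually_at_right_less)
  ultimately show "\<forall>\<^sub>F x in at_right (-\<delta>). x + \<delta> \<le> W (s, x, w) - W (s, - \<delta>, w)"
  proof eventually_elim
    case (elim x)
    have "(s, x, w) \<in> Dom m \<delta>" using elim sw by (auto simp: Dom_def)
    from ge[OF this] elim show ?case unfolding eq by linarith
  qed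
qed (use W mono in blast)+

text \<open>Touching is required in the interior only, while the jump integrals read values on the
  boundary; density of the interior bridges the gap.\<close>

lemma le_on_Dom:
  fixes f g :: "pt \<Rightarrow> real"
  assumes "Dom m \<delta> \<subseteq> closure (iDom m \<delta>)" "continuous_on (Dom m \<delta>) f" "continuous_on (Dom m \<delta>) g"
    and le: "\<And>\<theta>. \<theta> \<in> iDom m \<delta> \<Longrightarrow> f \<theta> \<le> g \<theta>" and \<theta>: "\<theta> \<in> Dom m \<delta>"
  shows "f \<theta> \<le> g \<theta>"
proof (rule ccontr)
  assume "\<not> f \<theta> \<le> g \<theta>"
  then have e: "0 < f \<theta> - g \<theta>" by simp
  have "continuous_on (Dom m \<delta>) (\<lambda>\<eta>. f \<eta> - g \<eta>)" using assms by (intro continuous_intros)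
  then obtain d where d: "d > 0" "\<And>\<eta>. \<eta> \<in> Dom m \<delta> \<Longrightarrow> dist \<eta> \<theta> < d \<Longrightarrow> dist (f \<eta> - g \<eta>) (f \<theta> - g \<theta>) < f \<theta> - g \<theta>"
    using \<theta> e unfolding continuous_on_iff by blast
  obtain \<eta> where \<eta>: "\<eta> \<in> iDom m \<delta>" "dist \<eta> \<theta> < d"
    using assms(1) \<theta> d(1) by (meson closure_approachable subsetD)
  then have "\<eta> \<in> Dom m \<delta>" using interior_subset by blast
  from d(2)[OF this \<eta>(2)] le[OF \<eta>(1)] show False by (auto simp: dist_real_def)
qed

locale perron =
  fixes m :: model and n :: nat and \<delta> :: real and \<Psi> \<psi>l \<psi>u u :: "pt \<Rightarrow> real"
  assumes sd: "standing_data m" and n: "1 \<le> n" and \<delta>: "0 < \<delta>" "\<delta> < 1"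
    and Psi_nonneg: "\<And>\<theta>. \<theta> \<in> Dom m \<delta> \<Longrightarrow> 0 \<le> \<Psi> \<theta>"
    and lower: "continuous_on (Dom m \<delta>) \<psi>l" "visc_subsolution m n \<delta> \<psi>l" "class_Psi m \<delta> \<Psi> \<psi>l"
    and upper: "continuous_on (Dom m \<delta>) \<psi>u" "visc_supersolution m n \<delta> \<psi>u" "class_Psi m \<delta> \<Psi> \<psi>u"
    and family_nonempty: "perron_family m n \<delta> \<Psi> \<psi>l \<psi>u \<noteq> {}"
    and u_eq: "\<And>\<theta>. \<theta> \<in> Dom m \<delta> \<Longrightarrow> u \<theta> = (SUP v\<in>perron_family m n \<delta> \<Psi> \<psi>l \<psi>u. v \<theta>)"
begin

abbreviation "D \<equiv> Dom m \<delta>"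
abbreviation "U \<equiv> iDom m \<delta>"
abbreviation "\<F> \<equiv> perron_family m n \<delta> \<Psi> \<psi>l \<psi>u"
abbreviation "us \<equiv> upper_envelope m \<delta> \<Psi> u"
abbreviation "ul \<equiv> lower_envelope m \<delta> \<Psi> u"

lemma data: "0 \<le> maxdiv m" "0 < epsseq m n" "0 < horizon m"
  using sd n by (auto simp: standing_data_def)

lemma UD: "\<theta> \<in> U \<Longrightarrow> \<theta> \<in> D"
  using interior_subset by blast

lemma D_closure: "D \<subseteq> closure U"
  by (rule Dom_subset_closure_iDom[OF data(3) \<delta>(1)])

lemma family_D:
  assumes "v \<in> \<F>"
  shows "continuous_on D v" "visc_subsolution m n \<delta> v" "class_Psi m \<delta> \<Psi> v"
    "\<theta> \<in> D \<Longrightarrow> \<psi>l \<theta> \<le> v \<theta>" "\<theta> \<in> D \<Longrightarrow> v \<theta> \<le> \<psi>u \<theta>"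
  using assms by (auto simp: perron_family_def)

lemma class_D:
  assumes "class_Psi m \<delta> \<Psi> v"
  shows "\<theta> \<in> Dstarc m \<delta> \<Longrightarrow> v \<theta> = \<Psi> \<theta>" "bounded (v ` D)"
    "(s, x, w) \<in> D \<Longrightarrow> (s, x', w) \<in> D \<Longrightarrow> x \<le> x' \<Longrightarrow> v (s, x, w) \<le> v (s, x', w)"
  using assms by (auto simp: class_Psi_def)

lemma bdd_above_family: "\<theta> \<in> D \<Longrightarrow> bdd_above ((\<lambda>v. v \<theta>) ` \<F>)"
  by (intro bdd_aboveI2[where M = "\<psi>u \<theta>"] family_D(5))

lemma family_le_u: "v \<in> \<F> \<Longrightarrow> \<theta> \<in> D \<Longrightarrow> v \<theta> \<le> u \<theta>"
  by (simp only: u_eq) (intro cSUP_upper bdd_above_family)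

lemma less_u: "\<theta> \<in> D \<Longrightarrow> y < u \<theta> \<Longrightarrow> \<exists>v\<in>\<F>. y < v \<theta>"
  using family_nonempty by (simp add: u_eq less_cSUP_iff bdd_above_family)

lemma u_bounds:
  assumes "\<theta> \<in> D" shows "\<psi>l \<theta> \<le> u \<theta>" "u \<theta> \<le> \<psi>u \<theta>"
proof -
  obtain v where v: "v \<in> \<F>" using family_nonempty by auto
  show "\<psi>l \<theta> \<le> u \<theta>" using family_le_u[OF v assms] family_D(4)[OF v assms] by simp
  show "u \<theta> \<le> \<psi>u \<theta>" unfolding u_eq[OF assms]
    using family_nonempty family_D(5) assms by (intro cSUP_least) auto
qed

lemma bounded_between:
  assumes "\<And>\<theta>. \<theta> \<in> D \<Longrightarrow> \<psi>l \<theta> \<le> f \<theta>" "\<And>\<theta>. \<theta> \<in> D \<Longrightarrow> f \<theta> \<le> \<psi>u \<theta>"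
  shows "bounded (f ` D)"
proof -
  obtain B1 B2 where "\<And>\<theta>. \<theta> \<in> D \<Longrightarrow> \<bar>\<psi>l \<theta>\<bar> \<le> B1" "\<And>\<theta>. \<theta> \<in> D \<Longrightarrow> \<bar>\<psi>u \<theta>\<bar> \<le> B2"
    using class_D(2)[OF lower(3)] class_D(2)[OF upper(3)] unfolding bounded_iff
    by (auto simp: image_iff Bex_def)
  then have "\<bar>f \<theta>\<bar> \<le> max B1 B2" if "\<theta> \<in> D" for \<theta>
    using assms[OF that] that by (smt (verit) max_def)
  then show ?thesis unfolding bounded_iff by (intro exI[of _ "max B1 B2"]) auto
qed

lemma bounded_u: "bounded (u ` U)"
  using bounded_subset[OF bounded_between[OF u_bounds] image_mono[OF interior_subset]] .

section \<open>Bounds, boundary values, monotonicity and semicontinuity of the envelopes\<close>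

lemma envelope_less:
  assumes "\<theta> \<in> D"
  shows "us \<theta> < y \<Longrightarrow> \<exists>\<rho>>0. \<forall>\<eta>\<in>U. dist \<eta> \<theta> \<le> \<rho> \<longrightarrow> u \<eta> < y"
    and "y < us \<theta> \<Longrightarrow> \<rho> > 0 \<Longrightarrow> \<exists>\<eta>\<in>U. dist \<eta> \<theta> \<le> \<rho> \<and> y < u \<eta>"
    and "y < ul \<theta> \<Longrightarrow> \<exists>\<rho>>0. \<forall>\<eta>\<in>U. dist \<eta> \<theta> \<le> \<rho> \<longrightarrow> y < u \<eta>"
    and "ul \<theta> < y \<Longrightarrow> \<rho> > 0 \<Longrightarrow> \<exists>\<eta>\<in>U. dist \<eta> \<theta> \<le> \<rho> \<and> u \<eta> < y"
proof -
  have "\<theta> \<in> closure U" using assms D_closure by auto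
  from Lim_upper[OF this bounded_u] Lim_lower[OF this bounded_u] assms
  show "us \<theta> < y \<Longrightarrow> \<exists>\<rho>>0. \<forall>\<eta>\<in>U. dist \<eta> \<theta> \<le> \<rho> \<longrightarrow> u \<eta> < y"
    and "y < us \<theta> \<Longrightarrow> \<rho> > 0 \<Longrightarrow> \<exists>\<eta>\<in>U. dist \<eta> \<theta> \<le> \<rho> \<and> y < u \<eta>"
    and "y < ul \<theta> \<Longrightarrow> \<exists>\<rho>>0. \<forall>\<eta>\<in>U. dist \<eta> \<theta> \<le> \<rho> \<longrightarrow> y < u \<eta>"
    and "ul \<theta> < y \<Longrightarrow> \<rho> > 0 \<Longrightarrow> \<exists>\<eta>\<in>U. dist \<eta> \<theta> \<le> \<rho> \<and> u \<eta> < y"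
    by (simp_all add: upper_envelope_def lower_envelope_def)
qed

lemma continuous_near:
  fixes f :: "pt \<Rightarrow> real"
  assumes "continuous_on D f" "\<theta> \<in> D" "e > 0"
  obtains d where "d > 0" "\<And>\<eta>. \<eta> \<in> D \<Longrightarrow> dist \<eta> \<theta> \<le> d \<Longrightarrow> \<bar>f \<eta> - f \<theta>\<bar> < e"
proof -
  obtain d where d: "d > 0" "\<And>\<eta>. \<eta> \<in> D \<Longrightarrow> dist \<eta> \<theta> < d \<Longrightarrow> dist (f \<eta>) (f \<theta>) < e"
    using assms unfolding continuous_on_iff by blast
  have "\<bar>f \<eta> - f \<theta>\<bar> < e" if "\<eta> \<in> D" "dist \<eta> \<theta> \<le> d/2" for \<eta>
    using d(2)[OF that(1)] that(2) d(1) by (simp add: dist_real_def)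
  then show thesis using that[of "d/2"] d(1) by simp
qed

text \<open>A continuous majorant of \<open>u\<close> in the interior bounds the envelope up to the
  boundary; applied to the upper barrier.\<close>

lemma us_le:
  assumes f: "continuous_on D f" and le: "\<And>\<eta>. \<eta> \<in> U \<Longrightarrow> u \<eta> \<le> f \<eta>" and \<theta>: "\<theta> \<in> D"
  shows "us \<theta> \<le> f \<theta>"
proof (rule ccontr)
  assume "\<not> us \<theta> \<le> f \<theta>"
  then have e: "0 < (us \<theta> - f \<theta>) / 2" by simp
  obtain d where d: "d > 0" "\<And>\<eta>. \<eta> \<in> D \<Longrightarrow> dist \<eta> \<theta> \<le> d \<Longrightarrow> \<bar>f \<eta> - f \<theta>\<bar> < (us \<theta> - f \<theta>) / 2"
    using continuous_near[OF f \<theta> e] by blast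
  have "us \<theta> - (us \<theta> - f \<theta>) / 2 < us \<theta>" using e by simp
  then obtain \<eta> where "\<eta> \<in> U" "dist \<eta> \<theta> \<le> d" "us \<theta> - (us \<theta> - f \<theta>) / 2 < u \<eta>"
    using envelope_less(2)[OF \<theta> _ d(1)] by blast
  then show False using d(2)[of \<eta>] UD[of \<eta>] le[of \<eta>] unfolding abs_less_iff by argo
qed

lemma ul_ge:
  assumes f: "continuous_on D f" and le: "\<And>\<eta>. \<eta> \<in> U \<Longrightarrow> f \<eta> \<le> u \<eta>" and \<theta>: "\<theta> \<in> D"
  shows "f \<theta> \<le> ul \<theta>"
proof (rule ccontr)
  assume "\<not> f \<theta> \<le> ul \<theta>"
  then have e: "0 < (f \<theta> - ul \<theta>) / 2" by simp
  obtain d where d: "d > 0" "\<And>\<eta>. \<eta> \<in> D \<Longrightarrow> dist \<eta> \<theta> \<le> d \<Longrightarrow> \<bar>f \<eta> - f \<theta>\<bar> < (f \<theta> - ul \<theta>) / 2"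
    using continuous_near[OF f \<theta> e] by blast
  have "ul \<theta> < ul \<theta> + (f \<theta> - ul \<theta>) / 2" using e by simp
  then obtain \<eta> where "\<eta> \<in> U" "dist \<eta> \<theta> \<le> d" "u \<eta> < ul \<theta> + (f \<theta> - ul \<theta>) / 2"
    using envelope_less(4)[OF \<theta> _ d(1)] by blast
  then show False using d(2)[of \<eta>] UD[of \<eta>] le[of \<eta>] unfolding abs_less_iff by argo
qed

lemma u_le_us: assumes "\<theta> \<in> U" shows "u \<theta> \<le> us \<theta>"
proof (rule ccontr)
  assume "\<not> u \<theta> \<le> us \<theta>"
  then show False using envelope_less(1)[OF UD[OF assms], of "u \<theta>"] assms by force
qed

lemma ul_le_u: assumes "\<theta> \<in> U" shows "ul \<theta> \<le> u \<theta>"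
proof (rule ccontr)
  assume "\<not> ul \<theta> \<le> u \<theta>"
  then show False using envelope_less(3)[OF UD[OF assms], of "u \<theta>"] assms by force
qed

text \<open>The envelopes do not sample \<open>u\<close> at boundary points, so both are compared at
  a common nearby point of U.\<close>

lemma ul_le_us: assumes "\<theta> \<in> D" shows "ul \<theta> \<le> us \<theta>"
proof (rule ccontr)
  assume "\<not> ul \<theta> \<le> us \<theta>"
  then have "us \<theta> < (us \<theta> + ul \<theta>) / 2" "(us \<theta> + ul \<theta>) / 2 < ul \<theta>" by simp_all
  then obtain r1 r2 where r: "r1 > 0" "\<forall>\<eta>\<in>U. dist \<eta> \<theta> \<le> r1 \<longrightarrow> u \<eta> < (us \<theta> + ul \<theta>) / 2"
    "r2 > 0" "\<forall>\<eta>\<in>U. dist \<eta> \<theta> \<le> r2 \<longrightarrow> (us \<theta> + ul \<theta>) / 2 < u \<eta>"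
    using envelope_less(1,3)[OF assms] by meson
  have "\<theta> \<in> closure U" "0 < min r1 r2" using D_closure assms r(1,3) by auto
  then obtain \<eta> where "\<eta> \<in> U" "dist \<eta> \<theta> < min r1 r2"
    by (meson closure_approachable)
  then show False using r(2,4) by force
qed

lemma envelope_bounds:
  assumes "\<theta> \<in> D" shows "\<psi>l \<theta> \<le> ul \<theta>" "\<psi>l \<theta> \<le> us \<theta>" "ul \<theta> \<le> \<psi>u \<theta>" "us \<theta> \<le> \<psi>u \<theta>"
proof -
  show "\<psi>l \<theta> \<le> ul \<theta>" using assms u_bounds UD by (intro ul_ge lower) auto
  show "us \<theta> \<le> \<psi>u \<theta>" using assms u_bounds UD by (intro us_le upper) auto
  show "\<psi>l \<theta> \<le> us \<theta>" "ul \<theta> \<le> \<psi>u \<theta>"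
    using \<open>\<psi>l \<theta> \<le> ul \<theta>\<close> \<open>us \<theta> \<le> \<psi>u \<theta>\<close> ul_le_us[OF assms] by linarith+
qed

text \<open>Both barriers equal \<Psi> here, so the envelopes are squeezed; off D they equal \<Psi>
  by definition.\<close>

lemma envelope_Dstarc:
  assumes "\<theta> \<in> Dstarc m \<delta>" shows "us \<theta> = \<Psi> \<theta>" "ul \<theta> = \<Psi> \<theta>"
proof -
  have "us \<theta> = \<Psi> \<theta> \<and> ul \<theta> = \<Psi> \<theta>"
  proof (cases "\<theta> \<in> D")
    case True
    show ?thesis
      using envelope_bounds[OF True] class_D(1)[OF lower(3) assms] class_D(1)[OF upper(3) assms] by linarith
  qed (simp add: upper_envelope_def lower_envelope_def)
  then show "us \<theta> = \<Psi> \<theta>" "ul \<theta> = \<Psi> \<theta>" by auto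
qed

lemma u_mono: 
  assumes "(s, x, w) \<in> D" "(s, x', w) \<in> D" "x \<le> x'" shows "u (s, x, w) \<le> u (s, x', w)"
  unfolding u_eq[OF assms(1)]
proof (rule cSUP_least[OF family_nonempty])
  fix v assume v: "v \<in> \<F>"
  then show "v (s, x, w) \<le> u (s, x', w)"
    using class_D(3)[OF family_D(3)[OF v] assms] family_le_u[OF v assms(2)] by simp
qed

lemma dist_shift: "dist (s, x + b, w) (s', x' + b, w') = dist (s, x, w) (s', x', w' :: real)" for s x w b :: real
  by (simp add: dist_Pair_Pair dist_real_def)

text \<open>A point near (s, x, w) where \<open>u\<close> is large is shifted right by x' - x. The
  shift stays in U and preserves distances, and \<open>u\<close> increases along it.\<close>

lemma us_mono:
  assumes "(s, x, w) \<in> D" "(s, x', w) \<in> D" "x \<le> x'" shows "us (s, x, w) \<le> us (s, x', w)"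
proof (rule ccontr)
  assume "\<not> us (s, x, w) \<le> us (s, x', w)"
  then obtain y where y: "us (s, x', w) < y" "y < us (s, x, w)" using dense[of "us (s, x', w)" "us (s, x, w)"] by auto
  obtain \<rho> where \<rho>: "\<rho> > 0" "\<forall>\<eta>\<in>U. dist \<eta> (s, x', w) \<le> \<rho> \<longrightarrow> u \<eta> < y"
    using envelope_less(1)[OF assms(2) y(1)] by auto
  obtain s1 x1 w1 where \<eta>: "(s1, x1, w1) \<in> U" "dist (s1, x1, w1) (s, x, w) \<le> \<rho>" "y < u (s1, x1, w1)"
    using envelope_less(2)[OF assms(1) y(2) \<rho>(1)] by auto
  have U': "(s1, x1 + (x' - x), w1) \<in> U" using \<eta>(1) assms(3) unfolding iDom_eq by auto
  have "dist (s1, x1 + (x' - x), w1) (s, x', w) = dist (s1, x1, w1) (s, x, w)"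
    using dist_shift[of s1 x1 "x' - x" w1 s x w] by simp
  then have "u (s1, x1 + (x' - x), w1) < y" using \<rho>(2) U' \<eta>(2) by auto
  then show False using \<eta>(3) u_mono[OF UD[OF \<eta>(1)] UD[OF U']] assms(3) by simp
qed

text \<open>Here the shift goes to the left and could leave U. From an interior target a small
  radius prevents this; at a boundary target \<open>ul\<close> agrees with \<open>\<psi>l\<close>,
  whose monotonicity is used instead.\<close>

lemma ul_mono:
  assumes D: "(s, x, w) \<in> D" "(s, x', w) \<in> D" and le: "x \<le> x'" shows "ul (s, x, w) \<le> ul (s, x', w)"
proof (cases "(s, x, w) \<in> Dstarc m \<delta>")
  case True
  then have "ul (s, x, w) = \<psi>l (s, x, w)" by (simp add: envelope_Dstarc class_D(1)[OF lower(3)])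
  also have "\<dots> \<le> \<psi>l (s, x', w)" by (rule class_D(3)[OF lower(3) D le])
  also have "\<dots> \<le> ul (s, x', w)" by (rule envelope_bounds(1)[OF D(2)])
  finally show ?thesis .
next
  case False
  then have xU: "(s, x, w) \<in> U" using Dom_cases[OF \<delta>(1) D(1)] by auto
  show ?thesis
  proof (rule ccontr)
    assume "\<not> ul (s, x, w) \<le> ul (s, x', w)"
    then obtain y where y: "ul (s, x', w) < y" "y < ul (s, x, w)" using dense[of "ul (s, x', w)" "ul (s, x, w)"] by auto
    obtain \<rho> where \<rho>: "\<rho> > 0" "\<forall>\<eta>\<in>U. dist \<eta> (s, x, w) \<le> \<rho> \<longrightarrow> y < u \<eta>"
      using envelope_less(3)[OF D(1) y(2)] by auto
    obtain e where e: "e > 0" "ball (s, x, w) e \<subseteq> U" using xU open_interior by (meson open_contains_ball)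
    obtain s1 x1 w1 where \<eta>: "(s1, x1, w1) \<in> U" "dist (s1, x1, w1) (s, x', w) \<le> min \<rho> (e/2)" "u (s1, x1, w1) < y"
      using envelope_less(4)[OF D(2) y(1), of "min \<rho> (e/2)"] \<rho>(1) e(1) by auto
    have d: "dist (s1, x1 - (x' - x), w1) (s, x, w) = dist (s1, x1, w1) (s, x', w)"
      using dist_shift[of s1 x1 "x - x'" w1 s x' w] by (simp add: diff_diff_eq2 add_diff_eq)
    then have "(s1, x1 - (x' - x), w1) \<in> ball (s, x, w) e" using \<eta>(2) e(1)
      by (simp add: dist_commute)
    then have U': "(s1, x1 - (x' - x), w1) \<in> U" using e(2) by blast
    then have "y < u (s1, x1 - (x' - x), w1)" using \<rho>(2) d \<eta>(2) by auto
    then show False using \<eta>(3) u_mono[OF UD[OF U'] UD[OF \<eta>(1)]] le by simp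
  qed
qed

lemma class_Psi_us: "class_Psi m \<delta> \<Psi> us"
  using envelope_bounds envelope_Dstarc us_mono
  by (intro class_Psi_above[OF lower(3) \<delta>(1)] bounded_between) auto

lemma class_Psi_ul: "class_Psi m \<delta> \<Psi> ul"
  using envelope_bounds envelope_Dstarc ul_mono
  by (intro class_Psi_above[OF lower(3) \<delta>(1)] bounded_between) auto

lemma usc_us: "usc_on D us"
  unfolding usc_on_def
proof (intro ballI allI impI)
  fix \<theta> y assume \<theta>: "\<theta> \<in> D" and "y > us \<theta>"
  then obtain y' where y': "us \<theta> < y'" "y' < y" using dense by blast
  obtain \<rho> where \<rho>: "\<rho> > 0" "\<forall>\<eta>\<in>U. dist \<eta> \<theta> \<le> \<rho> \<longrightarrow> u \<eta> < y'"
    using envelope_less(1)[OF \<theta> y'(1)] by auto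
  have "us \<eta> < y" if \<eta>: "\<eta> \<in> D" "dist \<eta> \<theta> < \<rho> / 2" for \<eta>
  proof (rule ccontr)
    assume "\<not> us \<eta> < y"
    then have "y' < us \<eta>" using y'(2) by simp
    then obtain \<xi> where \<xi>: "\<xi> \<in> U" "dist \<xi> \<eta> \<le> \<rho> / 2" "y' < u \<xi>"
      using envelope_less(2)[OF \<eta>(1), of y' "\<rho> / 2"] \<rho>(1) by auto
    have "dist \<xi> \<theta> \<le> \<rho>" using dist_triangle[of \<xi> \<theta> \<eta>] \<xi>(2) \<eta>(2) by simp
    then show False using \<rho>(2) \<xi>(1,3) by force
  qed
  then show "\<forall>\<^sub>F \<eta> in at \<theta> within D. us \<eta> < y"
    unfolding eventually_at using \<rho>(1) by (intro exI[of _ "\<rho>/2"]) auto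
qed

lemma lsc_ul: "lsc_on D ul"
  unfolding lsc_on_def
proof (intro ballI allI impI)
  fix \<theta> y assume \<theta>: "\<theta> \<in> D" and "y < ul \<theta>"
  then obtain y' where y': "y < y'" "y' < ul \<theta>" using dense by blast
  obtain \<rho> where \<rho>: "\<rho> > 0" "\<forall>\<eta>\<in>U. dist \<eta> \<theta> \<le> \<rho> \<longrightarrow> y' < u \<eta>"
    using envelope_less(3)[OF \<theta> y'(2)] by auto
  have "y < ul \<eta>" if \<eta>: "\<eta> \<in> D" "dist \<eta> \<theta> < \<rho> / 2" for \<eta>
  proof (rule ccontr)
    assume "\<not> y < ul \<eta>"
    then have "ul \<eta> < y'" using y'(1) by simp
    then obtain \<xi> where \<xi>: "\<xi> \<in> U" "dist \<xi> \<eta> \<le> \<rho> / 2" "u \<xi> < y'"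
      using envelope_less(4)[OF \<eta>(1), of y' "\<rho> / 2"] \<rho>(1) by auto
    have "dist \<xi> \<theta> \<le> \<rho>" using dist_triangle[of \<xi> \<theta> \<eta>] \<xi>(2) \<eta>(2) by simp
    then show False using \<rho>(2) \<xi>(1,3) by force
  qed
  then show "\<forall>\<^sub>F \<eta> in at \<theta> within D. y < ul \<eta>"
    unfolding eventually_at using \<rho>(1) by (intro exI[of _ "\<rho>/2"]) auto
qed

section \<open>Subsolution property of the upper envelope\<close>

lemma isCont_lambda: "\<theta> \<in> U \<Longrightarrow> isCont (intensity m) (snd (snd \<theta>))"
  using isCont_intensity[OF sd \<delta>] by (cases \<theta>) auto

lemma quart_sub_U:
  assumes "\<theta>0 \<in> U" "open S" "\<theta>0 \<in> S"
  obtains c where "c > 0" "\<And>c' \<theta>. c' \<le> c \<Longrightarrow> quart \<theta>0 \<theta> \<le> c' \<Longrightarrow> \<theta> \<in> U \<and> \<theta> \<in> S"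
proof -
  have "open (U \<inter> S)" "\<theta>0 \<in> U \<inter> S" using assms by auto
  from quart_le_subset[OF this] obtain c where "c > 0" "\<forall>c'\<le>c. {\<theta>. quart \<theta>0 \<theta> \<le> c'} \<subseteq> U \<inter> S" by blast
  then show thesis by (intro that[of c]) auto
qed

text \<open>The weights may have any limit, because the derivatives of \<open>quart\<close> vanish
  at the centre. The upper envelope uses weights tending to 0, the bump the constant weight
  -1.\<close>

lemma operator_tendsto:
  assumes \<phi>: "test_fun m \<delta> \<phi>" and \<theta>: "\<theta> \<longlonglongrightarrow> \<theta>0" "\<theta>0 \<in> U" "\<And>k. \<theta> k \<in> U"
    and \<kappa>: "\<kappa> \<longlonglongrightarrow> \<kappa>0" and y: "y \<longlonglongrightarrow> \<phi> \<theta>0" and z: "z \<longlonglongrightarrow> Jop m \<delta> \<phi> \<theta>0"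
  shows "(\<lambda>k. Dt \<phi> (\<theta> k) + \<kappa> k * quartt \<theta>0 (\<theta> k) +
      ham_sup m n (\<theta> k) (y k) (Dx \<phi> (\<theta> k) + \<kappa> k * quartx \<theta>0 (\<theta> k)) (Dw \<phi> (\<theta> k) + \<kappa> k * quartw \<theta>0 (\<theta> k))
        (Dx (Dx \<phi>) (\<theta> k) + \<kappa> k * quartxx \<theta>0 (\<theta> k)) (Dw (Dw \<phi>) (\<theta> k) + \<kappa> k * quartww \<theta>0 (\<theta> k))
        (z k - y k)) \<longlonglongrightarrow> Dt \<phi> \<theta>0 + Lop m n \<delta> \<phi> \<theta>0"
proof -
  note p = test_fun_partials[OF \<phi>]
  have c: "(\<lambda>k. f (\<theta> k)) \<longlonglongrightarrow> f \<theta>0" if "continuous_on U f" for f :: "pt \<Rightarrow> real"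
    by (rule continuous_on_tendsto_compose[OF that \<theta>(1,2)]) (simp add: \<theta>(3))
  have q: "(\<lambda>k. \<kappa> k * f (\<theta> k)) \<longlonglongrightarrow> \<kappa>0 * f \<theta>0" if "continuous_on U f" for f :: "pt \<Rightarrow> real"
    by (intro tendsto_mult \<kappa> c that)
  have "(\<lambda>k. Dt \<phi> (\<theta> k) + \<kappa> k * quartt \<theta>0 (\<theta> k) +
      ham_sup m n (\<theta> k) (y k) (Dx \<phi> (\<theta> k) + \<kappa> k * quartx \<theta>0 (\<theta> k)) (Dw \<phi> (\<theta> k) + \<kappa> k * quartw \<theta>0 (\<theta> k))
        (Dx (Dx \<phi>) (\<theta> k) + \<kappa> k * quartxx \<theta>0 (\<theta> k)) (Dw (Dw \<phi>) (\<theta> k) + \<kappa> k * quartww \<theta>0 (\<theta> k))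
        (z k - y k)) \<longlonglongrightarrow> Dt \<phi> \<theta>0 + \<kappa>0 * quartt \<theta>0 \<theta>0 +
      ham_sup m n \<theta>0 (\<phi> \<theta>0) (Dx \<phi> \<theta>0 + \<kappa>0 * quartx \<theta>0 \<theta>0) (Dw \<phi> \<theta>0 + \<kappa>0 * quartw \<theta>0 \<theta>0)
        (Dx (Dx \<phi>) \<theta>0 + \<kappa>0 * quartxx \<theta>0 \<theta>0) (Dw (Dw \<phi>) \<theta>0 + \<kappa>0 * quartww \<theta>0 \<theta>0)
        (Jop m \<delta> \<phi> \<theta>0 - \<phi> \<theta>0)"
    by (intro tendsto_add ham_sup_tendsto_pt[OF data(1) \<theta>(1) isCont_lambda[OF \<theta>(2)]] c q p(2-6)
        continuous_quart y tendsto_diff z)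
  then show ?thesis by (simp add: Lop_ham_sup Iop_Jop)
qed

text \<open>A member of the family that nearly attains \<open>us \<theta>0\<close> loses less than
  \<kappa>c, while the penalty is at least \<kappa>c outside the sublevel set. The maximum over the
  sublevel set is thus global, and c and \<kappa> control both its location and the offset
  a.\<close>

lemma us_touch:
  assumes \<theta>0: "\<theta>0 \<in> U" and \<phi>: "test_fun m \<delta> \<phi>" and eq: "us \<theta>0 = \<phi> \<theta>0"
    and le: "\<And>\<theta>. \<theta> \<in> U \<Longrightarrow> us \<theta> \<le> \<phi> \<theta>" and c: "c > 0" "\<And>\<theta>. quart \<theta>0 \<theta> \<le> c \<Longrightarrow> \<theta> \<in> U"
    and \<kappa>: "\<kappa> > 0"
  shows "\<exists>\<theta> a. quart \<theta>0 \<theta> \<le> c \<and> \<bar>a\<bar> \<le> \<kappa> * c \<and>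
    0 \<le> Dt \<phi> \<theta> + \<kappa> * quartt \<theta>0 \<theta> +
      ham_sup m n \<theta> (\<phi> \<theta> + (a + \<kappa> * quart \<theta>0 \<theta>)) (Dx \<phi> \<theta> + \<kappa> * quartx \<theta>0 \<theta>) (Dw \<phi> \<theta> + \<kappa> * quartw \<theta>0 \<theta>)
        (Dx (Dx \<phi>) \<theta> + \<kappa> * quartxx \<theta>0 \<theta>) (Dw (Dw \<phi>) \<theta> + \<kappa> * quartww \<theta>0 \<theta>)
        (Jop m \<delta> (\<lambda>\<eta>. \<phi> \<eta> + (a + \<kappa> * quart \<theta>0 \<eta>)) \<theta> - (\<phi> \<theta> + (a + \<kappa> * quart \<theta>0 \<theta>)))"
proof -
  note p = test_fun_partials[OF \<phi>]
  have \<kappa>c: "\<kappa> * c > 0" using \<kappa> c(1) by simp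
  have cg: "continuous_on D (\<lambda>\<eta>. \<phi> \<eta> + \<kappa> * quart \<theta>0 \<eta>)"
    by (intro continuous_intros continuous_quart p)
  \<comment> \<open>Half of the allowance \<kappa>c is spent on the variation of the penalised test
    function, the other half on choosing \<eta> and v.\<close>
  obtain d where d: "d > 0" "\<And>\<eta>. \<eta> \<in> D \<Longrightarrow> dist \<eta> \<theta>0 \<le> d \<Longrightarrow>
      \<bar>(\<phi> \<eta> + \<kappa> * quart \<theta>0 \<eta>) - (\<phi> \<theta>0 + \<kappa> * quart \<theta>0 \<theta>0)\<bar> < \<kappa> * c / 2"
    using continuous_near[OF cg UD[OF \<theta>0], of "\<kappa> * c / 2"] \<kappa>c by auto
  obtain \<eta> where \<eta>: "\<eta> \<in> U" "dist \<eta> \<theta>0 \<le> d" "us \<theta>0 - \<kappa> * c / 2 < u \<eta>"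
    using envelope_less(2)[OF UD[OF \<theta>0], of "us \<theta>0 - \<kappa> * c / 2" d] d(1) \<kappa>c by auto
  obtain v where v: "v \<in> \<F>" "us \<theta>0 - \<kappa> * c / 2 < v \<eta>" using less_u[OF UD[OF \<eta>(1)] \<eta>(3)] by auto
  have vphi: "v \<theta> \<le> \<phi> \<theta>" if "\<theta> \<in> U" for \<theta>
    using family_le_u[OF v(1) UD[OF that]] u_le_us[OF that] le[OF that] by linarith
  have v\<eta>: "- (\<kappa> * c) < v \<eta> - \<phi> \<eta> - \<kappa> * quart \<theta>0 \<eta>"
    using d(2)[OF UD[OF \<eta>(1)] \<eta>(2)] v(2) eq unfolding abs_less_iff by simp
  \<comment> \<open>Outside, v \<le> \<phi> and the penalty would push the difference down to
    -\<kappa>c or below.\<close>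
  have \<eta>c: "quart \<theta>0 \<eta> \<le> c"
  proof (rule ccontr)
    assume "\<not> quart \<theta>0 \<eta> \<le> c"
    then have "\<kappa> * c \<le> \<kappa> * quart \<theta>0 \<eta>" using \<kappa> by simp
    then show False using v\<eta> vphi[OF \<eta>(1)] by linarith
  qed
  define N where "N = {\<theta>. quart \<theta>0 \<theta> \<le> c}"
  have ND: "N \<subseteq> D" using c(2) UD by (auto simp: N_def)
  have "\<exists>\<theta>\<in>N. \<forall>\<eta>\<in>N. v \<eta> - \<phi> \<eta> - \<kappa> * quart \<theta>0 \<eta> \<le> v \<theta> - \<phi> \<theta> - \<kappa> * quart \<theta>0 \<theta>"
  proof (rule continuous_attains_sup)
    show "compact N" unfolding N_def by (rule compact_quart_le)
    have "\<eta> \<in> N" using \<eta>c by (simp add: N_def)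
    then show "N \<noteq> {}" by blast
    show "continuous_on N (\<lambda>\<eta>. v \<eta> - \<phi> \<eta> - \<kappa> * quart \<theta>0 \<eta>)"
      by (intro continuous_intros continuous_quart continuous_on_subset[OF family_D(1)[OF v(1)] ND]
        continuous_on_subset[OF p(7) ND])
  qed
  then obtain \<theta> where \<theta>: "quart \<theta>0 \<theta> \<le> c"
    "\<And>\<eta>. quart \<theta>0 \<eta> \<le> c \<Longrightarrow> v \<eta> - \<phi> \<eta> - \<kappa> * quart \<theta>0 \<eta> \<le> v \<theta> - \<phi> \<theta> - \<kappa> * quart \<theta>0 \<theta>"
    by (auto simp: N_def)
  define a where "a = v \<theta> - \<phi> \<theta> - \<kappa> * quart \<theta>0 \<theta>"
  have \<theta>U: "\<theta> \<in> U" using \<theta>(1) c(2) by auto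
  have "0 \<le> \<kappa> * quart \<theta>0 \<theta>" using \<kappa> quart_nonneg by simp
  then have a: "- (\<kappa> * c) < a" "a \<le> 0"
    using \<theta>(2)[OF \<eta>c] v\<eta> vphi[OF \<theta>U] unfolding a_def by linarith+
  have max: "v \<xi> \<le> \<phi> \<xi> + (a + \<kappa> * quart \<theta>0 \<xi>)" if \<xi>: "\<xi> \<in> U" for \<xi>
  proof (cases "quart \<theta>0 \<xi> \<le> c")
    case True then show ?thesis using \<theta>(2)[OF True] by (simp add: a_def)
  next
    case False
    then have "\<kappa> * c \<le> \<kappa> * quart \<theta>0 \<xi>" using \<kappa> by simp
    then show ?thesis using vphi[OF \<xi>] a by linarith
  qed
  obtain s x w where \<theta>_eq: "\<theta> = (s, x, w)" by (cases \<theta>) auto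
  define \<zeta> where "\<zeta> = (\<lambda>(s', x', w'). if (s', x', w') \<in> D
    then \<phi> (s', x', w') + (a + \<kappa> * quart \<theta>0 (s', x', w') + 0 * (w' - w)^4) else 0)"
  note T = quartic_test_fun[OF \<phi> \<theta>U[unfolded \<theta>_eq], of a \<kappa> \<theta>0 0, folded \<zeta>_def \<theta>_eq]
  have \<zeta>: "\<zeta> \<xi> = \<phi> \<xi> + (a + \<kappa> * quart \<theta>0 \<xi>)" if "\<xi> \<in> D" for \<xi>
    using that by (cases \<xi>) (simp add: \<zeta>_def)
  have at: "v \<theta> = \<zeta> \<theta>" using \<zeta>[OF UD[OF \<theta>U]] by (simp add: a_def)
  have "0 \<le> Dt \<zeta> \<theta> + Lop m n \<delta> \<zeta> \<theta>"
    by (rule visc_subsolutionD[OF family_D(2)[OF v(1)] \<theta>U T(1) at]) (simp add: \<zeta> UD max)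
  moreover have "Jop m \<delta> \<zeta> \<theta> = Jop m \<delta> (\<lambda>\<eta>. \<phi> \<eta> + (a + \<kappa> * quart \<theta>0 \<eta>)) \<theta>"
    by (rule Jop_cong[OF \<delta>(1) \<theta>U \<zeta>])
  ultimately have "0 \<le> Dt \<phi> \<theta> + \<kappa> * quartt \<theta>0 \<theta> +
      ham_sup m n \<theta> (\<phi> \<theta> + (a + \<kappa> * quart \<theta>0 \<theta>)) (Dx \<phi> \<theta> + \<kappa> * quartx \<theta>0 \<theta>) (Dw \<phi> \<theta> + \<kappa> * quartw \<theta>0 \<theta>)
        (Dx (Dx \<phi>) \<theta> + \<kappa> * quartxx \<theta>0 \<theta>) (Dw (Dw \<phi>) \<theta> + \<kappa> * quartww \<theta>0 \<theta>)
        (Jop m \<delta> (\<lambda>\<eta>. \<phi> \<eta> + (a + \<kappa> * quart \<theta>0 \<eta>)) \<theta> - (\<phi> \<theta> + (a + \<kappa> * quart \<theta>0 \<theta>)))"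
    unfolding Lop_ham_sup Iop_Jop T(2-6) \<zeta>[OF UD[OF \<theta>U]] by simp
  moreover have "\<bar>a\<bar> \<le> \<kappa> * c" using a by linarith
  ultimately show ?thesis using \<theta>(1) by blast
qed

lemma inverse_Suc_scaled: "(\<lambda>k. c / real (Suc k)) \<longlonglongrightarrow> 0"
  unfolding divide_inverse by (rule tendsto_mult_right_zero[OF LIMSEQ_inverse_real_of_nat])

lemma visc_subsolution_us: "visc_subsolution m n \<delta> us"
  unfolding visc_subsolution_def
proof (intro conjI usc_us ballI allI impI, elim conjE)
  fix \<theta>0 \<phi> assume \<theta>0: "\<theta>0 \<in> U" and \<phi>: "test_fun m \<delta> \<phi>"
    and eq: "us \<theta>0 - \<phi> \<theta>0 = 0" and le: "\<forall>\<theta>\<in>U. us \<theta> - \<phi> \<theta> \<le> 0"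
  note p = test_fun_partials[OF \<phi>]
  obtain c where c: "c > 0" "\<And>c' \<theta>. c' \<le> c \<Longrightarrow> quart \<theta>0 \<theta> \<le> c' \<Longrightarrow> \<theta> \<in> U \<and> \<theta> \<in> UNIV"
    using quart_sub_U[OF \<theta>0, of UNIV] by auto
  \<comment> \<open>Used both as size of the sublevel set and as weight of the quartic, so the
    offset is at most the square of e k.\<close>
  define e where "e = (\<lambda>k. c / real (Suc k))"
  have e: "e k > 0" "e k \<le> c" for k using c(1) by (auto simp: e_def field_simps)
  have e0: "e \<longlonglongrightarrow> 0" unfolding e_def by (rule inverse_Suc_scaled)
  define P where "P = (\<lambda>k \<theta> a. quart \<theta>0 \<theta> \<le> e k \<and> \<bar>a\<bar> \<le> e k * e k \<and>
    0 \<le> Dt \<phi> \<theta> + e k * quartt \<theta>0 \<theta> +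
      ham_sup m n \<theta> (\<phi> \<theta> + (a + e k * quart \<theta>0 \<theta>)) (Dx \<phi> \<theta> + e k * quartx \<theta>0 \<theta>) (Dw \<phi> \<theta> + e k * quartw \<theta>0 \<theta>)
        (Dx (Dx \<phi>) \<theta> + e k * quartxx \<theta>0 \<theta>) (Dw (Dw \<phi>) \<theta> + e k * quartww \<theta>0 \<theta>)
        (Jop m \<delta> (\<lambda>\<eta>. \<phi> \<eta> + (a + e k * quart \<theta>0 \<eta>)) \<theta> - (\<phi> \<theta> + (a + e k * quart \<theta>0 \<theta>))))"
  have "\<forall>k. \<exists>\<theta> a. P k \<theta> a"
    unfolding P_def
  proof (intro allI us_touch[OF \<theta>0 \<phi> _ _ e(1) _ e(1)])
    show "us \<theta> \<le> \<phi> \<theta>" if "\<theta> \<in> U" for \<theta> using le that by auto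
    show "\<theta> \<in> U" if "quart \<theta>0 \<theta> \<le> e k" for k \<theta> using c(2)[OF e(2) that] by simp
  qed (use eq in simp)
  then obtain \<theta> a where P: "\<And>k. P k (\<theta> k) (a k)" by metis
  have \<theta>: "\<And>k. quart \<theta>0 (\<theta> k) \<le> e k" and a: "\<And>k. \<bar>a k\<bar> \<le> e k * e k"
    and nonneg: "\<And>k. 0 \<le> Dt \<phi> (\<theta> k) + e k * quartt \<theta>0 (\<theta> k) +
      ham_sup m n (\<theta> k) (\<phi> (\<theta> k) + (a k + e k * quart \<theta>0 (\<theta> k)))
        (Dx \<phi> (\<theta> k) + e k * quartx \<theta>0 (\<theta> k)) (Dw \<phi> (\<theta> k) + e k * quartw \<theta>0 (\<theta> k))
        (Dx (Dx \<phi>) (\<theta> k) + e k * quartxx \<theta>0 (\<theta> k)) (Dw (Dw \<phi>) (\<theta> k) + e k * quartww \<theta>0 (\<theta> k))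
        (Jop m \<delta> (\<lambda>\<eta>. \<phi> \<eta> + (a k + e k * quart \<theta>0 \<eta>)) (\<theta> k) -
          (\<phi> (\<theta> k) + (a k + e k * quart \<theta>0 (\<theta> k))))"
    using P unfolding P_def by blast+
  have lim: "\<theta> \<longlonglongrightarrow> \<theta>0" by (rule quart_seq_tendsto[OF \<theta> e0])
  have \<theta>U: "\<theta> k \<in> U" for k using c(2)[OF e(2) \<theta>] by auto
  have ee0: "(\<lambda>k. e k * e k) \<longlonglongrightarrow> 0" using tendsto_mult[OF e0 e0] by simp
  have a0: "a \<longlonglongrightarrow> 0" by (rule Lim_null_comparison[OF _ ee0]) (simp add: a)
  have cU: "(\<lambda>k. f (\<theta> k)) \<longlonglongrightarrow> f \<theta>0" if "continuous_on U f" for f :: "pt \<Rightarrow> real"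
    by (rule continuous_on_tendsto_compose[OF that lim \<theta>0]) (simp add: \<theta>U)
  have "(\<lambda>k. \<phi> (\<theta> k) + (a k + e k * quart \<theta>0 (\<theta> k))) \<longlonglongrightarrow> \<phi> \<theta>0 + (0 + 0 * quart \<theta>0 \<theta>0)"
    by (intro tendsto_add tendsto_mult e0 a0 cU continuous_quart continuous_on_subset[OF p(7) interior_subset])
  then have y: "(\<lambda>k. \<phi> (\<theta> k) + (a k + e k * quart \<theta>0 (\<theta> k))) \<longlonglongrightarrow> \<phi> \<theta>0" by simp
  have z: "(\<lambda>k. Jop m \<delta> (\<lambda>\<eta>. \<phi> \<eta> + (a k + e k * quart \<theta>0 \<eta>)) (\<theta> k)) \<longlonglongrightarrow> Jop m \<delta> \<phi> \<theta>0"
    by (rule Jop_tendsto[OF sd \<delta>(1) lim \<theta>0 \<theta>U p(7) continuous_quart(1) e0 a0])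
  show "0 \<le> Dt \<phi> \<theta>0 + Lop m n \<delta> \<phi> \<theta>0"
    by (rule LIMSEQ_le_const[OF operator_tendsto[OF \<phi> lim \<theta>0 \<theta>U e0 y z]]) (use nonneg in blast)
qed

end

section \<open>Supersolution property of the lower envelope\<close>

text \<open>Degenerate ellipticity together with monotonicity in the nonlocal variable; the latter
  is where \<lambda> \<ge> 0 is indispensable.\<close>

lemma Hamn_mono:
  assumes "0 \<le> intensity m w" "0 \<le> epsseq m n" "A \<le> A'" "B \<le> B'" "z \<le> z'"
  shows "Hamn m n (s, x, w) y (p, q) A B z \<gamma> \<alpha> \<le> Hamn m n (s, x, w) y (p, q) A' B' z' \<gamma> \<alpha>"
proof -
  have "((vola m)\<^sup>2 / 2 * x\<^sup>2 * A) * \<gamma>\<^sup>2 \<le> ((vola m)\<^sup>2 / 2 * x\<^sup>2 * A') * \<gamma>\<^sup>2"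
    using assms(3) by (intro mult_right_mono mult_left_mono) auto
  moreover have "intensity m w * z \<le> intensity m w * z'" "epsseq m n / 2 * A \<le> epsseq m n / 2 * A'"
    "epsseq m n / 2 * B \<le> epsseq m n / 2 * B'"
    using assms by (auto intro!: mult_left_mono)
  ultimately show ?thesis unfolding Hamn_expand by linarith
qed

text \<open>With vanishing slope and \<open>A \<le> 0\<close> the control \<open>\<gamma> = 0\<close> is optimal, and \<open>x\<close> drops out of the Hamiltonian.\<close>

lemma Hamn_flat_le:
  assumes "A \<le> 0"
  shows "Hamn m n (s, x', w) y (0, q) A B z \<gamma> \<alpha> \<le> Hamn m n (s, x, w) y (0, q) A B z 0 \<alpha>"
proof -
  have "((vola m)\<^sup>2 / 2 * x'\<^sup>2) * A \<le> 0" by (rule mult_nonneg_nonpos[OF _ assms]) simp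
  then have "((vola m)\<^sup>2 / 2 * x'\<^sup>2 * A) * \<gamma>\<^sup>2 \<le> 0" by (rule mult_nonpos_nonneg) simp
  then show ?thesis unfolding Hamn_expand by simp
qed

context perron
begin

lemma lambda_nonneg: "(s, x, w) \<in> U \<Longrightarrow> 0 \<le> intensity m w"
  by (rule intensity_nonneg[OF sd \<delta> lower(1,2) class_D(2)[OF lower(3)]])

text \<open>Where a test function touches the maximum from above, it touches one of the two members
  from above as well.\<close>

lemma family_max:
  assumes v1: "v1 \<in> \<F>" and v2: "v2 \<in> \<F>"
  shows "(\<lambda>\<theta>. max (v1 \<theta>) (v2 \<theta>)) \<in> \<F>"
proof -
  let ?v = "\<lambda>\<theta>. max (v1 \<theta>) (v2 \<theta>)"
  note D = family_D[OF v1] family_D[OF v2]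
  have c: "continuous_on D ?v" by (intro continuous_intros D)
  have b: "\<psi>l \<theta> \<le> ?v \<theta>" "?v \<theta> \<le> \<psi>u \<theta>" if "\<theta> \<in> D" for \<theta>
    using D(4,5,9,10)[OF that] by auto
  have "visc_subsolution m n \<delta> ?v"
    unfolding visc_subsolution_def
  proof (intro conjI continuous_imp_usc_on c ballI allI impI, elim conjE)
    fix \<theta> \<phi> assume \<theta>: "\<theta> \<in> U" and \<phi>: "test_fun m \<delta> \<phi>" and eq: "?v \<theta> - \<phi> \<theta> = 0"
      and le: "\<forall>\<theta>\<in>U. ?v \<theta> - \<phi> \<theta> \<le> 0"
    have le': "v1 \<eta> \<le> \<phi> \<eta>" "v2 \<eta> \<le> \<phi> \<eta>" if "\<eta> \<in> U" for \<eta>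
      using le that by (metis diff_le_0_iff_le max.bounded_iff)+
    have "v1 \<theta> = \<phi> \<theta> \<or> v2 \<theta> = \<phi> \<theta>" using eq by (auto simp: max_def split: if_splits)
    then show "0 \<le> Dt \<phi> \<theta> + Lop m n \<delta> \<phi> \<theta>"
      using visc_subsolutionD[OF D(2) \<theta> \<phi> _ le'(1)] visc_subsolutionD[OF D(7) \<theta> \<phi> _ le'(2)] by blast
  qed
  moreover have "class_Psi m \<delta> \<Psi> ?v"
  proof (rule class_Psi_above[OF D(3) \<delta>(1)])
    show "bounded (?v ` D)" by (rule bounded_between[OF b])
    show "?v \<theta> = \<Psi> \<theta>" if "\<theta> \<in> Dstarc m \<delta>" for \<theta>
      using class_D(1)[OF D(3) that] class_D(1)[OF D(8) that] by simp
    show "?v (s, x, w) \<le> ?v (s, x', w)" if "(s, x, w) \<in> D" "(s, x', w) \<in> D" "x \<le> x'" for s x x' w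
      using class_D(3)[OF D(3) that] class_D(3)[OF D(8) that] by (rule max.mono)
  qed simp
  ultimately show ?thesis using c b by (simp add: perron_family_def)
qed

text \<open>Lets a finite subcover of a compact set, indexed by members of the family, be replaced
  by a single member.\<close>

lemma family_dominates:
  assumes "finite X" "X \<noteq> {}" "X \<subseteq> \<F>"
  shows "\<exists>v\<in>\<F>. \<forall>v'\<in>X. \<forall>\<theta>. v' \<theta> \<le> v \<theta>"
  using assms
proof (induction X rule: finite_ne_induct)
  case (singleton x)
  then show ?case by auto
next
  case (insert x X)
  then obtain v where v: "v \<in> \<F>" "\<forall>v'\<in>X. \<forall>\<theta>. v' \<theta> \<le> v \<theta>" by auto
  have "(\<lambda>\<theta>. max (x \<theta>) (v \<theta>)) \<in> \<F>" using insert.prems v(1) by (intro family_max) auto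
  moreover have "\<forall>v'\<in>insert x X. \<forall>\<theta>. v' \<theta> \<le> max (x \<theta>) (v \<theta>)"
    using v(2) by (auto simp: le_max_iff_disj)
  ultimately show ?case by (intro bexI[where x = "\<lambda>\<theta>. max (x \<theta>) (v \<theta>)"])
qed

lemma iDom_right: "(s, y, w) \<in> U \<Longrightarrow> y \<le> x \<Longrightarrow> (s, x, w) \<in> U"
  by (auto simp: iDom_eq)

text \<open>The factor -1 is left explicit so that the bump literally matches the weight -1 in
  \<open>operator_tendsto\<close>.\<close>

lemma bump_partials:
  assumes "test_fun m \<delta> \<phi>"
  shows "has_partials U (\<lambda>\<theta>. \<phi> \<theta> + (a + (-1) * quart \<theta>0 \<theta>)) (\<lambda>\<theta>. Dt \<phi> \<theta> + (-1) * quartt \<theta>0 \<theta>)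
    (\<lambda>\<theta>. Dx \<phi> \<theta> + (-1) * quartx \<theta>0 \<theta>) (\<lambda>\<theta>. Dx (Dx \<phi>) \<theta> + (-1) * quartxx \<theta>0 \<theta>)
    (\<lambda>\<theta>. Dw \<phi> \<theta> + (-1) * quartw \<theta>0 \<theta>) (\<lambda>\<theta>. Dw (Dw \<phi>) \<theta> + (-1) * quartww \<theta>0 \<theta>)"
  by (rule has_partials_transform[OF open_interior has_partials_add[OF test_fun_partials(1)[OF assms]
      has_partials_subset[OF has_partials_quart[of a "-1" \<theta>0 0 0] subset_UNIV]]]) auto

text \<open>The maximum of \<open>v\<close> and the bump \<open>\<psi>\<close> need not be increasing in \<open>x\<close>, hence its monotone hull \<open>W\<close>. At
  a point where the hull is attained strictly to the left, the bump has zero slope and is concave in \<open>x\<close>.\<close>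

lemma bump_family:
  assumes \<psi>_def: "\<psi> = (\<lambda>\<theta>. \<phi> \<theta> + (a + (-1) * quart \<theta>0 \<theta>))"
    and v: "v \<in> \<F>" and \<phi>: "test_fun m \<delta> \<phi>" and c: "0 < c" "\<And>\<theta>. quart \<theta>0 \<theta> \<le> c \<Longrightarrow> \<theta> \<in> U"
    and \<phi>_le: "\<And>\<theta>. \<theta> \<in> D \<Longrightarrow> \<phi> \<theta> \<le> \<psi>u \<theta>" and \<psi>_le: "\<And>\<theta>. quart \<theta>0 \<theta> \<le> c \<Longrightarrow> \<psi> \<theta> \<le> \<psi>u \<theta>"
    and ann: "\<And>\<theta>. c / 2 \<le> quart \<theta>0 \<theta> \<Longrightarrow> quart \<theta>0 \<theta> \<le> c \<Longrightarrow> \<psi> \<theta> < v \<theta>"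
    and strict: "\<And>\<theta>. quart \<theta>0 \<theta> \<le> c \<Longrightarrow> 0 < Dt \<phi> \<theta> + (-1) * quartt \<theta>0 \<theta> +
      ham_sup m n \<theta> (\<psi> \<theta>) (Dx \<phi> \<theta> + (-1) * quartx \<theta>0 \<theta>) (Dw \<phi> \<theta> + (-1) * quartw \<theta>0 \<theta>)
        (Dx (Dx \<phi>) \<theta> + (-1) * quartxx \<theta>0 \<theta>) (Dw (Dw \<phi>) \<theta> + (-1) * quartww \<theta>0 \<theta>)
        (Jop m \<delta> \<phi> \<theta> - \<psi> \<theta>)"
  shows "\<exists>W\<in>\<F>. \<forall>\<theta>. quart \<theta>0 \<theta> \<le> c \<longrightarrow> \<psi> \<theta> \<le> W \<theta>"
proof -
  define w where "w = (\<lambda>\<theta>. if quart \<theta>0 \<theta> \<le> c then max (v \<theta>) (\<psi> \<theta>) else v \<theta>)"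
  define W where "W = (\<lambda>\<theta>. if \<theta> \<in> D then xhull \<delta> w \<theta> else \<Psi> \<theta>)"
  note fv = family_D[OF v]
  note p\<phi> = test_fun_partials[OF \<phi>]
  have c\<psi>: "continuous_on X \<psi>" if "X \<subseteq> D" for X
    unfolding \<psi>_def by (intro continuous_intros continuous_quart continuous_on_subset[OF p\<phi>(7) that])
  have cw: "continuous_on D w"
    unfolding w_def
  proof (rule continuous_on_cases_le)
    show "continuous_on {\<theta> \<in> D. quart \<theta>0 \<theta> \<le> c} (\<lambda>\<theta>. max (v \<theta>) (\<psi> \<theta>))"
      by (intro continuous_on_max c\<psi> continuous_on_subset[OF fv(1)]) auto
    show "continuous_on {\<theta> \<in> D. c \<le> quart \<theta>0 \<theta>} v"
      by (rule continuous_on_subset[OF fv(1)]) auto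
    \<comment> \<open>On the edge of the pasting region v already lies above the bump, so the two
      branches agree.\<close>
    show "max (v \<theta>) (\<psi> \<theta>) = v \<theta>" if "quart \<theta>0 \<theta> = c" for \<theta>
      using ann[of \<theta>] c(1) that by simp
  qed (rule continuous_quart)
  have vw: "v \<theta> \<le> w \<theta>" and \<psi>w: "quart \<theta>0 \<theta> \<le> c \<Longrightarrow> \<psi> \<theta> \<le> w \<theta>" for \<theta> by (auto simp: w_def)
  have WD: "W \<theta> = xhull \<delta> w \<theta>" if "\<theta> \<in> D" for \<theta> using that by (simp add: W_def)
  have cW: "continuous_on D W"
    by (rule continuous_on_eq[OF continuous_on_xhull[OF cw]]) (simp add: WD)
  have wW: "w \<theta> \<le> W \<theta>" if "\<theta> \<in> D" for \<theta> using xhull_ge[OF cw that] WD[OF that] by simp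
  have \<psi>W: "\<psi> \<theta> \<le> W \<theta>" if "quart \<theta>0 \<theta> \<le> c" for \<theta>
    using \<psi>w[OF that] wW[OF UD[OF c(2)[OF that]]] by simp
  have vW: "v \<theta> \<le> W \<theta>" if "\<theta> \<in> D" for \<theta> using vw[of \<theta>] wW[OF that] by simp
  have Wmono: "W (s, x, r) \<le> W (s, x', r)" if "(s, x, r) \<in> D" "(s, x', r) \<in> D" "x \<le> x'" for s x x' r
    using xhull_mono[OF cw that(2)] that WD by (auto simp: Dom_def)
  have att: "\<exists>y\<in>{-\<delta>..x}. W (s, x, r) = w (s, y, r)" if "(s, x, r) \<in> D" for s x r
    using xhull_attained[OF cw that] WD[OF that] by simp
  \<comment> \<open>The value of W comes from a point further left, and \<open>\<psi>u\<close> is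
    increasing in x.\<close>
  have Wu: "W \<theta> \<le> \<psi>u \<theta>" if \<theta>: "\<theta> \<in> D" for \<theta>
  proof -
    obtain s x r where \<theta>_eq: "\<theta> = (s, x, r)" by (cases \<theta>) auto
    obtain y where y: "y \<in> {-\<delta>..x}" "W \<theta> = w (s, y, r)" using att[OF \<theta>[unfolded \<theta>_eq]] \<theta>_eq by auto
    have yD: "(s, y, r) \<in> D" using Dom_x_segment y(1) \<theta> \<theta>_eq by auto
    have "w (s, y, r) \<le> \<psi>u (s, y, r)" using fv(5)[OF yD] \<psi>_le by (auto simp: w_def)
    also have "\<dots> \<le> \<psi>u \<theta>" unfolding \<theta>_eq
      using class_D(3)[OF upper(3) yD \<theta>[unfolded \<theta>_eq]] y(1) by simp
    finally show ?thesis using y(2) by simp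
  qed
  have Wl: "\<psi>l \<theta> \<le> W \<theta>" if "\<theta> \<in> D" for \<theta> using fv(4)[OF that] vW[OF that] by simp
  have bdry: "W \<theta> = \<Psi> \<theta>" if \<theta>: "\<theta> \<in> Dstarc m \<delta>" for \<theta>
  proof (cases "\<theta> \<in> D")
    case True
    obtain s x r where \<theta>_eq: "\<theta> = (s, x, r)" by (cases \<theta>) auto
    obtain y where y: "y \<in> {-\<delta>..x}" "W \<theta> = w (s, y, r)" using att[OF True[unfolded \<theta>_eq]] \<theta>_eq by auto
    have yD: "(s, y, r) \<in> D" using Dom_x_segment y(1) True \<theta>_eq by auto
    \<comment> \<open>U is stable under increasing x, so no point of U lies to the left of a
      boundary point. The bump is absent there and w = v.\<close>
    have "(s, y, r) \<notin> U" using iDom_right[of s y r x] y(1) iDom_notin_Dstarc \<theta> unfolding \<theta>_eq by auto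
    then have "w (s, y, r) = v (s, y, r)" using c(2) by (auto simp: w_def)
    also have "\<dots> \<le> v \<theta>" unfolding \<theta>_eq
      using class_D(3)[OF fv(3) yD True[unfolded \<theta>_eq]] y(1) by simp
    finally show ?thesis using vW[OF True] y(2) class_D(1)[OF fv(3) \<theta>] by simp
  qed (simp add: W_def)
  have clW: "class_Psi m \<delta> \<Psi> W"
    by (rule class_Psi_above[OF fv(3) \<delta>(1) bdry Wmono bounded_between[OF Wl Wu] vW])
  have "visc_subsolution m n \<delta> W"
    unfolding visc_subsolution_def
  proof (intro conjI continuous_imp_usc_on cW ballI allI impI, elim conjE)
    fix \<theta>1 \<zeta> assume \<theta>1: "\<theta>1 \<in> U" and \<zeta>: "test_fun m \<delta> \<zeta>" and eq: "W \<theta>1 - \<zeta> \<theta>1 = 0"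
      and le: "\<forall>\<theta>\<in>U. W \<theta> - \<zeta> \<theta> \<le> 0"
    note p\<zeta> = test_fun_partials[OF \<zeta>]
    have W\<zeta>: "W \<theta> \<le> \<zeta> \<theta>" if "\<theta> \<in> U" for \<theta> using le that by auto
    obtain s x r where \<theta>1_eq: "\<theta>1 = (s, x, r)" by (cases \<theta>1) auto
    note xU = \<theta>1[unfolded \<theta>1_eq]
    obtain x' where x': "x' \<in> {-\<delta>..x}" "W \<theta>1 = w (s, x', r)" using att[OF UD[OF xU]] \<theta>1_eq by auto
    define \<theta>' where "\<theta>' = (s, x', r)"
    have \<theta>'D: "\<theta>' \<in> D" using Dom_x_segment[OF UD[OF xU] x'(1)] by (simp add: \<theta>'_def)
    show "0 \<le> Dt \<zeta> \<theta>1 + Lop m n \<delta> \<zeta> \<theta>1"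
    proof (cases "w \<theta>' = v \<theta>'")
      case True
      \<comment> \<open>Contact through v: since W \<theta>1 = v \<theta>' \<le> v \<theta>1 \<le> W
        \<theta>1, the test function touches v at \<theta>1 itself.\<close>
      have "v \<theta>' \<le> v \<theta>1" unfolding \<theta>1_eq \<theta>'_def
        using class_D(3)[OF fv(3) \<theta>'D[unfolded \<theta>'_def] UD[OF xU]] x'(1) by simp
      then have eqv: "v \<theta>1 = \<zeta> \<theta>1" using vW[OF UD[OF \<theta>1]] x'(2) True eq by (simp add: \<theta>'_def)
      have "v \<eta> \<le> \<zeta> \<eta>" if "\<eta> \<in> U" for \<eta> using vW[OF UD[OF that]] W\<zeta>[OF that] by simp
      then show ?thesis by (rule visc_subsolutionD[OF fv(2) \<theta>1 \<zeta> eqv])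
    next
      case False
      then have \<theta>'c: "quart \<theta>0 \<theta>' \<le> c" and w\<theta>': "w \<theta>' = \<psi> \<theta>'" and "v \<theta>' < \<psi> \<theta>'"
        by (auto simp: w_def max_def split: if_splits)
      \<comment> \<open>Contact through the bump cannot occur where v is strictly above it. Hence
        \<psi> \<le> W on a whole neighbourhood of \<theta>', as the derivative tests
        require.\<close>
      then have half: "quart \<theta>0 \<theta>' < c / 2" using ann[of \<theta>'] by force
      note \<theta>'U = c(2)[OF \<theta>'c]
      define S where "S = U \<inter> {\<eta>. quart \<theta>0 \<eta> < c}"
      have oS: "open S" unfolding S_def
        by (intro open_Int open_interior open_Collect_less continuous_quart continuous_intros)
      have SU: "S \<subseteq> U" by (auto simp: S_def)
      have \<theta>'S: "(s, x', r) \<in> S" using \<theta>'U half c(1) by (simp add: S_def \<theta>'_def)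
      define b where "b = x - x'"
      have b: "0 \<le> b" "x' + b = x" using x'(1) by (auto simp: b_def)
      have eq\<theta>': "\<zeta> (s, x, r) = \<psi> (s, x', r)" using eq x'(2) w\<theta>' by (simp add: \<theta>1_eq \<theta>'_def)
      have shiftU: "(s2, x2 + b, r2) \<in> U" if "(s2, x2, r2) \<in> S" for s2 x2 r2
        using iDom_right[of s2 x2 r2 "x2 + b"] that b(1) SU by auto
      \<comment> \<open>The shifted test function minus the bump is minimal at \<theta>', because W
        is increasing in x.\<close>
      have touch: "(case (s, x', r) of (s, x, r) \<Rightarrow> \<zeta> (s, x + b, r)) - \<psi> (s, x', r)
          \<le> (case \<eta> of (s, x, r) \<Rightarrow> \<zeta> (s, x + b, r)) - \<psi> \<eta>" if \<eta>: "\<eta> \<in> S" for \<eta>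
      proof -
        obtain s2 x2 r2 where \<eta>_eq: "\<eta> = (s2, x2, r2)" by (cases \<eta>) auto
        have "\<psi> \<eta> \<le> W \<eta>" using \<eta> by (intro \<psi>W) (simp add: S_def)
        also have "\<dots> \<le> W (s2, x2 + b, r2)" unfolding \<eta>_eq
          using \<eta> SU shiftU[OF \<eta>[unfolded \<eta>_eq]] b(1) by (intro Wmono UD) (auto simp: \<eta>_eq)
        also have "\<dots> \<le> \<zeta> (s2, x2 + b, r2)" by (rule W\<zeta>[OF shiftU[OF \<eta>[unfolded \<eta>_eq]]])
        finally show ?thesis using eq\<theta>' b(2) by (simp add: \<eta>_eq)
      qed
      define \<psi>x where "\<psi>x = (\<lambda>\<theta>. Dx \<phi> \<theta> + (-1) * quartx \<theta>0 \<theta>)"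
      define \<psi>xx where "\<psi>xx = (\<lambda>\<theta>. Dx (Dx \<phi>) \<theta> + (-1) * quartxx \<theta>0 \<theta>)"
      note P = has_partials_subset[OF bump_partials[OF \<phi>, of a \<theta>0] SU, folded \<psi>_def, folded \<psi>x_def \<psi>xx_def]
      note Z = has_partials_min[OF oS \<theta>'S has_partials_diff[OF has_partials_shift_x[OF p\<zeta>(1) shiftU] P] touch,
          unfolded prod.case b(2)]
      have deriv: "Dt \<zeta> \<theta>1 = Dt \<phi> \<theta>' + (-1) * quartt \<theta>0 \<theta>'" "Dx \<zeta> \<theta>1 = \<psi>x \<theta>'"
        "Dw \<zeta> \<theta>1 = Dw \<phi> \<theta>' + (-1) * quartw \<theta>0 \<theta>'" "\<psi>xx \<theta>' \<le> Dx (Dx \<zeta>) \<theta>1"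
        "Dw (Dw \<phi>) \<theta>' + (-1) * quartww \<theta>0 \<theta>' \<le> Dw (Dw \<zeta>) \<theta>1"
        using Z unfolding \<theta>1_eq \<theta>'_def by linarith+
      \<comment> \<open>Near x' and left of x, \<psi> \<le> W \<le> W \<theta>1 = \<psi> \<theta>',
        so \<psi> has a local maximum in x at x'.\<close>
      have flat: "\<psi>x \<theta>' = 0 \<and> \<psi>xx \<theta>' \<le> 0" if "x' < x"
      proof -
        have "open ({y. (s, y, r) \<in> S} \<inter> {..<x})" by (intro open_Int open_sections oS) auto
        moreover have "x' \<in> {y. (s, y, r) \<in> S} \<inter> {..<x}" using \<theta>'S that by auto
        ultimately obtain d where "d > 0"
          "\<forall>y. \<bar>y - x'\<bar> < d \<longrightarrow> y \<in> {y. (s, y, r) \<in> S} \<inter> {..<x}"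
          unfolding open_dist dist_real_def by blast
        then have d: "d > 0" "\<And>y. \<bar>y - x'\<bar> < d \<Longrightarrow> (s, y, r) \<in> S \<and> y < x" by auto
        have 1: "((\<lambda>y. - \<psi> (s, y, r)) has_real_derivative - \<psi>x (s, z, r)) (at z)" if "\<bar>z - x'\<bar> < d" for z
          using P d(2)[OF that] unfolding has_partials_def by (intro DERIV_minus) blast
        have 2: "((\<lambda>y. - \<psi>x (s, y, r)) has_real_derivative - \<psi>xx (s, x', r)) (at x')"
          using P \<theta>'S unfolding has_partials_def by (intro DERIV_minus) blast
        have 3: "- \<psi> (s, x', r) \<le> - \<psi> (s, z, r)" if z: "\<bar>z - x'\<bar> < d" for z
        proof -
          have zS: "(s, z, r) \<in> S" "z < x" using d(2)[OF z] by auto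
          then have "\<psi> (s, z, r) \<le> W (s, z, r)" by (intro \<psi>W) (simp add: S_def)
          also have "\<dots> \<le> W (s, x, r)" using zS SU xU by (intro Wmono UD) auto
          finally show ?thesis using x'(2) w\<theta>' by (simp add: \<theta>1_eq \<theta>'_def)
        qed
        show ?thesis using local_min_second_derivative[OF d(1) 1 2 3] by (simp add: \<theta>'_def)
      qed
      have \<lambda>: "0 \<le> intensity m r" by (rule lambda_nonneg[OF xU])
      have v\<zeta>: "v \<theta> \<le> \<zeta> \<theta>" if "\<theta> \<in> D" for \<theta>
        by (rule le_on_Dom[OF D_closure fv(1) p\<zeta>(7) _ that]) (use vW W\<zeta> UD in \<open>blast intro: order_trans\<close>)
      \<comment> \<open>On the landing face \<phi> \<le> \<open>\<psi>u\<close> = \<Psi> = v, then v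
        increases in x and stays below \<zeta>. Nonnegativity of \<zeta> for the additional jumps
        comes from \<Psi> = v \<le> \<zeta> there.\<close>
      have J: "Jop m \<delta> \<phi> \<theta>' \<le> Jop m \<delta> \<zeta> \<theta>1"
        unfolding \<theta>1_eq \<theta>'_def
      proof (rule Jop_mono[OF sd \<delta>(1) xU \<theta>'U[unfolded \<theta>'_def] p\<phi>(7) p\<zeta>(7)])
        show "x' \<le> x" using x'(1) by simp
        show "0 \<le> \<zeta> (s, x - t, -\<delta>)" if "t \<in> {0..x + \<delta>}" for t
          using class_D(1)[OF fv(3) jump_in_Dom(2)[OF \<delta>(1) xU that]]
            v\<zeta>[OF jump_in_Dom(1)[OF \<delta>(1) xU that]] Psi_nonneg[OF jump_in_Dom(1)[OF \<delta>(1) xU that]]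
          by linarith
        fix t assume t: "t \<in> {0..x' + \<delta>}"
        note j' = jump_in_Dom[OF \<delta>(1) \<theta>'U[unfolded \<theta>'_def] t]
        have j: "(s, x - t, -\<delta>) \<in> D" using t x'(1) by (intro jump_in_Dom(1)[OF \<delta>(1) xU]) auto
        have "\<phi> (s, x' - t, -\<delta>) \<le> \<psi>u (s, x' - t, -\<delta>)" by (rule \<phi>_le[OF j'(1)])
        also have "\<dots> = v (s, x' - t, -\<delta>)"
          using class_D(1)[OF upper(3) j'(2)] class_D(1)[OF fv(3) j'(2)] by simp
        also have "\<dots> \<le> v (s, x - t, -\<delta>)" using x'(1) by (intro class_D(3)[OF fv(3) j'(1) j]) auto
        also have "\<dots> \<le> \<zeta> (s, x - t, -\<delta>)" by (rule v\<zeta>[OF j])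
        finally show "\<phi> (s, x' - t, -\<delta>) \<le> \<zeta> (s, x - t, -\<delta>)" .
      qed
      have eqy: "\<psi> \<theta>' = \<zeta> \<theta>1" using eq\<theta>' by (simp add: \<theta>1_eq \<theta>'_def)
      have "ham_sup m n \<theta>' (\<psi> \<theta>') (\<psi>x \<theta>') (Dw \<phi> \<theta>' + (-1) * quartw \<theta>0 \<theta>')
          (\<psi>xx \<theta>') (Dw (Dw \<phi>) \<theta>' + (-1) * quartww \<theta>0 \<theta>') (Jop m \<delta> \<phi> \<theta>' - \<psi> \<theta>')
        \<le> ham_sup m n \<theta>1 (\<zeta> \<theta>1) (Dx \<zeta> \<theta>1) (Dw \<zeta> \<theta>1) (Dx (Dx \<zeta>) \<theta>1) (Dw (Dw \<zeta>) \<theta>1)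
          (Jop m \<delta> \<zeta> \<theta>1 - \<zeta> \<theta>1)"
        unfolding deriv(2,3) eqy
      proof (rule ham_sup_mono[OF data(1)])
        fix \<gamma> \<alpha> :: real assume \<gamma>: "\<gamma> \<in> {0..1}"
        let ?H = "\<lambda>x A B z \<gamma>. Hamn m n (s, x, r) (\<zeta> \<theta>1) (\<psi>x \<theta>', Dw \<phi> \<theta>' + (-1) * quartw \<theta>0 \<theta>') A B z \<gamma> \<alpha>"
        let ?B = "Dw (Dw \<phi>) \<theta>' + (-1) * quartww \<theta>0 \<theta>'"
        have mono: "?H x (\<psi>xx \<theta>') ?B (Jop m \<delta> \<phi> \<theta>' - \<zeta> \<theta>1) \<gamma>' \<le>
            ?H x (Dx (Dx \<zeta>) \<theta>1) (Dw (Dw \<zeta>) \<theta>1) (Jop m \<delta> \<zeta> \<theta>1 - \<zeta> \<theta>1) \<gamma>'" for \<gamma>'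
          using \<lambda> data(2) deriv(4,5) J by (intro Hamn_mono) auto
        \<comment> \<open>For x' = x the control is kept. Otherwise slope 0 and concavity make
          \<gamma> = 0 at least as good, and then the Hamiltonian is the same at x' and x.\<close>
        have "\<exists>\<gamma>'\<in>{0..1}. ?H x' (\<psi>xx \<theta>') ?B (Jop m \<delta> \<phi> \<theta>' - \<zeta> \<theta>1) \<gamma> \<le>
            ?H x (\<psi>xx \<theta>') ?B (Jop m \<delta> \<phi> \<theta>' - \<zeta> \<theta>1) \<gamma>'"
        proof (cases "x' = x")
          case True then show ?thesis using \<gamma> by (intro bexI[of _ \<gamma>]) auto
        next
          case False
          then have f: "\<psi>x \<theta>' = 0" "\<psi>xx \<theta>' \<le> 0" using flat x'(1) by auto
          show ?thesis unfolding f(1) by (intro bexI[of _ 0] Hamn_flat_le f(2)) auto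
        qed
        then obtain \<gamma>' where \<gamma>': "\<gamma>' \<in> {0..1}" "?H x' (\<psi>xx \<theta>') ?B (Jop m \<delta> \<phi> \<theta>' - \<zeta> \<theta>1) \<gamma> \<le>
            ?H x (\<psi>xx \<theta>') ?B (Jop m \<delta> \<phi> \<theta>' - \<zeta> \<theta>1) \<gamma>'" by blast
        from order_trans[OF \<gamma>'(2) mono] \<gamma>'(1)
        show "\<exists>\<gamma>'\<in>{0..1}. Hamn m n \<theta>' (\<zeta> \<theta>1) (\<psi>x \<theta>', Dw \<phi> \<theta>' + (-1) * quartw \<theta>0 \<theta>')
            (\<psi>xx \<theta>') ?B (Jop m \<delta> \<phi> \<theta>' - \<zeta> \<theta>1) \<gamma> \<alpha> \<le>
          Hamn m n \<theta>1 (\<zeta> \<theta>1) (\<psi>x \<theta>', Dw \<phi> \<theta>' + (-1) * quartw \<theta>0 \<theta>') (Dx (Dx \<zeta>) \<theta>1) (Dw (Dw \<zeta>) \<theta>1)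
            (Jop m \<delta> \<zeta> \<theta>1 - \<zeta> \<theta>1) \<gamma>' \<alpha>"
          unfolding \<theta>1_eq \<theta>'_def by blast
      qed
      then show ?thesis
        using strict[OF \<theta>'c] unfolding Lop_ham_sup Iop_Jop deriv(1) \<psi>x_def \<psi>xx_def by linarith
    qed
  qed
  then have "W \<in> \<F>" using cW clW Wl Wu by (simp add: perron_family_def)
  then show ?thesis using \<psi>W by blast
qed

lemma visc_supersolution_ul: "visc_supersolution m n \<delta> ul"
  unfolding visc_supersolution_def
proof (intro conjI lsc_ul ballI allI impI, elim conjE)
  fix \<theta>0 \<phi> assume \<theta>0: "\<theta>0 \<in> U" and \<phi>: "test_fun m \<delta> \<phi>"
    and eq: "ul \<theta>0 - \<phi> \<theta>0 = 0" and ge: "\<forall>\<theta>\<in>U. 0 \<le> ul \<theta> - \<phi> \<theta>"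
  note p = test_fun_partials[OF \<phi>]
  have \<phi>ul: "\<phi> \<theta> \<le> ul \<theta>" if "\<theta> \<in> U" for \<theta> using ge that by auto
  have \<phi>u: "\<phi> \<theta> \<le> \<psi>u \<theta>" if "\<theta> \<in> D" for \<theta>
    by (rule le_on_Dom[OF D_closure p(7) upper(1) _ that])
      (use \<phi>ul envelope_bounds(3) UD in \<open>blast intro: order_trans\<close>)
  show "Dt \<phi> \<theta>0 + Lop m n \<delta> \<phi> \<theta>0 \<le> 0"
  proof (cases "ul \<theta>0 = \<psi>u \<theta>0")
    case True
    \<comment> \<open>Here the lower envelope leaves no room below \<open>\<psi>u\<close>, but
      \<phi> touches \<open>\<psi>u\<close> from below at the same point.\<close>
    show ?thesis by (rule visc_supersolutionD[OF upper(2) \<theta>0 \<phi>]) (use True eq \<phi>u UD in auto)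
  next
    case False
    then have d: "0 < (\<psi>u \<theta>0 - \<phi> \<theta>0) / 2" using envelope_bounds(3)[OF UD[OF \<theta>0]] eq by simp
    \<comment> \<open>Half of the gap to \<open>\<psi>u\<close> at \<theta>0, so that by continuity
      the gap exceeds d on an open neighbourhood.\<close>
    define d where "d = (\<psi>u \<theta>0 - \<phi> \<theta>0) / 2"
    define S where "S = U \<inter> (\<lambda>\<eta>. \<psi>u \<eta> - \<phi> \<eta>) -` {d<..}"
    have S: "open S" "\<theta>0 \<in> S"
    proof -
      show "open S" unfolding S_def
        by (intro continuous_open_preimage continuous_on_diff continuous_on_subset[OF upper(1) interior_subset]
          continuous_on_subset[OF p(7) interior_subset]) auto
      show "\<theta>0 \<in> S" using \<theta>0 d by (simp add: S_def d_def)
    qed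
    obtain c0 where c0: "c0 > 0" "\<And>c' \<theta>. c' \<le> c0 \<Longrightarrow> quart \<theta>0 \<theta> \<le> c' \<Longrightarrow> \<theta> \<in> U \<and> \<theta> \<in> S"
      using quart_sub_U[OF \<theta>0 S] by blast
    \<comment> \<open>The bound \<open>c0\<close> keeps the sublevel set inside S, and c \<le> 4d
      keeps the height c/4 of the bump within the gap.\<close>
    define C where "C = min c0 (4 * d)"
    have C: "C > 0" using c0(1) d by (simp add: C_def d_def)
    \<comment> \<open>The equation at the bump of size c, with the jump integral taken for \<phi>:
      on the landing face it is \<phi> that is compared with \<open>\<psi>u\<close>.\<close>
    define G where "G = (\<lambda>c \<theta>. Dt \<phi> \<theta> + (-1) * quartt \<theta>0 \<theta> +
      ham_sup m n \<theta> (\<phi> \<theta> + (c / 4 + (-1) * quart \<theta>0 \<theta>)) (Dx \<phi> \<theta> + (-1) * quartx \<theta>0 \<theta>)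
        (Dw \<phi> \<theta> + (-1) * quartw \<theta>0 \<theta>)
        (Dx (Dx \<phi>) \<theta> + (-1) * quartxx \<theta>0 \<theta>) (Dw (Dw \<phi>) \<theta> + (-1) * quartww \<theta>0 \<theta>)
        (Jop m \<delta> \<phi> \<theta> - (\<phi> \<theta> + (c / 4 + (-1) * quart \<theta>0 \<theta>))))"
    show ?thesis
    proof (rule ccontr)
      assume pos: "\<not> Dt \<phi> \<theta>0 + Lop m n \<delta> \<phi> \<theta>0 \<le> 0"
      define e where "e = (\<lambda>k. C / real (Suc k))"
      have e: "e k > 0" "e k \<le> C" "e k \<le> c0" for k
      proof -
        show "e k > 0" "e k \<le> C" using C by (auto simp: e_def field_simps)
        then show "e k \<le> c0" by (simp add: C_def)
      qed
      have e0: "e \<longlonglongrightarrow> 0" unfolding e_def by (rule inverse_Suc_scaled)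
      \<comment> \<open>Otherwise violating points converge to \<theta>0, and the non-strict
        inequality passes to the limit against the assumed positivity.\<close>
      have "\<exists>k. \<forall>\<theta>. quart \<theta>0 \<theta> \<le> e k \<longrightarrow> 0 < G (e k) \<theta>"
      proof (rule ccontr)
        assume "\<not> ?thesis"
        then have "\<forall>k. \<exists>\<theta>. quart \<theta>0 \<theta> \<le> e k \<and> G (e k) \<theta> \<le> 0" by (auto simp: not_less)
        then obtain \<theta> where \<theta>: "\<And>k. quart \<theta>0 (\<theta> k) \<le> e k" "\<And>k. G (e k) (\<theta> k) \<le> 0" by metis
        have lim: "\<theta> \<longlonglongrightarrow> \<theta>0" by (rule quart_seq_tendsto[OF \<theta>(1) e0])
        have \<theta>U: "\<theta> k \<in> U" for k using c0(2)[OF e(3) \<theta>(1)] by auto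
        have cU: "(\<lambda>k. f (\<theta> k)) \<longlonglongrightarrow> f \<theta>0" if "continuous_on U f" for f :: "pt \<Rightarrow> real"
          by (rule continuous_on_tendsto_compose[OF that lim \<theta>0]) (simp add: \<theta>U)
        have "(\<lambda>k. \<phi> (\<theta> k) + (e k / 4 + (-1) * quart \<theta>0 (\<theta> k))) \<longlonglongrightarrow> \<phi> \<theta>0 + (0 / 4 + (-1) * quart \<theta>0 \<theta>0)"
          by (intro tendsto_add tendsto_mult tendsto_divide tendsto_const e0 cU continuous_quart
            continuous_on_subset[OF p(7) interior_subset]) simp
        then have y: "(\<lambda>k. \<phi> (\<theta> k) + (e k / 4 + (-1) * quart \<theta>0 (\<theta> k))) \<longlonglongrightarrow> \<phi> \<theta>0" by simp
        have "(\<lambda>k. Jop m \<delta> (\<lambda>\<eta>. \<phi> \<eta> + (0 + 0 * 0)) (\<theta> k)) \<longlonglongrightarrow> Jop m \<delta> \<phi> \<theta>0"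
          by (rule Jop_tendsto[OF sd \<delta>(1) lim \<theta>0 \<theta>U p(7) continuous_on_const tendsto_const tendsto_const])
        then have z: "(\<lambda>k. Jop m \<delta> \<phi> (\<theta> k)) \<longlonglongrightarrow> Jop m \<delta> \<phi> \<theta>0" by simp
        have "Dt \<phi> \<theta>0 + Lop m n \<delta> \<phi> \<theta>0 \<le> 0"
          by (rule LIMSEQ_le_const2[OF operator_tendsto[OF \<phi> lim \<theta>0 \<theta>U tendsto_const y z]])
            (use \<theta>(2) in \<open>unfold G_def, blast\<close>)
        then show False using pos by simp
      qed
      then obtain c where c: "c > 0" "c \<le> C" "c \<le> c0" and G: "\<And>\<theta>. quart \<theta>0 \<theta> \<le> c \<Longrightarrow> 0 < G c \<theta>"
        using e by blast
      define \<psi> where "\<psi> = (\<lambda>\<theta>. \<phi> \<theta> + (c / 4 + (-1) * quart \<theta>0 \<theta>))"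
      have cU: "\<theta> \<in> U" "\<theta> \<in> S" if "quart \<theta>0 \<theta> \<le> c" for \<theta> using c0(2)[OF c(3) that] by auto
      have \<psi>cont: "continuous_on D \<psi>" unfolding \<psi>_def by (intro continuous_intros continuous_quart p(7))
      define A where "A = {\<theta>. quart \<theta>0 \<theta> \<le> c} \<inter> {\<theta>. c / 2 \<le> quart \<theta>0 \<theta>}"
      have cA: "compact A" unfolding A_def
        by (intro compact_Int_closed compact_quart_le closed_Collect_le continuous_quart continuous_intros)
      define O' where "O' = (\<lambda>v. U \<inter> (\<lambda>\<eta>. v \<eta> - \<psi> \<eta>) -` {0<..})"
      have "A \<subseteq> (\<Union>v\<in>\<F>. O' v)"
      proof
        fix \<theta> assume "\<theta> \<in> A"
        then have \<theta>: "quart \<theta>0 \<theta> \<le> c" "c / 2 \<le> quart \<theta>0 \<theta>" by (auto simp: A_def)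
        \<comment> \<open>On the annulus the quartic takes away at least c/2 and only c/4 is added,
          so \<psi> \<le> \<phi> - c/4.\<close>
        have "\<psi> \<theta> < u \<theta>"
          using \<phi>ul[OF cU(1)[OF \<theta>(1)]] ul_le_u[OF cU(1)[OF \<theta>(1)]] \<theta>(2) c(1) unfolding \<psi>_def by simp
        then obtain v where "v \<in> \<F>" "\<psi> \<theta> < v \<theta>" using less_u[OF UD[OF cU(1)[OF \<theta>(1)]]] by auto
        then show "\<theta> \<in> (\<Union>v\<in>\<F>. O' v)" using cU(1)[OF \<theta>(1)] by (auto simp: O'_def)
      qed
      moreover have "open (O' v)" if "v \<in> \<F>" for v
        unfolding O'_def
        by (intro continuous_open_preimage continuous_on_diff continuous_on_subset[OF family_D(1)[OF that] interior_subset]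
          continuous_on_subset[OF \<psi>cont interior_subset]) auto
      ultimately obtain X where X: "X \<subseteq> \<F>" "finite X" "A \<subseteq> (\<Union>v\<in>X. O' v)"
        using compactE_image[OF cA, of \<F> O'] by blast
      \<comment> \<open>Guards against an empty subcover, from which no dominating member could be
        formed.\<close>
      obtain v0 where v0: "v0 \<in> \<F>" using family_nonempty by auto
      obtain v where v: "v \<in> \<F>" "\<And>v' \<theta>. v' \<in> X \<Longrightarrow> v' \<theta> \<le> v \<theta>"
        using family_dominates[of "insert v0 X"] X(1,2) v0 by auto
      have ann: "\<psi> \<theta> < v \<theta>" if "c / 2 \<le> quart \<theta>0 \<theta>" "quart \<theta>0 \<theta> \<le> c" for \<theta>
      proof -
        have "\<theta> \<in> A" using that by (simp add: A_def)
        then obtain v' where "v' \<in> X" "\<psi> \<theta> < v' \<theta>" using X(3) by (auto simp: O'_def)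
        then show ?thesis using v(2)[of v' \<theta>] by simp
      qed
      have \<psi>_le: "\<psi> \<theta> \<le> \<psi>u \<theta>" if "quart \<theta>0 \<theta> \<le> c" for \<theta>
      proof -
        have "d < \<psi>u \<theta> - \<phi> \<theta>" "c / 4 \<le> d" using cU(2)[OF that] c(2) by (auto simp: S_def C_def)
        then show ?thesis using quart_nonneg[of \<theta>0 \<theta>] unfolding \<psi>_def by linarith
      qed
      have "\<exists>W\<in>\<F>. \<forall>\<theta>. quart \<theta>0 \<theta> \<le> c \<longrightarrow> \<psi> \<theta> \<le> W \<theta>"
      proof (rule bump_family[OF \<psi>_def v(1) \<phi> c(1) cU(1) \<phi>u \<psi>_le ann])
        fix \<theta> assume "quart \<theta>0 \<theta> \<le> c"
        from G[OF this] show "0 < Dt \<phi> \<theta> + (-1) * quartt \<theta>0 \<theta> +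
          ham_sup m n \<theta> (\<psi> \<theta>) (Dx \<phi> \<theta> + (-1) * quartx \<theta>0 \<theta>) (Dw \<phi> \<theta> + (-1) * quartw \<theta>0 \<theta>)
            (Dx (Dx \<phi>) \<theta> + (-1) * quartxx \<theta>0 \<theta>) (Dw (Dw \<phi>) \<theta> + (-1) * quartww \<theta>0 \<theta>)
            (Jop m \<delta> \<phi> \<theta> - \<psi> \<theta>)"
          unfolding G_def \<psi>_def .
      qed
      then obtain W where W: "W \<in> \<F>" "\<And>\<theta>. quart \<theta>0 \<theta> \<le> c \<Longrightarrow> \<psi> \<theta> \<le> W \<theta>"
        by blast
      \<comment> \<open>At the centre the bump exceeds \<open>ul \<theta>0\<close> by c/4. At the
        point \<eta> below, \<psi> has lost less than c/8 and \<open>u\<close> exceeds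
        \<open>ul \<theta>0\<close> by less than c/8, so \<psi> \<le> W \<le> u fails there.\<close>
      have "c / 8 > 0" using c(1) by simp
      from continuous_near[OF \<psi>cont UD[OF \<theta>0] this] obtain d1 where
        d1: "d1 > 0" "\<And>\<eta>. \<eta> \<in> D \<Longrightarrow> dist \<eta> \<theta>0 \<le> d1 \<Longrightarrow> \<bar>\<psi> \<eta> - \<psi> \<theta>0\<bar> < c / 8" by blast
      from continuous_near[OF continuous_quart(1) UD[OF \<theta>0] c(1)] obtain d2 where
        d2: "d2 > 0" "\<And>\<eta>. \<eta> \<in> D \<Longrightarrow> dist \<eta> \<theta>0 \<le> d2 \<Longrightarrow> \<bar>quart \<theta>0 \<eta> - quart \<theta>0 \<theta>0\<bar> < c" by blast
      obtain \<eta> where \<eta>: "\<eta> \<in> U" "dist \<eta> \<theta>0 \<le> min d1 d2" "u \<eta> < ul \<theta>0 + c / 8"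
        using envelope_less(4)[OF UD[OF \<theta>0], of "ul \<theta>0 + c / 8" "min d1 d2"] c(1) d1(1) d2(1) by auto
      have "quart \<theta>0 \<eta> \<le> c" using d2(2)[OF UD[OF \<eta>(1)]] \<eta>(2) by simp
      from order_trans[OF W(2)[OF this] family_le_u[OF W(1) UD[OF \<eta>(1)]]] have "\<psi> \<eta> \<le> u \<eta>" .
      moreover have "\<bar>\<psi> \<eta> - \<psi> \<theta>0\<bar> < c / 8" using \<eta>(2) by (intro d1(2) UD \<eta>(1)) simp
      moreover have "\<psi> \<theta>0 = ul \<theta>0 + c / 4" using eq by (simp add: \<psi>_def)
      ultimately show False using \<eta>(3) c(1) by linarith
    qed
  qed
qed

end

theorem theorem3p4:
  fixes m :: model and n :: nat and \<delta> :: real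
    and \<Psi> \<psi>l \<psi>u u :: "real \<times> real \<times> real \<Rightarrow> real"
    and \<F> :: "(real \<times> real \<times> real \<Rightarrow> real) set"
  assumes "standing_data m"
    and "n \<ge> 1" and "0 < \<delta>" and "\<delta> < 1"
    and "Psi_conditions m \<Psi>"
    and "continuous_on (Dom m \<delta>) \<psi>l" and "visc_subsolution m n \<delta> \<psi>l" and "class_Psi m \<delta> \<Psi> \<psi>l"
    and "continuous_on (Dom m \<delta>) \<psi>u" and "visc_supersolution m n \<delta> \<psi>u" and "class_Psi m \<delta> \<Psi> \<psi>u"
    and "\<F> = perron_family m n \<delta> \<Psi> \<psi>l \<psi>u" and "\<F> \<noteq> {}"
    and "\<forall>\<theta>\<in>Dom m \<delta>. u \<theta> = (SUP v\<in>\<F>. v \<theta>)"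
  shows "visc_subsolution m n \<delta> (upper_envelope m \<delta> \<Psi> u) \<and>
         class_Psi m \<delta> \<Psi> (upper_envelope m \<delta> \<Psi> u) \<and>
         visc_supersolution m n \<delta> (lower_envelope m \<delta> \<Psi> u) \<and>
         class_Psi m \<delta> \<Psi> (lower_envelope m \<delta> \<Psi> u)"
proof -
  have "0 \<le> \<Psi> \<theta>" if "\<theta> \<in> Dom m \<delta>" for \<theta>
  proof -
    have "\<theta> \<in> Dom m 1" using that assms(4) by (cases \<theta>) (auto simp: Dom_def)
    then show ?thesis using assms(5) unfolding Psi_conditions_def by blast
  qed
  then interpret perron m n \<delta> \<Psi> \<psi>l \<psi>u u
    using assms by unfold_locales auto
  show ?thesis using visc_subsolution_us class_Psi_us visc_supersolution_ul class_Psi_ul by blast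
qed

end
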